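(* Let $K$ be a sequentially compact and compact Hausdorff space. Then the dual weak essential norm $T\mapsto\|T^*\|_w$ is minimal on the weak Calkin algebra $\mathscr{B}(C(K))/\mathscr{W}(C(K))$; that is, for every algebra norm $|||\cdot|||$ on $\mathscr{B}(C(K))/\mathscr{W}(C(K))$ there is a constant $c>0$ such that $c\,\|T^*\|_w\le|||T+\mathscr{W}(C(K))|||$ for all $T\in\mathscr{B}(C(K))$.
   Context: Scalars are real or complex. For a Banach space $E$, $\mathscr{B}(E)$ is the algebra of bounded linear operators on $E$ and $\mathscr{W}(E)$ is the ideal of weakly compact operators (those mapping the unit ball to a relatively weakly compact set). For $R\in\mathscr{B}(E)$, $\|R\|_w=\inf\{\|R-W\|: W\in\mathscr{W}(E)\}$. Thus $\|T^*\|_w$ is the distance of $T^*\in\mathscr{B}(C(K)^* )$ to $\mathscr{W}(C(K)^* )$; it depends only on the class of $T$ modulo $\mathscr{W}(C(K))$ and induces an algebra norm on the weak Calkin algebra. An algebra norm on an algebra is a submultiplicative norm (completeness is not assumed). *)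

theory Defs
  imports "HOL-Analysis.Analysis" "HOL-Algebra.QuotRing" "HOL-Algebra.Module"
begin

section \<open>Bounded operators over the scalar field\<close>

text \<open>
  The scalar field is a type \<open>'s\<close>, used below for \<open>real\<close> and \<open>complex\<close> only. The type
  \<open>'e \<Rightarrow>\<^sub>L 'e\<close> consists of real-linear maps, so a normed space over \<open>'s\<close> is given by a type \<open>'e\<close>
  together with its scalar multiplication \<open>sc :: 's \<Rightarrow> 'e \<Rightarrow> 'e\<close>, and linearity is imposed with
  respect to \<open>sc\<close>. The operator norm does not depend on the scalar field.
\<close>

definition bounded_operators :: "('s::real_normed_field \<Rightarrow> 'e::real_normed_vector \<Rightarrow> 'e) \<Rightarrow> ('e \<Rightarrow>\<^sub>L 'e) set"
  where "bounded_operators sc = {T. Vector_Spaces.linear sc sc (blinfun_apply T)}"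

definition bounded_functionals :: "('s::real_normed_field \<Rightarrow> 'e::real_normed_vector \<Rightarrow> 'e) \<Rightarrow> ('e \<Rightarrow>\<^sub>L 's) set"
  where "bounded_functionals sc = {\<phi>. Vector_Spaces.linear sc (*) (blinfun_apply \<phi>)}"

definition weak_topology :: "('s::real_normed_field \<Rightarrow> 'e::real_normed_vector \<Rightarrow> 'e) \<Rightarrow> 'e topology"
  where "weak_topology sc =
    topology_generated_by {blinfun_apply \<phi> -` U | \<phi> U. \<phi> \<in> bounded_functionals sc \<and> open U}"

definition weakly_compact_operators ::
    "('s::real_normed_field \<Rightarrow> 'e::real_normed_vector \<Rightarrow> 'e) \<Rightarrow> ('e \<Rightarrow>\<^sub>L 'e) set"
  where "weakly_compact_operators sc =
    {W \<in> bounded_operators sc.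
      compactin (weak_topology sc) (weak_topology sc closure_of (blinfun_apply W ` cball 0 1))}"

definition weak_ess_norm ::
    "('s::real_normed_field \<Rightarrow> 'e::real_normed_vector \<Rightarrow> 'e) \<Rightarrow> ('e \<Rightarrow>\<^sub>L 'e) \<Rightarrow> real"
  where "weak_ess_norm sc R = (INF W \<in> weakly_compact_operators sc. norm (R - W))"


section \<open>The weak Calkin algebra and algebra norms\<close>

definition operator_algebra ::
    "('s::real_normed_field \<Rightarrow> 'e::real_normed_vector \<Rightarrow> 'e) \<Rightarrow> ('s, 'e \<Rightarrow>\<^sub>L 'e) module"
  where "operator_algebra sc =
    \<lparr>carrier = bounded_operators sc, mult = (o\<^sub>L), one = id_blinfun, zero = 0, add = (+),
     smult = (\<lambda>c T. Blinfun (\<lambda>x. sc c (blinfun_apply T x)))\<rparr>"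

text \<open>
  The library quotient \<open>Quot\<close> only yields a ring; the induced scalar multiplication on cosets is
  added here in the style of \<^const>\<open>rcoset_mult\<close>.
\<close>

definition quotient_algebra :: "('s, 'a) module \<Rightarrow> 'a set \<Rightarrow> ('s, 'a set) module"
  where "quotient_algebra A I =
    ring.extend (A Quot I) (module.fields (\<lambda>c X. \<Union>x\<in>X. I +>\<^bsub>A\<^esub> (c \<odot>\<^bsub>A\<^esub> x)))"

abbreviation weak_Calkin_algebra ::
    "('s::real_normed_field \<Rightarrow> 'e::real_normed_vector \<Rightarrow> 'e) \<Rightarrow> ('s, ('e \<Rightarrow>\<^sub>L 'e) set) module"
  where "weak_Calkin_algebra sc \<equiv>
    quotient_algebra (operator_algebra sc) (weakly_compact_operators sc)"

abbreviation weak_Calkin_class ::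
    "('s::real_normed_field \<Rightarrow> 'e::real_normed_vector \<Rightarrow> 'e) \<Rightarrow> ('e \<Rightarrow>\<^sub>L 'e) \<Rightarrow> ('e \<Rightarrow>\<^sub>L 'e) set"
  where "weak_Calkin_class sc T \<equiv> weakly_compact_operators sc +>\<^bsub>operator_algebra sc\<^esub> T"

definition algebra_norm :: "('s::real_normed_field, 'a) module \<Rightarrow> ('a \<Rightarrow> real) \<Rightarrow> bool"
  where "algebra_norm A N \<longleftrightarrow>
    (\<forall>x\<in>carrier A. 0 \<le> N x \<and> (N x = 0 \<longleftrightarrow> x = \<zero>\<^bsub>A\<^esub>)) \<and>
    (\<forall>c. \<forall>x\<in>carrier A. N (c \<odot>\<^bsub>A\<^esub> x) = norm c * N x) \<and>
    (\<forall>x\<in>carrier A. \<forall>y\<in>carrier A. N (x \<oplus>\<^bsub>A\<^esub> y) \<le> N x + N y) \<and>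
    (\<forall>x\<in>carrier A. \<forall>y\<in>carrier A. N (x \<otimes>\<^bsub>A\<^esub> y) \<le> N x * N y)"


section \<open>The space of continuous functions, its dual, and adjoints\<close>

text \<open>For compact \<open>'k\<close>, the type \<open>'k \<Rightarrow>\<^sub>C 's\<close> is the space of all continuous functions.\<close>

definition bcontfun_scale ::
    "'s::real_normed_field \<Rightarrow> ('k::topological_space \<Rightarrow>\<^sub>C 's) \<Rightarrow> ('k \<Rightarrow>\<^sub>C 's)"
  where "bcontfun_scale c f = Bcontfun (\<lambda>x. c * f x)"

lemma apply_bcontfun_scale [simp]: "apply_bcontfun (bcontfun_scale c f) x = c * f x"
proof -
  have "(\<lambda>x. c * f x) \<in> bcontfun"
    by (rule bcontfun_normI[where b = "norm c * norm f"])
      (auto intro!: continuous_intros mult_left_mono norm_bounded simp: norm_mult)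
  then show ?thesis
    by (simp add: bcontfun_scale_def Bcontfun_inverse)
qed

lemma vector_space_bcontfun_scale: "vector_space bcontfun_scale"
  by standard (auto intro!: bcontfun_eqI simp: algebra_simps)

lemma bounded_functionals_bcontfun_iff:
  "\<phi> \<in> bounded_functionals bcontfun_scale \<longleftrightarrow> (\<forall>c f. \<phi> (bcontfun_scale c f) = c * \<phi> f)"
proof -
  have "vector_space ((*) :: 's \<Rightarrow> 's \<Rightarrow> 's::real_normed_field)"
    by standard (auto simp: algebra_simps)
  then show ?thesis
    unfolding bounded_functionals_def Vector_Spaces.linear_iff
    by (auto simp: vector_space_bcontfun_scale blinfun.add_right)
qed

lemma bounded_functionals_bcontfun_0: "0 \<in> bounded_functionals bcontfun_scale"
  by (simp add: bounded_functionals_bcontfun_iff)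

typedef (overloaded) ('k, 's) bcontfun_dual =
  "bounded_functionals (bcontfun_scale :: 's \<Rightarrow> ('k::topological_space \<Rightarrow>\<^sub>C 's::real_normed_field) \<Rightarrow> _)"
  morphisms functional_of Functional
  using bounded_functionals_bcontfun_0 by blast

setup_lifting type_definition_bcontfun_dual

instantiation bcontfun_dual :: (topological_space, real_normed_field) real_normed_vector
begin

lift_definition zero_bcontfun_dual :: "('a, 'b) bcontfun_dual" is 0
  by (rule bounded_functionals_bcontfun_0)

lift_definition plus_bcontfun_dual ::
    "('a, 'b) bcontfun_dual \<Rightarrow> ('a, 'b) bcontfun_dual \<Rightarrow> ('a, 'b) bcontfun_dual" is "(+)"
  by (simp add: bounded_functionals_bcontfun_iff blinfun.add_left algebra_simps)

lift_definition minus_bcontfun_dual ::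
    "('a, 'b) bcontfun_dual \<Rightarrow> ('a, 'b) bcontfun_dual \<Rightarrow> ('a, 'b) bcontfun_dual" is "(-)"
  by (simp add: bounded_functionals_bcontfun_iff blinfun.diff_left algebra_simps)

lift_definition uminus_bcontfun_dual :: "('a, 'b) bcontfun_dual \<Rightarrow> ('a, 'b) bcontfun_dual" is uminus
  by (simp add: bounded_functionals_bcontfun_iff blinfun.minus_left)

lift_definition scaleR_bcontfun_dual ::
    "real \<Rightarrow> ('a, 'b) bcontfun_dual \<Rightarrow> ('a, 'b) bcontfun_dual" is scaleR
  by (simp add: bounded_functionals_bcontfun_iff blinfun.scaleR_left)

lift_definition norm_bcontfun_dual :: "('a, 'b) bcontfun_dual \<Rightarrow> real" is norm .

definition dist_bcontfun_dual :: "('a, 'b) bcontfun_dual \<Rightarrow> ('a, 'b) bcontfun_dual \<Rightarrow> real"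
  where "dist_bcontfun_dual \<phi> \<psi> = norm (\<phi> - \<psi>)"

definition sgn_bcontfun_dual :: "('a, 'b) bcontfun_dual \<Rightarrow> ('a, 'b) bcontfun_dual"
  where "sgn_bcontfun_dual \<phi> = scaleR (inverse (norm \<phi>)) \<phi>"

definition uniformity_bcontfun_dual ::
    "(('a, 'b) bcontfun_dual \<times> ('a, 'b) bcontfun_dual) filter"
  where "uniformity_bcontfun_dual = (INF e\<in>{0 <..}. principal {(x, y). dist x y < e})"

definition open_bcontfun_dual :: "('a, 'b) bcontfun_dual set \<Rightarrow> bool"
  where "open_bcontfun_dual S = (\<forall>x\<in>S. \<forall>\<^sub>F (x', y) in uniformity. x' = x \<longrightarrow> y \<in> S)"

instance
proof
  fix a b :: real and x y z :: "('a, 'b) bcontfun_dual"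
  show "x + y + z = x + (y + z)" by transfer (simp add: add.assoc)
  show "x + y = y + x" by transfer (simp add: add.commute)
  show "0 + x = x" by transfer simp
  show "- x + x = 0" by transfer simp
  show "x - y = x + - y" by transfer simp
  show "a *\<^sub>R (x + y) = a *\<^sub>R x + a *\<^sub>R y" by transfer (simp add: scaleR_right_distrib)
  show "(a + b) *\<^sub>R x = a *\<^sub>R x + b *\<^sub>R x" by transfer (simp add: scaleR_left_distrib)
  show "a *\<^sub>R b *\<^sub>R x = (a * b) *\<^sub>R x" by transfer simp
  show "1 *\<^sub>R x = x" by transfer simp
  show "norm x = 0 \<longleftrightarrow> x = 0" by transfer simp
  show "norm (x + y) \<le> norm x + norm y" by transfer (rule norm_triangle_ineq)
  show "norm (a *\<^sub>R x) = \<bar>a\<bar> * norm x" by transfer simp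
qed (simp_all add: dist_bcontfun_dual_def sgn_bcontfun_dual_def uniformity_bcontfun_dual_def
    open_bcontfun_dual_def)

end

lift_definition dual_scale ::
    "'s::real_normed_field \<Rightarrow> ('k::topological_space, 's) bcontfun_dual \<Rightarrow> ('k, 's) bcontfun_dual"
  is "\<lambda>c \<phi>. Blinfun (\<lambda>f. c * blinfun_apply \<phi> f)"
  by (simp add: bounded_functionals_bcontfun_iff bounded_linear_Blinfun_apply
      bounded_linear_const_mult blinfun.bounded_linear_right)

lemma functional_of_dual_scale [simp]: "functional_of (dual_scale c \<phi>) f = c * functional_of \<phi> f"
  by transfer (simp add: bounded_linear_Blinfun_apply bounded_linear_const_mult
      blinfun.bounded_linear_right)

lemma vector_space_dual_scale: "vector_space dual_scale"
  by standard (auto intro!: blinfun_eqI simp: functional_of_inject[symmetric] plus_bcontfun_dual.rep_eq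
      blinfun.add_left algebra_simps)

text \<open>
  The functional \<open>\<phi> \<circ> T\<close> lies in the dual only if \<open>T\<close> is linear over \<open>'s\<close>, so the adjoint is
  meaningful only for members of \<open>bounded_operators bcontfun_scale\<close>.
\<close>

definition adjoint_operator ::
    "(('k::topological_space \<Rightarrow>\<^sub>C 's::real_normed_field) \<Rightarrow>\<^sub>L ('k \<Rightarrow>\<^sub>C 's)) \<Rightarrow>
     (('k, 's) bcontfun_dual \<Rightarrow>\<^sub>L ('k, 's) bcontfun_dual)"
  where "adjoint_operator T = Blinfun (\<lambda>\<phi>. Functional (functional_of \<phi> o\<^sub>L T))"

lemma functional_of_adjoint_operator:
  fixes T :: "('a::topological_space \<Rightarrow>\<^sub>C 'b::real_normed_field) \<Rightarrow>\<^sub>L ('a \<Rightarrow>\<^sub>C 'b)"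
  assumes "T \<in> bounded_operators bcontfun_scale"
  shows "functional_of (adjoint_operator T \<phi>) f = functional_of \<phi> (T f)"
proof -
  have T: "T (bcontfun_scale c f) = bcontfun_scale c (T f)" for c f
    using assms by (simp add: bounded_operators_def Vector_Spaces.linear_iff)
  have F: "functional_of (Functional (functional_of \<phi> o\<^sub>L T)) = functional_of \<phi> o\<^sub>L T" for \<phi>
    using functional_of[of \<phi>]
    by (intro Functional_inverse) (simp add: bounded_functionals_bcontfun_iff T)
  have "bounded_linear (\<lambda>\<phi>. Functional (functional_of \<phi> o\<^sub>L T))"
  proof (rule bounded_linear_intro[where K = "norm T"])
    show "norm (Functional (functional_of \<phi> o\<^sub>L T)) \<le> norm \<phi> * norm T" for \<phi>
      by (simp add: norm_bcontfun_dual.rep_eq F norm_blinfun_compose)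
  next
    fix \<phi> \<psi> :: "('a, 'b) bcontfun_dual" and r :: real
    let ?A = "\<lambda>\<phi>. Functional (functional_of \<phi> o\<^sub>L T)"
    have "functional_of (?A (\<phi> + \<psi>)) = functional_of (?A \<phi> + ?A \<psi>)"
      unfolding F unfolding plus_bcontfun_dual.rep_eq
      by (rule blinfun_eqI) (simp add: F blinfun.add_left)
    then show "?A (\<phi> + \<psi>) = ?A \<phi> + ?A \<psi>"
      by (simp only: functional_of_inject)
    have "functional_of (?A (r *\<^sub>R \<phi>)) = functional_of (r *\<^sub>R ?A \<phi>)"
      unfolding F unfolding scaleR_bcontfun_dual.rep_eq
      by (rule blinfun_eqI) (simp add: F blinfun.scaleR_left)
    then show "?A (r *\<^sub>R \<phi>) = r *\<^sub>R ?A \<phi>"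
      by (simp only: functional_of_inject)
  qed
  then show ?thesis
    by (simp add: adjoint_operator_def bounded_linear_Blinfun_apply F)
qed

end

theory Submission
  imports Defs
begin

text \<open>
  The proof consists of a quantitative factorisation of the identity of the space of null sequences
  through operators that are far from being weakly compact, and of a gliding hump argument which turns
  the factorisation into a lower bound for an arbitrary algebra norm.

  \<^bold>\<open>Factorisation.\<close> Let \<open>T\<close> be an operator on \<open>C(K)\<close> and \<open>C \<ge> 0\<close>. Suppose first that
  \<open>|T f x| \<le> \<mu> |f| + C \<parallel>f\<parallel>\<close> for a positive measure \<open>\<mu>\<close>. By the Hahn-Banach theorem, each functional
  \<open>f \<mapsto> T f x\<close> is the sum of one with variation at most \<open>\<mu>\<close> and one with norm at most \<open>C\<close>
  (\<open>split_functional\<close>). Partitions of unity on \<open>K\<close> glue the first summands to an operator \<open>R\<close> on the dual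
  which is within \<open>C\<close> of the adjoint of \<open>T\<close> and maps the unit ball into the order interval of \<open>\<mu>\<close>. As
  order intervals of measures are weakly compact (\<open>compactin_order_interval\<close>), the dual weak essential
  norm of \<open>T\<close> is at most \<open>C\<close> (\<open>weak_ess_norm_adjoint_le\<close>).

  If no \<open>\<mu>\<close> has this property, then the total variations of the functionals \<open>f \<mapsto> T f x\<close> that violate
  it for larger and larger \<open>\<mu>\<close> have a pointwise cluster point \<open>m\<close>. Since multiples of \<open>m\<close> are admissible
  as \<open>\<mu>\<close>, there are functions with values in \<open>[0, 1]\<close> on which \<open>m\<close> is as small as desired, but on which
  a variation close to \<open>m\<close> exceeds \<open>C\<close>. A sequence of such functions can be made disjoint, and it yields
  disjoint \<open>g n\<close> in the unit ball and points \<open>x n\<close> with \<open>|T (g n) (x n)| > C / 2\<close>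
  (\<open>undominated_operator_disjoint_sequence\<close>). Here sequential compactness of \<open>K\<close> enters: when \<open>x n\<close>
  converges to \<open>l\<close>, the functionals \<open>\<delta>(x n) - \<delta>(l)\<close> tend to zero pointwise, and along a subsequence
  they invert \<open>T\<close> on the span of the \<open>g n\<close> up to rapidly decreasing errors
  (\<open>essential_operator_fixes_null_sequences\<close>). The constants depend only on the dual weak essential
  norm.

  \<^bold>\<open>Minimality.\<close> If an algebra norm \<open>N\<close> violated the claim, there would be operators \<open>T k\<close> with
  \<open>N (T k)\<close> much smaller than the dual weak essential norm. The maps that factor the null sequences
  through all the \<open>T k\<close> can be combined, on infinitely many blocks of null sequences, into two single
  operators \<open>A\<close> and \<open>B\<close>. From \<open>B \<circ> T k \<circ> A\<close> the \<open>k\<close>-th block is extracted by operators that are known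
  before \<open>T k\<close> is chosen, and modulo weakly compact operators the outcome is a multiple of one projection
  \<open>P\<close> that is not weakly compact. Submultiplicativity then forces \<open>N P = 0\<close>, which is absurd
  (\<open>dual_weak_essential_norm_minimal\<close>).
\<close>

section \<open>Scalars\<close>

text \<open>
  The reals and the complex numbers are treated together as the sort
  \<open>{real_normed_field, euclidean_space}\<close>; the real part of \<open>z\<close> is \<open>inner z 1\<close>, and on both
  fields the following is complex conjugation.
\<close>

definition conjugate :: "'s::{real_normed_field,euclidean_space} \<Rightarrow> 's"
  where "conjugate z = of_real ((norm z)\<^sup>2) / z"

lemma inner_mult_left_mult_left:
  fixes u x y :: "'s::{real_normed_field,euclidean_space}"
  shows "inner (u * x) (u * y) = (norm u)\<^sup>2 * inner x y"
proof -
  have polarization: "4 * inner a b = (norm (a + b))\<^sup>2 - (norm (a - b))\<^sup>2" for a b :: 's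
    by (simp add: power2_norm_eq_inner inner_add inner_diff inner_commute)
  then have "4 * inner (u * x) (u * y) = (norm (u * (x + y)))\<^sup>2 - (norm (u * (x - y)))\<^sup>2"
    by (simp only: distrib_left right_diff_distrib)
  also have "\<dots> = (norm u)\<^sup>2 * ((norm (x + y))\<^sup>2 - (norm (x - y))\<^sup>2)"
    unfolding norm_mult power_mult_distrib by (rule right_diff_distrib[symmetric])
  also have "\<dots> = (norm u)\<^sup>2 * (4 * inner x y)"
    using polarization[of x y] by simp
  finally show ?thesis by simp
qed

lemma inner_mult_one:
  fixes c z :: "'s::{real_normed_field,euclidean_space}"
  shows "inner (c * z) 1 = inner c (conjugate z)"
proof (cases "z = 0")
  case False
  have "inner (c * z) 1 = inner (z * c) (z * (1 / z))"
    using False by (simp add: mult.commute)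
  also have "\<dots> = (norm z)\<^sup>2 * inner c (1 / z)"
    by (rule inner_mult_left_mult_left)
  also have "\<dots> = inner c ((norm z)\<^sup>2 *\<^sub>R (1 / z))"
    by simp
  finally show ?thesis
    by (simp add: conjugate_def scaleR_conv_of_real)
qed (simp add: conjugate_def)

lemma conjugate_conjugate [simp]: "conjugate (conjugate z) = z"
proof (cases "z = 0")
  case False
  have "norm (conjugate z) = norm z"
    using False by (simp add: conjugate_def norm_divide norm_power power2_eq_square flip: of_real_mult)
  then have "conjugate (conjugate z) = of_real ((norm z)\<^sup>2) / (of_real ((norm z)\<^sup>2) / z)"
    by (simp add: conjugate_def)
  with False show ?thesis by simp
qed (simp add: conjugate_def)

lemma norm_inner_one_le: "\<bar>inner z 1\<bar> \<le> norm (z :: 's::{real_normed_field,euclidean_space})"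
  using Cauchy_Schwarz_ineq2[of z 1] by simp

lemma inner_of_real_one [simp]:
  "inner (of_real r :: 's::{real_normed_field,euclidean_space}) 1 = r"
  by (simp add: of_real_def dot_square_norm)

lemma obtain_phase:
  fixes z :: "'s::{real_normed_field,euclidean_space}"
  obtains u :: 's where "norm u = 1" "u * z = of_real (norm z)"
proof (cases "z = 0")
  case False
  then show ?thesis by (intro that[of "of_real (norm z) / z"]) (simp_all add: norm_divide)
qed (use that[of 1] in simp)

lemma eq_zero_if_inner_one:
  fixes z :: "'s::{real_normed_field,euclidean_space}"
  assumes "\<And>c. inner (c * z) 1 = 0" shows "z = 0"
proof -
  obtain u where "u * z = of_real (norm z)" by (rule obtain_phase)
  with assms[of u] show ?thesis by simp
qed

lemma norm_le_if_inner_one_le: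
  fixes z :: "'s::{real_normed_field,euclidean_space}"
  assumes "\<And>u. norm u = 1 \<Longrightarrow> inner (u * z) 1 \<le> b" shows "norm z \<le> b"
proof -
  obtain u where "norm u = 1" "u * z = of_real (norm z)" by (rule obtain_phase)
  with assms[of u] show ?thesis by simp
qed

text \<open>
  Riesz representation on the scalar field: every real-linear functional of a scalar \<open>c\<close> is the
  real part of \<open>c * z\<close> for exactly one \<open>z\<close>. Scalar-linear functionals are built from real-linear
  ones in this way.
\<close>

lemma real_part_determines_functional:
  fixes L :: "'s::{real_normed_field,euclidean_space} \<Rightarrow> real"
  assumes "linear L"
  shows "\<exists>!z. \<forall>c. inner (c * z) 1 = L c"
proof -
  obtain v where v: "inner c v = L c" for c
    using adjoint_works[OF assms, of _ 1] by (metis inner_commute inner_real_def mult.right_neutral)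
  show ?thesis
  proof
    show "\<forall>c. inner (c * conjugate v) 1 = L c"
      by (simp add: inner_mult_one v)
  next
    fix z assume "\<forall>c. inner (c * z) 1 = L c"
    then have "inner (c * (z - conjugate v)) 1 = 0" for c
      by (simp add: right_diff_distrib inner_diff_left) (simp add: inner_mult_one v)
    then show "z = conjugate v"
      using eq_zero_if_inner_one[of "z - conjugate v"] by simp
  qed
qed

section \<open>Continuous functions on a compact space\<close>

text \<open>
  A Cauchy sequence for the supremum distance converges uniformly, over any topological space.
  Completeness is what allows operators on \<open>C(K)\<close> to be given by series.
\<close>

instance bcontfun :: (topological_space, complete_space) complete_space
proof
  fix f :: "nat \<Rightarrow> ('a, 'b) bcontfun"
  assume "Cauchy f"
  then obtain g where "uniform_limit UNIV f g sequentially"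
    using uniformly_convergent_eq_cauchy[of "\<lambda>_. True" f]
    unfolding Cauchy_def uniform_limit_sequentially_iff
    by (metis dist_fun_lt_imp_dist_val_lt)
  from uniform_limit_bcontfunE[OF this sequentially_bot]
  obtain l' where "g = apply_bcontfun l'" "f \<longlonglongrightarrow> l'" by metis
  then show "convergent f" by (intro convergentI)
qed

instance bcontfun :: (topological_space, banach) banach ..

lemma compact_bcontfun:
  fixes f :: "'k::topological_space \<Rightarrow> 'b::real_normed_vector"
  assumes "compact (UNIV :: 'k set)" "continuous_on UNIV f"
  shows "f \<in> bcontfun"
  using assms by (simp add: bcontfun_def compact_imp_bounded compact_continuous_image)

lemma apply_Bcontfun_compact:
  fixes f :: "'k::topological_space \<Rightarrow> 'b::real_normed_vector"
  assumes "compact (UNIV :: 'k set)" "continuous_on UNIV f"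
  shows "apply_bcontfun (Bcontfun f) = f"
  using compact_bcontfun[OF assms] by (rule Bcontfun_inverse)

lemma norm_bcontfun_scale:
  fixes f :: "'k::topological_space \<Rightarrow>\<^sub>C 's::real_normed_field"
  shows "norm (bcontfun_scale c f) = norm c * norm f"
proof (rule antisym)
  show "norm (bcontfun_scale c f) \<le> norm c * norm f"
    by (rule norm_bound) (simp add: norm_mult mult_left_mono norm_bounded)
  show "norm c * norm f \<le> norm (bcontfun_scale c f)"
  proof (cases "c = 0")
    case False
    have "norm f \<le> norm (bcontfun_scale c f) / norm c"
    proof (rule norm_bound)
      show "norm (f x) \<le> norm (bcontfun_scale c f) / norm c" for x
        using norm_bounded[of "bcontfun_scale c f" x] False by (simp add: norm_mult field_simps)
    qed
    then show ?thesis using False by (simp add: field_simps)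
  qed simp
qed

lemma bcontfun_scale_of_real: "bcontfun_scale (of_real r) f = r *\<^sub>R f"
  by (rule bcontfun_eqI) (simp add: scaleR_conv_of_real)

type_synonym ('k, 's) operator = "('k \<Rightarrow>\<^sub>C 's) \<Rightarrow>\<^sub>L ('k \<Rightarrow>\<^sub>C 's)"
type_synonym ('k, 's) functional = "('k \<Rightarrow>\<^sub>C 's) \<Rightarrow>\<^sub>L 's"

lemma bounded_operators_bcontfun_iff:
  "T \<in> bounded_operators bcontfun_scale \<longleftrightarrow> (\<forall>c f. T (bcontfun_scale c f) = bcontfun_scale c (T f))"
  unfolding bounded_operators_def Vector_Spaces.linear_iff
  by (auto simp: vector_space_bcontfun_scale blinfun.add_right)

lemma bounded_functional_scale:
  "\<phi> \<in> bounded_functionals bcontfun_scale \<Longrightarrow> \<phi> (bcontfun_scale c f) = c * \<phi> f"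
  by (simp add: bounded_functionals_bcontfun_iff)

lemma bounded_operator_scale:
  "T \<in> bounded_operators bcontfun_scale \<Longrightarrow> T (bcontfun_scale c f) = bcontfun_scale c (T f)"
  by (simp add: bounded_operators_bcontfun_iff)

lemma apply_bcontfun_sum:
  "apply_bcontfun (\<Sum>i\<in>A. h i) x = (\<Sum>i\<in>A. apply_bcontfun (h i) x)"
  by (induction A rule: infinite_finite_induct) auto

definition point_evaluation :: "'k::topological_space \<Rightarrow> ('k, 's::real_normed_field) functional"
  where "point_evaluation x = Blinfun (\<lambda>f. apply_bcontfun f x)"

lemma point_evaluation_apply [simp]:
  fixes f :: "'k::topological_space \<Rightarrow>\<^sub>C 's::real_normed_field"
  shows "point_evaluation x f = f x"
proof -
  have "bounded_linear (\<lambda>f :: 'k \<Rightarrow>\<^sub>C 's. apply_bcontfun f x)"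
    by (rule bounded_linear_intro[where K = 1]) (auto simp: norm_bounded)
  then show ?thesis by (simp add: point_evaluation_def bounded_linear_Blinfun_apply)
qed

lemma point_evaluation_in_functionals: "point_evaluation x \<in> bounded_functionals bcontfun_scale"
  by (simp add: bounded_functionals_bcontfun_iff)

lemma norm_point_evaluation_le: "norm (point_evaluation x) \<le> 1"
  by (rule norm_blinfun_bound) (auto simp: norm_bounded)

section \<open>Positive functionals\<close>

text \<open>
  Positive measures as functionals on plain functions, so that expressions such as
  \<open>\<mu> (\<lambda>x. norm (f x))\<close> need no packaging; the values at discontinuous functions carry no meaning.
\<close>

definition positive_functional :: "(('k::topological_space \<Rightarrow> real) \<Rightarrow> real) \<Rightarrow> bool"
  where "positive_functional \<mu> \<longleftrightarrow>
    (\<forall>f g. continuous_on UNIV f \<longrightarrow> continuous_on UNIV g \<longrightarrow> \<mu> (\<lambda>x. f x + g x) = \<mu> f + \<mu> g) \<and>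
    (\<forall>c f. continuous_on UNIV f \<longrightarrow> \<mu> (\<lambda>x. c * f x) = c * \<mu> f) \<and>
    (\<forall>f. continuous_on UNIV f \<longrightarrow> (\<forall>x. 0 \<le> f x) \<longrightarrow> 0 \<le> \<mu> f)"

context
  fixes \<mu> :: "('k::topological_space \<Rightarrow> real) \<Rightarrow> real"
  assumes \<mu>: "positive_functional \<mu>"
begin

lemma positive_functional_add:
  "continuous_on UNIV f \<Longrightarrow> continuous_on UNIV g \<Longrightarrow> \<mu> (\<lambda>x. f x + g x) = \<mu> f + \<mu> g"
  using \<mu> by (simp add: positive_functional_def)

lemma positive_functional_scale: "continuous_on UNIV f \<Longrightarrow> \<mu> (\<lambda>x. c * f x) = c * \<mu> f"
  using \<mu> by (simp add: positive_functional_def)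

lemma positive_functional_nonneg: "continuous_on UNIV f \<Longrightarrow> (\<And>x. 0 \<le> f x) \<Longrightarrow> 0 \<le> \<mu> f"
  using \<mu> by (simp add: positive_functional_def)

lemma positive_functional_zero [simp]: "\<mu> (\<lambda>x. 0) = 0"
  using positive_functional_scale[of "\<lambda>x. 0" 0] by simp

lemma positive_functional_diff:
  assumes "continuous_on UNIV f" "continuous_on UNIV g"
  shows "\<mu> (\<lambda>x. f x - g x) = \<mu> f - \<mu> g"
  using positive_functional_add[of f "\<lambda>x. - 1 * g x"] positive_functional_scale[of g "- 1"] assms
  by (simp add: continuous_on_minus)

lemma positive_functional_mono:
  assumes "continuous_on UNIV f" "continuous_on UNIV g" "\<And>x. f x \<le> g x"
  shows "\<mu> f \<le> \<mu> g"
  using positive_functional_nonneg[of "\<lambda>x. g x - f x"] positive_functional_diff[of g f] assms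
  by (simp add: continuous_on_diff)

lemma positive_functional_const: "\<mu> (\<lambda>x. c) = c * \<mu> (\<lambda>x. 1)"
  using positive_functional_scale[of "\<lambda>x. 1" c] by simp

lemma positive_functional_le_const:
  assumes "continuous_on UNIV f" "\<And>x. f x \<le> c"
  shows "\<mu> f \<le> c * \<mu> (\<lambda>x. 1)"
  using positive_functional_mono[of f "\<lambda>x. c"] assms positive_functional_const[of c] by simp

lemma positive_functional_sum:
  assumes "\<And>i. i \<in> A \<Longrightarrow> continuous_on UNIV (f i)"
  shows "\<mu> (\<lambda>x. \<Sum>i\<in>A. f i x) = (\<Sum>i\<in>A. \<mu> (f i))"
  using assms
  by (induction A rule: infinite_finite_induct)
    (simp_all add: positive_functional_add continuous_on_sum)

end

lemma positive_functional_sum_functionals: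
  assumes "\<And>i. i \<in> A \<Longrightarrow> positive_functional (\<mu> i)"
  shows "positive_functional (\<lambda>f. \<Sum>i\<in>A. \<mu> i f)"
  unfolding positive_functional_def
  by (auto simp: positive_functional_add[OF assms] positive_functional_scale[OF assms]
      sum.distrib sum_distrib_left intro!: sum_nonneg positive_functional_nonneg[OF assms])

lemma positive_functional_mult_right:
  assumes "positive_functional \<mu>" "0 \<le> (c::real)"
  shows "positive_functional (\<lambda>f. c * \<mu> f)"
  using assms(2) unfolding positive_functional_def
  by (auto simp: positive_functional_add[OF assms(1)] positive_functional_scale[OF assms(1)]
      algebra_simps positive_functional_nonneg[OF assms(1)])

text \<open>
  The difference of the values at the positive and the negative part is additive because any
  other way to write \<open>f\<close> as a difference of nonnegative functions gives the same number.
\<close>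

lemma positive_functional_from_cone:
  fixes m :: "('k::topological_space \<Rightarrow> real) \<Rightarrow> real"
  assumes add: "\<And>f g. continuous_on UNIV f \<Longrightarrow> continuous_on UNIV g \<Longrightarrow> (\<And>x. 0 \<le> f x) \<Longrightarrow> (\<And>x. 0 \<le> g x)
      \<Longrightarrow> m (\<lambda>x. f x + g x) = m f + m g"
    and scale: "\<And>c f. continuous_on UNIV f \<Longrightarrow> (\<And>x. 0 \<le> f x) \<Longrightarrow> 0 < c \<Longrightarrow> m (\<lambda>x. c * f x) = c * m f"
    and nonneg: "\<And>f. continuous_on UNIV f \<Longrightarrow> (\<And>x. 0 \<le> f x) \<Longrightarrow> 0 \<le> m f"
  shows "positive_functional (\<lambda>f. m (\<lambda>x. max 0 (f x)) - m (\<lambda>x. max 0 (- f x)))" (is "positive_functional ?\<mu>")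
    and "(\<And>x. 0 \<le> f x) \<Longrightarrow> m (\<lambda>x. max 0 (f x)) - m (\<lambda>x. max 0 (- f x)) = m f"
proof -
  have zero: "m (\<lambda>x. 0) = 0"
    using add[of "\<lambda>x. 0" "\<lambda>x. 0"] by simp
  have cont: "continuous_on UNIV (\<lambda>x. max 0 (f x))" "continuous_on UNIV (\<lambda>x. max 0 (- f x))"
    if "continuous_on UNIV f" for f :: "'k \<Rightarrow> real"
    using that by (auto intro!: continuous_intros)
  have \<mu>_diff: "?\<mu> (\<lambda>x. a x - b x) = m a - m b"
    if "continuous_on UNIV a" "continuous_on UNIV b" "\<And>x. 0 \<le> a x" "\<And>x. 0 \<le> b x" for a b
  proof -
    have "(\<lambda>x. max 0 (a x - b x) + b x) = (\<lambda>x. max 0 (- (a x - b x)) + a x)"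
      by (auto simp: max_def)
    then have "m (\<lambda>x. max 0 (a x - b x) + b x) = m (\<lambda>x. max 0 (- (a x - b x)) + a x)"
      by (rule arg_cong)
    then show ?thesis
      using that add[of "\<lambda>x. max 0 (a x - b x)" b] add[of "\<lambda>x. max 0 (- (a x - b x))" a]
        cont[of "\<lambda>x. a x - b x"]
      by (simp add: continuous_on_diff)
  qed
  show "positive_functional ?\<mu>"
    unfolding positive_functional_def
  proof (intro conjI allI impI)
    fix f g :: "'k \<Rightarrow> real"
    assume f: "continuous_on UNIV f" and g: "continuous_on UNIV g"
    have parts: "(max 0 (f x) + max 0 (g x)) - (max 0 (- f x) + max 0 (- g x)) = f x + g x" for x
      by (simp add: max_def)
    have "?\<mu> (\<lambda>x. (max 0 (f x) + max 0 (g x)) - (max 0 (- f x) + max 0 (- g x))) =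
        m (\<lambda>x. max 0 (f x) + max 0 (g x)) - m (\<lambda>x. max 0 (- f x) + max 0 (- g x))"
      by (rule \<mu>_diff) (auto intro!: continuous_intros f g)
    then show "?\<mu> (\<lambda>x. f x + g x) = ?\<mu> f + ?\<mu> g"
      unfolding parts by (simp add: add cont f g)
  next
    fix c :: real and f :: "'k \<Rightarrow> real"
    assume f: "continuous_on UNIV f"
    consider "c = 0" | "c > 0" | "c < 0" by linarith
    then show "?\<mu> (\<lambda>x. c * f x) = c * ?\<mu> f"
    proof cases
      case 1 then show ?thesis by (simp add: zero)
    next
      case 2
      then have "(\<lambda>x. max 0 (c * f x)) = (\<lambda>x. c * max 0 (f x))"
        "(\<lambda>x. max 0 (- (c * f x))) = (\<lambda>x. c * max 0 (- f x))"
        by (auto simp: max_def zero_le_mult_iff mult_le_0_iff)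
      with 2 show ?thesis by (simp add: scale cont f right_diff_distrib)
    next
      case 3
      then have "(\<lambda>x. max 0 (c * f x)) = (\<lambda>x. - c * max 0 (- f x))"
        "(\<lambda>x. max 0 (- (c * f x))) = (\<lambda>x. - c * max 0 (f x))"
        by (auto simp: max_def zero_le_mult_iff mult_le_0_iff)
      moreover have "m (\<lambda>x. - c * max 0 (f x)) = - c * m (\<lambda>x. max 0 (f x))"
        "m (\<lambda>x. - c * max 0 (- f x)) = - c * m (\<lambda>x. max 0 (- f x))"
        using 3 by (intro scale cont f; simp)+
      ultimately show ?thesis by (simp add: right_diff_distrib)
    qed
  next
    fix f :: "'k \<Rightarrow> real"
    assume "continuous_on UNIV f" "\<forall>x. 0 \<le> f x"
    then show "0 \<le> ?\<mu> f" by (simp add: zero nonneg)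
  qed
  show "(\<And>x. 0 \<le> f x) \<Longrightarrow> m (\<lambda>x. max 0 (f x)) - m (\<lambda>x. max 0 (- f x)) = m f"
    by (simp add: zero)
qed

subsection \<open>Total variation\<close>

text \<open>
  \<open>cone_variation \<nu>\<close> is the total variation measure of \<open>\<nu>\<close>, evaluated at nonnegative functions;
  \<open>variation \<nu>\<close> is its linear extension.
\<close>

definition cone_variation ::
    "(('k::topological_space, 's::real_normed_field) functional) \<Rightarrow> ('k \<Rightarrow> real) \<Rightarrow> real"
  where "cone_variation \<nu> f = (SUP g \<in> {g. \<forall>x. norm (apply_bcontfun g x) \<le> f x}. norm (\<nu> g))"

definition variation ::
    "(('k::topological_space, 's::real_normed_field) functional) \<Rightarrow> ('k \<Rightarrow> real) \<Rightarrow> real"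
  where "variation \<nu> f = cone_variation \<nu> (\<lambda>x. max 0 (f x)) - cone_variation \<nu> (\<lambda>x. max 0 (- f x))"

context
  fixes \<nu> :: "('k::topological_space, 's::{real_normed_field,euclidean_space}) functional"
  assumes compact: "compact (UNIV :: 'k set)"
    and \<nu>: "\<nu> \<in> bounded_functionals bcontfun_scale"
begin

lemma norm_functional_le:
  assumes "\<And>x. norm (apply_bcontfun g x) \<le> b" shows "norm (\<nu> g) \<le> norm \<nu> * b"
  using norm_blinfun[of \<nu> g] norm_bound[of g b, OF assms] 
  by (meson mult_left_mono norm_ge_zero order_trans)

lemma cone_variation_bdd:
  assumes "continuous_on UNIV f"
  shows "bdd_above ((\<lambda>g. norm (\<nu> g)) ` {g. \<forall>x. norm (apply_bcontfun g x) \<le> f x})"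
proof -
  obtain b where "norm (f x) \<le> b" for x
    using compact_imp_bounded[OF compact_continuous_image[OF assms compact]]
    by (auto simp: bounded_iff)
  then have b: "f x \<le> b" for x
    by (metis abs_le_D1 real_norm_def)
  show ?thesis
  proof (rule bdd_aboveI2)
    fix g :: "'k \<Rightarrow>\<^sub>C 's" assume "g \<in> {g. \<forall>x. norm (apply_bcontfun g x) \<le> f x}"
    then show "norm (\<nu> g) \<le> norm \<nu> * b"
      using b order_trans by (intro norm_functional_le) blast
  qed
qed

lemma norm_le_cone_variation:
  assumes "continuous_on UNIV f" "\<And>x. norm (apply_bcontfun g x) \<le> f x"
  shows "norm (\<nu> g) \<le> cone_variation \<nu> f"
  unfolding cone_variation_def
  by (rule cSUP_upper[OF _ cone_variation_bdd[OF assms(1)]]) (use assms(2) in auto)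

lemma cone_variation_leI:
  assumes "\<And>x. 0 \<le> f x" "\<And>g. (\<And>x. norm (apply_bcontfun g x) \<le> f x) \<Longrightarrow> norm (\<nu> g) \<le> b"
  shows "cone_variation \<nu> f \<le> b"
proof -
  have "(0 :: 'k \<Rightarrow>\<^sub>C 's) \<in> {g. \<forall>x. norm (apply_bcontfun g x) \<le> f x}"
    using assms(1) by simp
  then show ?thesis
    unfolding cone_variation_def by (intro cSUP_least) (use assms(2) in blast)+
qed

lemma less_cone_variationE:
  assumes "c < cone_variation \<nu> f" "continuous_on UNIV f" "\<And>x. 0 \<le> f x"
  obtains g where "\<And>x. norm (apply_bcontfun g x) \<le> f x" "c < norm (\<nu> g)"
  using cone_variation_leI[of f c] assms by (meson linorder_not_le)

lemma cone_variation_nonneg: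
  assumes "continuous_on UNIV f" "\<And>x. 0 \<le> f x"
  shows "0 \<le> cone_variation \<nu> f"
  using norm_le_cone_variation[of f 0] assms by simp

text \<open>
  A function bounded by \<open>f + g\<close> is cut into pieces proportional to \<open>f\<close> and \<open>g\<close>, which gives one
  inequality. For the other one, near-maximisers for \<open>f\<close> and for \<open>g\<close> are rotated so that their
  values add up without cancellation.
\<close>

lemma cone_variation_add:
  assumes f: "continuous_on UNIV f" and g: "continuous_on UNIV g"
    and f0: "\<And>x. 0 \<le> f x" and g0: "\<And>x. 0 \<le> g x"
  shows "cone_variation \<nu> (\<lambda>x. f x + g x) = cone_variation \<nu> f + cone_variation \<nu> g"
proof (rule antisym)
  have fg: "continuous_on UNIV (\<lambda>x. f x + g x)" using f g by (rule continuous_on_add)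
  show "cone_variation \<nu> (\<lambda>x. f x + g x) \<le> cone_variation \<nu> f + cone_variation \<nu> g"
  proof (rule cone_variation_leI)
    fix h :: "'k \<Rightarrow>\<^sub>C 's" assume h: "\<And>x. norm (apply_bcontfun h x) \<le> f x + g x"
    show "norm (\<nu> h) \<le> cone_variation \<nu> f + cone_variation \<nu> g"
    proof (rule field_le_epsilon)
      fix e :: real assume e: "0 < e"
      define d where "d = e / (norm \<nu> + 1)"
      have d: "0 < d" "norm \<nu> * d \<le> e"
        using e norm_ge_zero[of \<nu>] unfolding d_def
        by (simp_all add: pos_divide_le_eq divide_pos_pos add_nonneg_pos)
      have pos: "0 < f x + g x + d" for x using d(1) f0[of x] g0[of x] by linarith
      \<comment> \<open>the shift by \<open>d\<close> keeps the quotients continuous where \<open>f + g\<close> vanishes\<close>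
      define part where "part k = Bcontfun (\<lambda>x. (k x / (f x + g x + d)) *\<^sub>R apply_bcontfun h x)" for k
      have part: "part k x = (k x / (f x + g x + d)) *\<^sub>R h x" if "continuous_on UNIV k" for k x
      proof -
        have "continuous_on UNIV (\<lambda>x. (k x / (f x + g x + d)) *\<^sub>R h x)"
          using pos by (intro continuous_intros that f g) (simp_all add: pos less_imp_neq[THEN not_sym])
        then show ?thesis by (simp add: part_def apply_Bcontfun_compact[OF compact])
      qed
      have part_le: "norm (part k x) \<le> k x" if k: "continuous_on UNIV k" "\<And>x. 0 \<le> k x" for k x
      proof -
        have "norm (part k x) = k x * (norm (h x) / (f x + g x + d))"
          using k pos[of x] by (simp add: part)
        also have "\<dots> \<le> k x * 1"
          using h[of x] pos[of x] d(1) k by (intro mult_left_mono) auto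
        finally show ?thesis by simp
      qed
      have "h = part f + part g + part (\<lambda>x. d)"
      proof (rule bcontfun_eqI)
        fix x
        have "(f x / (f x + g x + d) + g x / (f x + g x + d) + d / (f x + g x + d)) = 1"
          using pos[of x] by (simp add: add_divide_distrib[symmetric])
        then show "h x = (part f + part g + part (\<lambda>x. d)) x"
          by (simp add: part f g scaleR_left_distrib[symmetric])
      qed
      then have "norm (\<nu> h) \<le> norm (\<nu> (part f)) + norm (\<nu> (part g)) + norm (\<nu> (part (\<lambda>x. d)))"
        using norm_triangle_ineq[of "\<nu> (part f) + \<nu> (part g)" "\<nu> (part (\<lambda>x. d))"]
          norm_triangle_ineq[of "\<nu> (part f)" "\<nu> (part g)"]
        by (simp add: blinfun.add_right)
      also have "\<dots> \<le> cone_variation \<nu> f + cone_variation \<nu> g + norm \<nu> * d"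
        using d(1) by (intro add_mono norm_le_cone_variation norm_functional_le part_le f g f0 g0) auto
      finally show "norm (\<nu> h) \<le> cone_variation \<nu> f + cone_variation \<nu> g + e"
        using d(2) by linarith
    qed
  qed (simp add: f0 g0)
  show "cone_variation \<nu> f + cone_variation \<nu> g \<le> cone_variation \<nu> (\<lambda>x. f x + g x)"
  proof (rule field_le_epsilon)
    fix e :: real assume e: "0 < e"
    obtain a where a: "\<And>x. norm (apply_bcontfun a x) \<le> f x" "cone_variation \<nu> f - e / 2 < norm (\<nu> a)"
      by (rule less_cone_variationE[of "cone_variation \<nu> f - e / 2" f]) (use e f f0 in auto)
    obtain b where b: "\<And>x. norm (apply_bcontfun b x) \<le> g x" "cone_variation \<nu> g - e / 2 < norm (\<nu> b)"
      by (rule less_cone_variationE[of "cone_variation \<nu> g - e / 2" g]) (use e g g0 in auto)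
    obtain u where u: "norm u = 1" "u * \<nu> a = of_real (norm (\<nu> a))" by (rule obtain_phase)
    obtain v where v: "norm v = 1" "v * \<nu> b = of_real (norm (\<nu> b))" by (rule obtain_phase)
    have "\<nu> (bcontfun_scale u a + bcontfun_scale v b) = of_real (norm (\<nu> a) + norm (\<nu> b))"
      by (simp add: blinfun.add_right bounded_functional_scale[OF \<nu>] u v)
    then have "norm (\<nu> a) + norm (\<nu> b) = norm (\<nu> (bcontfun_scale u a + bcontfun_scale v b))"
      by (simp only: norm_of_real) simp
    also have "\<dots> \<le> cone_variation \<nu> (\<lambda>x. f x + g x)"
    proof (rule norm_le_cone_variation[OF fg])
      show "norm ((bcontfun_scale u a + bcontfun_scale v b) x) \<le> f x + g x" for x
        using norm_triangle_ineq[of "u * a x" "v * b x"] a(1)[of x] b(1)[of x] u v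
        by (simp add: norm_mult)
    qed
    finally show "cone_variation \<nu> f + cone_variation \<nu> g \<le> cone_variation \<nu> (\<lambda>x. f x + g x) + e"
      using a(2) b(2) by linarith
  qed
qed

lemma cone_variation_scale_le:
  assumes f: "continuous_on UNIV f" and f0: "\<And>x. 0 \<le> f x" and c: "0 < c"
  shows "cone_variation \<nu> (\<lambda>x. c * f x) \<le> c * cone_variation \<nu> f"
proof (rule cone_variation_leI)
  fix g :: "'k \<Rightarrow>\<^sub>C 's" assume g: "\<And>x. norm (apply_bcontfun g x) \<le> c * f x"
  have "norm (\<nu> ((1 / c) *\<^sub>R g)) \<le> cone_variation \<nu> f"
    by (rule norm_le_cone_variation[OF f]) (use g c in \<open>simp add: field_simps\<close>)
  then show "norm (\<nu> g) \<le> c * cone_variation \<nu> f"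
    using c by (simp add: blinfun.scaleR_right field_simps)
qed (use f0 c in simp)

lemma cone_variation_scale:
  assumes f: "continuous_on UNIV f" and f0: "\<And>x. 0 \<le> f x" and c: "0 < c"
  shows "cone_variation \<nu> (\<lambda>x. c * f x) = c * cone_variation \<nu> f"
proof (rule antisym[OF cone_variation_scale_le[OF assms]])
  have "cone_variation \<nu> (\<lambda>x. 1 / c * (c * f x)) \<le> 1 / c * cone_variation \<nu> (\<lambda>x. c * f x)"
    by (rule cone_variation_scale_le) (use assms in \<open>auto intro: continuous_intros\<close>)
  then show "c * cone_variation \<nu> f \<le> cone_variation \<nu> (\<lambda>x. c * f x)"
    using c by (simp add: field_simps)
qed

lemma positive_functional_variation: "positive_functional (variation \<nu>)"
  unfolding variation_def[abs_def]
  by (rule positive_functional_from_cone(1))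
    (simp_all add: cone_variation_add cone_variation_scale cone_variation_nonneg)

lemma variation_eq:
  assumes "\<And>x. 0 \<le> f x" shows "variation \<nu> f = cone_variation \<nu> f"
  unfolding variation_def
  by (rule positive_functional_from_cone(2)[OF _ _ _ assms])
    (simp_all add: cone_variation_add cone_variation_scale cone_variation_nonneg)

lemma norm_le_variation: "norm (\<nu> g) \<le> variation \<nu> (\<lambda>x. norm (g x))"
  by (subst variation_eq) (auto intro!: norm_le_cone_variation continuous_intros)

lemma variation_one_le: "variation \<nu> (\<lambda>x. 1) \<le> norm \<nu>"
  by (subst variation_eq) (auto intro!: cone_variation_leI order_trans[OF norm_functional_le[of _ 1]])

lemma less_variationE:
  assumes "c < variation \<nu> f" "continuous_on UNIV f" "\<And>x. 0 \<le> f x"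
  obtains g where "\<And>x. norm (apply_bcontfun g x) \<le> f x" "c < norm (\<nu> g)"
  using assms less_cone_variationE variation_eq by metis

end

section \<open>Functionals determined by their real parts\<close>

lemma functional_of_scale:
  "functional_of \<phi> (bcontfun_scale c f) = c * functional_of \<phi> f"
  using functional_of[of \<phi>] by (rule bounded_functional_scale)

lemma norm_functional_of_le: "norm (functional_of \<phi> f) \<le> norm \<phi> * norm f"
  by (simp add: norm_bcontfun_dual.rep_eq norm_blinfun)

lemma norm_dual_le:
  assumes "\<And>f. norm (functional_of \<phi> f) \<le> b * norm f" "0 \<le> b"
  shows "norm \<phi> \<le> b"
  unfolding norm_bcontfun_dual.rep_eq using assms(2,1) by (rule norm_blinfun_bound)

lemma dual_eqI: "(\<And>f. functional_of \<phi> f = functional_of \<psi> f) \<Longrightarrow> \<phi> = \<psi>"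
  by (simp add: functional_of_inject[symmetric] blinfun_eqI)

lemmas dual_apply =
  plus_bcontfun_dual.rep_eq minus_bcontfun_dual.rep_eq uminus_bcontfun_dual.rep_eq
  zero_bcontfun_dual.rep_eq scaleR_bcontfun_dual.rep_eq
  blinfun.add_left blinfun.diff_left blinfun.minus_left blinfun.zero_left blinfun.scaleR_left

lemma obtain_functional:
  fixes L :: "('k::topological_space \<Rightarrow>\<^sub>C 's::real_normed_field) \<Rightarrow> 's"
  assumes "\<And>f g. L (f + g) = L f + L g" "\<And>c f. L (bcontfun_scale c f) = c * L f"
    and "\<And>f. norm (L f) \<le> norm f * b"
  obtains \<phi> where "\<And>f. functional_of \<phi> f = L f"
proof -
  have "L (r *\<^sub>R f) = r *\<^sub>R L f" for r f
    using assms(2)[of "of_real r" f] by (simp add: bcontfun_scale_of_real scaleR_conv_of_real)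
  then have "bounded_linear L"
    using assms by (intro bounded_linear_intro) auto
  then have "blinfun_apply (Blinfun L) = L"
    by (rule bounded_linear_Blinfun_apply)
  moreover from this have "Blinfun L \<in> bounded_functionals bcontfun_scale"
    by (simp add: bounded_functionals_bcontfun_iff assms(2))
  ultimately show thesis
    using that[of "Functional (Blinfun L)"] by (simp add: Functional_inverse)
qed

text \<open>
  The value at \<open>f\<close> is the scalar that represents \<open>c \<mapsto> L (c f)\<close>; uniqueness of the representing
  scalar yields linearity.
\<close>

lemma functional_with_real_part:
  fixes L :: "('k::topological_space \<Rightarrow>\<^sub>C 's::{real_normed_field,euclidean_space}) \<Rightarrow> real"
  assumes "linear L" "\<And>f. L f \<le> norm f * b"
  obtains \<phi> where "\<And>f. inner (functional_of \<phi> f) 1 = L f"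
proof -
  define z where "z f = (THE z. \<forall>c. inner (c * z) 1 = L (bcontfun_scale c f))" for f
  have scale_linear: "linear (\<lambda>c. L (bcontfun_scale c f))" for f
  proof (rule linearI)
    show "L (bcontfun_scale (c + d) f) = L (bcontfun_scale c f) + L (bcontfun_scale d f)" for c d
      by (simp add: vector_space.vector_space_assms[OF vector_space_bcontfun_scale] linear_add[OF assms(1)])
    show "L (bcontfun_scale (r *\<^sub>R c) f) = r *\<^sub>R L (bcontfun_scale c f)" for r c
    proof -
      have "bcontfun_scale (r *\<^sub>R c) f = r *\<^sub>R bcontfun_scale c f"
        by (rule bcontfun_eqI) simp
      then show ?thesis by (simp add: linear_scale[OF assms(1)])
    qed
  qed
  have unique: "\<exists>!z. \<forall>c. inner (c * z) 1 = L (bcontfun_scale c f)" for f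
    by (rule real_part_determines_functional[OF scale_linear])
  have z: "inner (c * z f) 1 = L (bcontfun_scale c f)" for c f
    using theI'[OF unique[of f]] by (simp add: z_def)
  have zI: "z f = w" if "\<And>c. inner (c * w) 1 = L (bcontfun_scale c f)" for f w
    using unique[of f] z[of _ f] that by blast
  obtain \<phi> where \<phi>: "functional_of \<phi> f = z f" for f
  proof (rule obtain_functional[of z b])
    show "z (f + g) = z f + z g" for f g
    proof (rule zI)
      fix c
      have "bcontfun_scale c (f + g) = bcontfun_scale c f + bcontfun_scale c g"
        by (rule bcontfun_eqI) (simp add: distrib_left)
      then show "inner (c * (z f + z g)) 1 = L (bcontfun_scale c (f + g))"
        by (simp add: distrib_left inner_add_left z linear_add[OF assms(1)])
    qed
    show "z (bcontfun_scale d f) = d * z f" for d f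
    proof (rule zI)
      fix c
      have "bcontfun_scale c (bcontfun_scale d f) = bcontfun_scale (c * d) f"
        by (rule bcontfun_eqI) (simp add: mult.assoc)
      then show "inner (c * (d * z f)) 1 = L (bcontfun_scale c (bcontfun_scale d f))"
        using z[of "c * d" f] by (simp add: mult.assoc)
    qed
    show "norm (z f) \<le> norm f * b" for f
    proof (rule norm_le_if_inner_one_le)
      fix u :: 's assume "norm u = 1"
      then show "inner (u * z f) 1 \<le> norm f * b"
        using assms(2)[of "bcontfun_scale u f"] by (simp add: z norm_bcontfun_scale)
    qed
  qed blast
  have "bcontfun_scale 1 f = f" for f :: "'k \<Rightarrow>\<^sub>C 's"
    by (rule bcontfun_eqI) simp
  with z[of 1] show thesis
    by (intro that[of \<phi>]) (simp add: \<phi>)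
qed

lemma linear_real_part_functional: "linear (\<lambda>f. inner (functional_of \<phi> f) 1)"
  by (rule linearI) (simp_all add: blinfun.add_right blinfun.scaleR_right inner_add_left)

section \<open>Order intervals of measures are weakly compact\<close>

text \<open>
  The Riesz representation theorem in a semi-inner product space that may be incomplete, up to an
  error: a minimiser of \<open>B y y / 2 - L y\<close> would represent \<open>L\<close>, and a near-minimiser satisfies the
  Euler equation approximately.
\<close>

lemma near_minimiser_represents:
  fixes B :: "'v::real_vector \<Rightarrow> 'v \<Rightarrow> real"
  assumes B: "\<And>x. linear (B x)" "\<And>x y. B x y = B y x" "\<And>x. 0 \<le> B x x"
    and L: "linear L" "\<And>x. \<bar>L x\<bar> \<le> K * sqrt (B x x)" and e: "0 < e"
  obtains y where "\<And>x. \<bar>L x - B x y\<bar> \<le> e * sqrt (B x x)"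
proof -
  define F where "F y = B y y / 2 - L y" for y
  have "- (K\<^sup>2 / 2) \<le> F y" for y
  proof -
    have "0 \<le> (sqrt (B y y) - K)\<^sup>2" by simp
    then have "0 \<le> B y y - 2 * (K * sqrt (B y y)) + K\<^sup>2"
      using B(3)[of y] by (simp add: power2_diff algebra_simps)
    then show ?thesis using L(2)[of y] unfolding F_def by linarith
  qed
  then have bdd: "bdd_below (range F)" by (rule bdd_belowI2)
  obtain y where y: "F y < Inf (range F) + e\<^sup>2 / 2"
    using cInf_lessD[of "range F" "Inf (range F) + e\<^sup>2 / 2"] e by auto
  show thesis
  proof (rule that)
    fix x
    define a b where "a = B x y - L x" and "b = B x x"
    have key: "0 < t * a + t\<^sup>2 * b / 2 + e\<^sup>2 / 2" for t
    proof -
      have "F y < F (y + t *\<^sub>R x) + e\<^sup>2 / 2"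
        using y cInf_lower[OF rangeI bdd, of "y + t *\<^sub>R x"] by linarith
      also have "F (y + t *\<^sub>R x) = F y + t * a + t\<^sup>2 * b / 2"
      proof -
        have "B (y + t *\<^sub>R x) (y + t *\<^sub>R x) = B (y + t *\<^sub>R x) y + t * B (y + t *\<^sub>R x) x"
          using B(1)[of "y + t *\<^sub>R x"] by (simp add: linear_add linear_scale)
        also have "\<dots> = B y y + 2 * t * B x y + t\<^sup>2 * B x x"
          using B(1)[of y] B(1)[of x] B(2)[of "y + t *\<^sub>R x"] B(2)[of y x]
          by (simp add: linear_add linear_scale power2_eq_square algebra_simps)
        finally show ?thesis
          unfolding F_def a_def b_def
          using L(1) by (simp add: linear_add linear_scale field_simps)
      qed
      finally show ?thesis by linarith
    qed
    show "\<bar>L x - B x y\<bar> \<le> e * sqrt (B x x)"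
    proof (cases "b = 0")
      case True
      have "a = 0"
      proof (rule ccontr)
        assume "a \<noteq> 0"
        \<comment> \<open>in a null direction \<open>key\<close> is linear in \<open>t\<close>, so a nonzero slope would violate it\<close>
        then show False using key[of "- e\<^sup>2 / a"] True e by (simp add: field_simps)
      qed
      then show ?thesis using True e by (simp add: a_def b_def)
    next
      case False
      then have b: "0 < b" using B(3)[of x] by (simp add: b_def)
      \<comment> \<open>\<open>t = - a / b\<close> minimises the quadratic polynomial in \<open>key\<close>\<close>
      have "0 < (- a / b) * a + (- a / b)\<^sup>2 * b / 2 + e\<^sup>2 / 2" by (rule key)
      also have "\<dots> = (e\<^sup>2 * b - a\<^sup>2) / (2 * b)"
        using b by (simp add: field_simps power2_eq_square)
      finally have "a\<^sup>2 < e\<^sup>2 * b" using b by (simp add: zero_less_divide_iff)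
      then have "\<bar>a\<bar> < sqrt (e\<^sup>2 * b)" by (simp add: real_less_rsqrt)
      then show ?thesis using e by (simp add: a_def b_def real_sqrt_mult abs_minus_commute)
    qed
  qed
qed


lemma positive_functional_norm_Cauchy_Schwarz:
  fixes f :: "'k::topological_space \<Rightarrow>\<^sub>C 's::real_inner"
  assumes \<mu>: "positive_functional \<mu>"
  shows "\<mu> (\<lambda>x. norm (f x)) \<le> sqrt (\<mu> (\<lambda>x. 1)) * sqrt (\<mu> (\<lambda>x. inner (f x) (f x)))"
proof -
  define a b c where "a = \<mu> (\<lambda>x. norm (f x))" and "b = \<mu> (\<lambda>x. inner (f x) (f x))"
    and "c = \<mu> (\<lambda>x. 1)"
  have c: "0 \<le> c" unfolding c_def by (rule positive_functional_nonneg[OF \<mu>]) auto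
  have quadratic: "0 \<le> b - 2 * t * a + t\<^sup>2 * c" for t
  proof -
    have "0 \<le> \<mu> (\<lambda>x. (norm (f x) - t)\<^sup>2)"
      by (rule positive_functional_nonneg[OF \<mu>]) (auto intro!: continuous_intros)
    also have "(\<lambda>x. (norm (f x) - t)\<^sup>2) = (\<lambda>x. (inner (f x) (f x) + (- 2 * t) * norm (f x)) + t\<^sup>2 * 1)"
      by (auto simp: power2_diff power2_norm_eq_inner)
    also have "\<mu> \<dots> = (b + (- 2 * t) * a) + t\<^sup>2 * c"
      unfolding a_def b_def c_def
      by (simp only: positive_functional_add[OF \<mu>] positive_functional_scale[OF \<mu>]
          continuous_on_add continuous_on_mult continuous_on_const continuous_on_inner continuous_on_norm
          continuous_on_apply_bcontfun)
    finally show ?thesis by simp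
  qed
  have "a\<^sup>2 \<le> c * b"
  proof (cases "c = 0")
    case True
    have "a \<le> norm f * c"
      unfolding a_def c_def
      by (rule positive_functional_le_const[OF \<mu>]) (auto intro!: continuous_intros norm_bounded)
    moreover have "0 \<le> a"
      unfolding a_def by (rule positive_functional_nonneg[OF \<mu>]) (auto intro!: continuous_intros)
    ultimately show ?thesis using True by simp
  next
    case False
    with c quadratic[of "a / c"] show ?thesis
      by (simp add: field_simps power2_eq_square)
  qed
  then have "a \<le> sqrt (c * b)" by (rule real_le_rsqrt)
  then show ?thesis by (simp add: a_def b_def c_def real_sqrt_mult)
qed

lemma linear_positive_functional_inner:
  assumes \<mu>: "positive_functional \<mu>" and "continuous_on UNIV f"
  shows "linear (\<lambda>g :: 'k::topological_space \<Rightarrow>\<^sub>C 's::real_inner. \<mu> (\<lambda>x. inner (f x) (g x)))"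
  using assms(2)
  by (intro linearI)
    (simp_all add: inner_add_right positive_functional_add[OF \<mu>] positive_functional_scale[OF \<mu>]
      continuous_on_inner)

lemma obtain_density_functional:
  fixes g :: "'k::topological_space \<Rightarrow>\<^sub>C 's::{real_normed_field,euclidean_space}"
  assumes \<mu>: "positive_functional \<mu>"
  obtains \<psi> where "\<And>f. inner (functional_of \<psi> f) 1 = \<mu> (\<lambda>x. inner (f x) (g x))"
proof (rule functional_with_real_part[where b = "norm g * \<mu> (\<lambda>x. 1)"])
  show "linear (\<lambda>f :: 'k \<Rightarrow>\<^sub>C 's. \<mu> (\<lambda>x. inner (f x) (g x)))"
    using linear_positive_functional_inner[OF \<mu>, of g] by (simp add: inner_commute)
  show "\<mu> (\<lambda>x. inner (f x) (g x)) \<le> norm f * (norm g * \<mu> (\<lambda>x. 1))" for f :: "'k \<Rightarrow>\<^sub>C 's"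
  proof -
    have "inner (f x) (g x) \<le> norm f * norm g" for x
      using norm_cauchy_schwarz[of "f x" "g x"]
      by (meson mult_mono norm_bounded norm_ge_zero order_trans)
    then have "\<mu> (\<lambda>x. inner (f x) (g x)) \<le> (norm f * norm g) * \<mu> (\<lambda>x. 1)"
      by (intro positive_functional_le_const[OF \<mu>]) (auto intro!: continuous_intros)
    then show ?thesis by (simp add: mult.assoc)
  qed
qed (rule that)

lemma bounded_functionals_dual_iff:
  "\<Phi> \<in> bounded_functionals dual_scale \<longleftrightarrow> (\<forall>c \<phi>. \<Phi> (dual_scale c \<phi>) = c * \<Phi> \<phi>)"
proof -
  have "vector_space ((*) :: 's \<Rightarrow> 's \<Rightarrow> 's::real_normed_field)"
    by standard (auto simp: algebra_simps)
  then show ?thesis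
    unfolding bounded_functionals_def Vector_Spaces.linear_iff
    by (auto simp: vector_space_dual_scale blinfun.add_right)
qed

text \<open>
  The functionals whose total variation lies below \<open>\<mu>\<close>.
\<close>

definition order_interval :: "(('k::topological_space \<Rightarrow> real) \<Rightarrow> real) \<Rightarrow> ('k, 's::real_normed_field) bcontfun_dual set"
  where "order_interval \<mu> = {\<psi>. \<forall>f. norm (functional_of \<psi> f) \<le> \<mu> (\<lambda>x. norm (f x))}"

lemma dual_scale_order_interval:
  assumes "\<psi> \<in> order_interval \<mu>" "norm u = 1"
  shows "dual_scale u \<psi> \<in> order_interval \<mu>"
  using assms by (simp add: order_interval_def norm_mult)

text \<open>
  On an order interval every functional \<open>\<Phi>\<close> on the dual is uniformly close to the evaluation at a
  continuous function. Indeed \<open>g \<mapsto> \<Phi> (g d\<mu>)\<close> is bounded in quadratic mean and hence is represented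
  by some continuous \<open>f\<close> up to a small error; by the same principle, applied to a member \<open>\<psi>\<close> of the
  interval, the measures \<open>g d\<mu>\<close> with \<open>g\<close> continuous come arbitrarily close to \<open>\<psi>\<close> in norm.
\<close>

lemma order_interval_second_dual:
  fixes \<Phi> :: "('k::topological_space, 's::{real_normed_field,euclidean_space}) bcontfun_dual \<Rightarrow>\<^sub>L 's"
  assumes \<mu>: "positive_functional \<mu>" and \<Phi>: "\<Phi> \<in> bounded_functionals dual_scale" and e: "0 < e"
  obtains f where "\<And>\<psi>. \<psi> \<in> order_interval \<mu> \<Longrightarrow> norm (\<Phi> \<psi> - functional_of \<psi> f) \<le> e"
proof -
  define B where "B f g = \<mu> (\<lambda>x. inner (f x) (g x))" for f g :: "'k \<Rightarrow>\<^sub>C 's"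
  define s where "s = sqrt (\<mu> (\<lambda>x. 1))"
  have s: "0 \<le> s"
    unfolding s_def by (intro real_sqrt_ge_zero positive_functional_nonneg[OF \<mu>]) auto
  have B: "linear (B f)" "B f g = B g f" "0 \<le> B f f" for f g
    unfolding B_def using linear_positive_functional_inner[OF \<mu>, of f]
    by (auto simp: inner_commute intro!: positive_functional_nonneg[OF \<mu>] continuous_intros)
  have norm_le: "\<mu> (\<lambda>x. norm (f x)) \<le> s * sqrt (B f f)" for f :: "'k \<Rightarrow>\<^sub>C 's"
    unfolding s_def B_def by (rule positive_functional_norm_Cauchy_Schwarz[OF \<mu>])
  have norm_rotate: "\<mu> (\<lambda>x. norm (bcontfun_scale u f x)) = \<mu> (\<lambda>x. norm (f x))"
    "B (bcontfun_scale u f) (bcontfun_scale u f) = B f f" if "norm u = 1" for u and f :: "'k \<Rightarrow>\<^sub>C 's"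
    using that by (simp_all add: B_def norm_mult inner_mult_left_mult_left)
  \<comment> \<open>\<open>density g\<close> is the measure \<open>g d\<mu>\<close>\<close>
  define density where "density g = (SOME \<psi>. \<forall>f. inner (functional_of \<psi> f) 1 = B f g)" for g :: "'k \<Rightarrow>\<^sub>C 's"
  have density: "inner (functional_of (density g) f) 1 = B f g" for g f
    unfolding density_def
    by (rule someI2_ex[of "\<lambda>\<psi>. \<forall>f. inner (functional_of \<psi> f) 1 = B f g"])
      (use obtain_density_functional[OF \<mu>, of g] in \<open>auto simp: B_def\<close>)
  have densityI: "\<psi> = density g" if "\<And>f. inner (functional_of \<psi> f) 1 = B f g" for \<psi> g
  proof (rule dual_eqI)
    fix f
    have "inner (c * (functional_of \<psi> f - functional_of (density g) f)) 1 = 0" for c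
      using that[of "bcontfun_scale c f"] density[of g "bcontfun_scale c f"]
      by (simp add: functional_of_scale right_diff_distrib inner_diff_left)
    then show "functional_of \<psi> f = functional_of (density g) f"
      using eq_zero_if_inner_one by (metis eq_iff_diff_eq_0)
  qed
  have density_add: "density (g + h) = density g + density h" for g h
    by (rule densityI[symmetric])
      (simp add: dual_apply inner_add_left density linear_add[OF B(1)])
  have density_scale: "density (r *\<^sub>R g) = r *\<^sub>R density g" for r g
    by (rule densityI[symmetric])
      (simp add: dual_apply density linear_scale[OF B(1)])
  have density_le: "norm (functional_of (density g) f) \<le> norm f * \<mu> (\<lambda>x. norm (g x))" for g f
  proof (rule norm_le_if_inner_one_le)
    fix u :: 's assume u: "norm u = 1"
    have "inner (u * functional_of (density g) f) 1 = B (bcontfun_scale u f) g"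
      by (simp add: density[symmetric] functional_of_scale)
    also have "\<dots> \<le> \<mu> (\<lambda>x. norm f * norm (g x))"
      unfolding B_def
    proof (rule positive_functional_mono[OF \<mu>])
      show "inner (bcontfun_scale u f x) (g x) \<le> norm f * norm (g x)" for x
        using norm_cauchy_schwarz[of "u * f x" "g x"] u norm_bounded[of f x]
        by (simp add: norm_mult) (meson mult_right_mono norm_ge_zero order_trans)
    qed (auto intro!: continuous_intros)
    finally show "inner (u * functional_of (density g) f) 1 \<le> norm f * \<mu> (\<lambda>x. norm (g x))"
      by (simp add: positive_functional_scale[OF \<mu>] continuous_on_norm)
  qed
  have norm_density: "norm (density g) \<le> s * sqrt (B g g)" for g
  proof (rule norm_dual_le)
    show "norm (functional_of (density g) f) \<le> s * sqrt (B g g) * norm f" for f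
      using density_le[of g f] mult_left_mono[OF norm_le[of g] norm_ge_zero[of f]]
      by (simp add: mult.commute)
  qed (use s B(3) in simp)
  define d where "d = min 1 (e / (2 * (s + 1)))"
  have d: "0 < d" "d \<le> 1" "d * (s + 1) \<le> e / 2"
  proof -
    have "d \<le> e / (2 * (s + 1))" by (simp add: d_def)
    then show "d * (s + 1) \<le> e / 2" using s by (simp add: pos_le_divide_eq field_simps)
  qed (use e s in \<open>simp_all add: d_def divide_pos_pos\<close>)
  \<comment> \<open>\<open>f\<close> approximates the density of \<open>\<Phi>\<close> with respect to \<open>\<mu>\<close> in the quadratic mean\<close>
  obtain f where f: "\<bar>inner (\<Phi> (density g)) 1 - B g f\<bar> \<le> d * sqrt (B g g)" for g
  proof (rule near_minimiser_represents[of B "\<lambda>g. inner (\<Phi> (density g)) 1" "norm \<Phi> * s" d])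
    show "linear (\<lambda>g. inner (\<Phi> (density g)) 1)"
      by (rule linearI)
        (simp_all add: density_add density_scale blinfun.add_right blinfun.scaleR_right inner_add_left)
    show "\<bar>inner (\<Phi> (density g)) 1\<bar> \<le> norm \<Phi> * s * sqrt (B g g)" for g
      using norm_inner_one_le[of "\<Phi> (density g)"] norm_blinfun[of \<Phi> "density g"]
        mult_left_mono[OF norm_density[of g] norm_ge_zero[of \<Phi>]] by (simp add: mult.assoc)
  qed (use B d in auto)
  show thesis
  proof (rule that)
    fix \<psi> :: "('k, 's) bcontfun_dual" assume "\<psi> \<in> order_interval \<mu>"
    then have real_part: "inner (\<Phi> \<psi> - functional_of \<psi> f) 1 \<le> e" if "\<psi> \<in> order_interval \<mu>" for \<psi>
    proof -
      have \<psi>: "norm (functional_of \<psi> h) \<le> \<mu> (\<lambda>x. norm (h x))" for h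
        using that by (simp add: order_interval_def)
      \<comment> \<open>approximating \<open>\<psi>\<close> with error \<open>c * s\<close> changes \<open>\<Phi> \<psi> - \<psi> f\<close> by at most \<open>c * M\<close>\<close>
      define M where "M = (norm \<Phi> + norm f) * s + 1"
      define c where "c = min 1 (e / (2 * M))"
      have M: "0 < M" using s by (simp add: M_def add_nonneg_pos)
      have c: "0 < c" "c \<le> 1" "c * M \<le> e / 2"
      proof -
        have "c \<le> e / (2 * M)" by (simp add: c_def)
        then show "c * M \<le> e / 2" using M by (simp add: pos_le_divide_eq field_simps)
      qed (use e M in \<open>simp_all add: c_def divide_pos_pos\<close>)
      obtain g where g: "\<bar>inner (functional_of \<psi> h) 1 - B h g\<bar> \<le> c * sqrt (B h h)" for h
      proof (rule near_minimiser_represents[of B "\<lambda>h. inner (functional_of \<psi> h) 1" s c])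
        show "\<bar>inner (functional_of \<psi> h) 1\<bar> \<le> s * sqrt (B h h)" for h
          using norm_inner_one_le[of "functional_of \<psi> h"] \<psi>[of h] norm_le[of h] by linarith
      qed (use B c linear_real_part_functional in auto)
      have norm_g: "sqrt (B g g) \<le> s + 1"
      proof (cases "sqrt (B g g) = 0")
        case False
        then have pos: "0 < sqrt (B g g)" using B(3)[of g] by simp
        have "sqrt (B g g) * sqrt (B g g) = B g g" using B(3)[of g] by simp
        also have "\<dots> \<le> inner (functional_of \<psi> g) 1 + c * sqrt (B g g)"
          using g[of g] by linarith
        also have "\<dots> \<le> (s + c) * sqrt (B g g)"
          using norm_inner_one_le[of "functional_of \<psi> g"] \<psi>[of g] norm_le[of g]
          by (simp add: algebra_simps)
        finally have "sqrt (B g g) \<le> s + c" by (rule mult_right_le_imp_le[OF _ pos])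
        with c(2) show ?thesis by simp
      qed (use s in simp)
      have approx: "norm (\<psi> - density g) \<le> c * s"
      proof (rule norm_dual_le)
        fix h
        show "norm (functional_of (\<psi> - density g) h) \<le> c * s * norm h"
        proof (rule norm_le_if_inner_one_le)
          fix u :: 's assume u: "norm u = 1"
          have "inner (u * functional_of (\<psi> - density g) h) 1 =
              inner (functional_of \<psi> (bcontfun_scale u h)) 1 - B (bcontfun_scale u h) g"
            by (simp add: dual_apply density[symmetric] functional_of_scale right_diff_distrib inner_diff_left)
          also have "\<dots> \<le> c * sqrt (B h h)"
            using g[of "bcontfun_scale u h"] norm_rotate(2)[OF u, of h] by simp
          also have "sqrt (B h h) \<le> norm h * s"
          proof -
            have "B h h \<le> (norm h)\<^sup>2 * \<mu> (\<lambda>x. 1)"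
              unfolding B_def
              by (rule positive_functional_le_const[OF \<mu>])
                (auto intro!: continuous_intros power_mono norm_bounded simp flip: power2_norm_eq_inner)
            then have "sqrt (B h h) \<le> sqrt ((norm h)\<^sup>2 * \<mu> (\<lambda>x. 1))" by simp
            then show ?thesis by (simp add: s_def real_sqrt_mult)
          qed
          finally show "inner (u * functional_of (\<psi> - density g) h) 1 \<le> c * s * norm h"
            using c(1) by (simp add: algebra_simps)
        qed
      qed (use c s in simp)
      have "inner (\<Phi> \<psi> - functional_of \<psi> f) 1 =
          (inner (\<Phi> (density g)) 1 - B g f) + inner (\<Phi> (\<psi> - density g) - functional_of (\<psi> - density g) f) 1"
        using density[of g f] B(2)[of f g] by (simp add: dual_apply blinfun.diff_right inner_diff_left)
      also have "\<dots> \<le> d * sqrt (B g g) + (norm \<Phi> * norm (\<psi> - density g) + norm (\<psi> - density g) * norm f)"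
        using f[of g] norm_inner_one_le[of "\<Phi> (\<psi> - density g) - functional_of (\<psi> - density g) f"]
          norm_triangle_ineq4[of "\<Phi> (\<psi> - density g)" "functional_of (\<psi> - density g) f"]
          norm_blinfun[of \<Phi> "\<psi> - density g"] norm_functional_of_le[of "\<psi> - density g" f]
        by linarith
      also have "\<dots> = d * sqrt (B g g) + (norm \<Phi> + norm f) * norm (\<psi> - density g)"
        by (simp add: algebra_simps)
      also have "\<dots> \<le> d * (s + 1) + (norm \<Phi> + norm f) * (c * s)"
        using norm_g approx d by (intro add_mono mult_left_mono) auto
      also have "\<dots> \<le> e / 2 + c * M"
        using d c by (simp add: M_def algebra_simps)
      finally show ?thesis using c by linarith
    qed
    show "norm (\<Phi> \<psi> - functional_of \<psi> f) \<le> e"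
    proof (rule norm_le_if_inner_one_le)
      fix u :: 's assume "norm u = 1"
      with \<open>\<psi> \<in> order_interval \<mu>\<close> have "dual_scale u \<psi> \<in> order_interval \<mu>"
        by (rule dual_scale_order_interval)
      from real_part[OF this] \<Phi> show "inner (u * (\<Phi> \<psi> - functional_of \<psi> f)) 1 \<le> e"
        by (simp add: bounded_functionals_dual_iff right_diff_distrib)
    qed
  qed
qed

section \<open>Weak topologies\<close>

context
  fixes sc :: "'s::real_normed_field \<Rightarrow> 'e::real_normed_vector \<Rightarrow> 'e"
begin

lemma continuous_map_weak_functional:
  assumes "\<phi> \<in> bounded_functionals sc"
  shows "continuous_map (weak_topology sc) euclidean \<phi>"
proof (rule continuous_map_openin_preimage_eq[THEN iffD2], intro conjI allI impI)
  fix U :: "'s set" assume "openin euclidean U"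
  then have "blinfun_apply \<phi> -` U \<in> {blinfun_apply \<phi> -` U |\<phi> U. \<phi> \<in> bounded_functionals sc \<and> open U}"
    using assms by auto
  then show "openin (weak_topology sc) (topspace (weak_topology sc) \<inter> blinfun_apply \<phi> -` U)"
    unfolding weak_topology_def by (intro openin_Int openin_topspace topology_generated_by_Basis)
qed simp

lemma continuous_map_into_weak_topology:
  assumes "\<And>\<phi>. \<phi> \<in> bounded_functionals sc \<Longrightarrow> continuous_map X euclidean (\<lambda>x. \<phi> (h x))"
    and "topspace (weak_topology sc) = UNIV"
  shows "continuous_map X (weak_topology sc) h"
  unfolding weak_topology_def
proof (rule continuous_on_generated_topo)
  fix V assume "V \<in> {blinfun_apply \<phi> -` U |\<phi> U. \<phi> \<in> bounded_functionals sc \<and> open U}"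
  then obtain \<phi> U where V: "V = blinfun_apply \<phi> -` U" "\<phi> \<in> bounded_functionals sc" "open U" by auto
  then have "openin X {x \<in> topspace X. \<phi> (h x) \<in> U}"
    using assms(1)[of \<phi>] by (simp add: continuous_map_def)
  moreover have "{x \<in> topspace X. \<phi> (h x) \<in> U} = h -` V \<inter> topspace X"
    using V by auto
  ultimately show "openin X (h -` V \<inter> topspace X)" by simp
qed (use assms(2) in \<open>simp add: weak_topology_def topology_generated_by_topspace\<close>)

lemma topspace_weak_topology:
  assumes "vector_space sc" shows "topspace (weak_topology sc) = UNIV"
proof -
  have "vector_space ((*) :: 's \<Rightarrow> 's \<Rightarrow> 's)"
    by standard (auto simp: algebra_simps)
  then have "0 \<in> bounded_functionals sc"
    using assms by (simp add: bounded_functionals_def Vector_Spaces.linear_iff)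
  then have "UNIV \<in> {blinfun_apply \<phi> -` U |\<phi> U. \<phi> \<in> bounded_functionals sc \<and> open U}"
    by (auto intro!: exI[of _ UNIV])
  then show ?thesis
    unfolding weak_topology_def topology_generated_by_topspace by blast
qed

lemma Hausdorff_weak_topology:
  assumes "\<And>x y. x \<noteq> y \<Longrightarrow> \<exists>\<phi>\<in>bounded_functionals sc. \<phi> x \<noteq> \<phi> y"
  shows "Hausdorff_space (weak_topology sc)"
  unfolding Hausdorff_space_def
proof (intro allI impI)
  fix x y assume xy: "x \<in> topspace (weak_topology sc) \<and> y \<in> topspace (weak_topology sc) \<and> x \<noteq> y"
  then obtain \<phi> where \<phi>: "\<phi> \<in> bounded_functionals sc" "\<phi> x \<noteq> \<phi> y" using assms by blast
  obtain U V where UV: "open U" "open V" "\<phi> x \<in> U" "\<phi> y \<in> V" "U \<inter> V = {}"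
    using hausdorff[OF \<phi>(2)] by blast
  have "openin (weak_topology sc) {z \<in> topspace (weak_topology sc). \<phi> z \<in> W}" if "open W" for W
    using continuous_map_weak_functional[OF \<phi>(1)] that by (simp add: continuous_map_def)
  from this[OF UV(1)] this[OF UV(2)] show "\<exists>U V. openin (weak_topology sc) U \<and>
      openin (weak_topology sc) V \<and> x \<in> U \<and> y \<in> V \<and> disjnt U V"
    using UV xy
    by (intro exI[of _ "{z \<in> topspace (weak_topology sc). \<phi> z \<in> U}"]
        exI[of _ "{z \<in> topspace (weak_topology sc). \<phi> z \<in> V}"]) (auto simp: disjnt_def)
qed

text \<open>
  In a Hausdorff topology a compact set that contains the image of the ball also contains its
  closure.
\<close>

lemma weakly_compact_operatorI:
  assumes "Hausdorff_space (weak_topology sc)" "W \<in> bounded_operators sc"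
    and "compactin (weak_topology sc) C" "blinfun_apply W ` cball 0 1 \<subseteq> C"
  shows "W \<in> weakly_compact_operators sc"
proof -
  have "closedin (weak_topology sc) C"
    using assms(1,3) by (rule compactin_imp_closedin)
  then have "weak_topology sc closure_of (blinfun_apply W ` cball 0 1) \<subseteq> C"
    using assms(4) by (intro closure_of_minimal)
  with assms(2,3) show ?thesis
    unfolding weakly_compact_operators_def by (auto intro: closed_compactin)
qed

lemma weakly_compact_operatorE:
  assumes "W \<in> weakly_compact_operators sc" "topspace (weak_topology sc) = UNIV"
  obtains C where "compactin (weak_topology sc) C" "\<And>x. norm x \<le> 1 \<Longrightarrow> W x \<in> C"
proof (rule that)
  show "compactin (weak_topology sc) (weak_topology sc closure_of (blinfun_apply W ` cball 0 1))"
    using assms(1) by (simp add: weakly_compact_operators_def)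
  show "W x \<in> weak_topology sc closure_of (blinfun_apply W ` cball 0 1)" if "norm x \<le> 1" for x
    using closure_of_subset[of "blinfun_apply W ` cball 0 1" "weak_topology sc"] assms(2) that
    by auto
qed

end

lemma topspace_weak_topology_dual: "topspace (weak_topology dual_scale) = UNIV"
  by (rule topspace_weak_topology[OF vector_space_dual_scale])

lemma Hausdorff_weak_topology_dual:
  "Hausdorff_space (weak_topology (dual_scale :: 's::real_normed_field \<Rightarrow> ('k::topological_space, 's) bcontfun_dual \<Rightarrow> _))"
proof (rule Hausdorff_weak_topology)
  fix \<phi> \<psi> :: "('k, 's) bcontfun_dual" assume "\<phi> \<noteq> \<psi>"
  then obtain f where f: "functional_of \<phi> f \<noteq> functional_of \<psi> f" using dual_eqI by blast
  have "bounded_linear (\<lambda>\<phi> :: ('k, 's) bcontfun_dual. functional_of \<phi> f)"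
    by (rule bounded_linear_intro[where K = "norm f"]) (auto simp: dual_apply norm_functional_of_le)
  then have eval: "blinfun_apply (Blinfun (\<lambda>\<phi>. functional_of \<phi> f)) \<phi> = functional_of \<phi> f" for \<phi> :: "('k, 's) bcontfun_dual"
    by (simp add: bounded_linear_Blinfun_apply)
  show "\<exists>\<Phi>\<in>bounded_functionals dual_scale. \<Phi> \<phi> \<noteq> \<Phi> \<psi>"
    by (rule bexI[of _ "Blinfun (\<lambda>\<phi>. functional_of \<phi> f)"])
      (use f in \<open>simp_all add: eval bounded_functionals_dual_iff\<close>)
qed

lemma topspace_weak_topology_bcontfun: "topspace (weak_topology bcontfun_scale) = UNIV"
  by (rule topspace_weak_topology[OF vector_space_bcontfun_scale])

lemma Hausdorff_weak_topology_bcontfun: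
  "Hausdorff_space (weak_topology (bcontfun_scale :: 's::real_normed_field \<Rightarrow> ('k::topological_space \<Rightarrow>\<^sub>C 's) \<Rightarrow> _))"
proof (rule Hausdorff_weak_topology)
  fix f g :: "'k \<Rightarrow>\<^sub>C 's" assume "f \<noteq> g"
  then obtain x where "f x \<noteq> g x" using bcontfun_eqI by blast
  then show "\<exists>\<phi>\<in>bounded_functionals bcontfun_scale. \<phi> f \<noteq> \<phi> g"
    by (intro bexI[of _ "point_evaluation x"]) (simp_all add: point_evaluation_in_functionals)
qed

lemma compact_product_of_balls:
  "compact {h :: 'i \<Rightarrow> 'b::{real_normed_vector,heine_borel}. \<forall>i. norm (h i) \<le> b i}"
proof -
  have "compactin (product_topology (\<lambda>i. euclidean) UNIV) (PiE UNIV (\<lambda>i. cball (0::'b) (b i)))"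
    by (simp add: compactin_PiE)
  moreover have "PiE UNIV (\<lambda>i. cball (0::'b) (b i)) = {h. \<forall>i. norm (h i) \<le> b i}"
    by (auto simp: PiE_UNIV_domain)
  ultimately show ?thesis
    by (simp add: euclidean_product_topology)
qed

text \<open>
  In the topology of pointwise convergence the order interval is a closed subset of a product of
  balls. By \<open>order_interval_second_dual\<close> the functionals on the dual are uniform limits of evaluations on it, so the
  weak topology is no finer there.
\<close>

lemma compactin_order_interval:
  fixes \<mu> :: "('k::topological_space \<Rightarrow> real) \<Rightarrow> real"
  assumes \<mu>: "positive_functional \<mu>"
  shows "compactin (weak_topology dual_scale)
    (order_interval \<mu> :: ('k, 's::{real_normed_field,euclidean_space}) bcontfun_dual set)"
proof -
  define J where "J = {h :: ('k \<Rightarrow>\<^sub>C 's) \<Rightarrow> 's. \<forall>f. norm (h f) \<le> \<mu> (\<lambda>x. norm (apply_bcontfun f x))} \<inter>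
    ({h. \<forall>f g. h (f + g) = h f + h g} \<inter> {h. \<forall>c f. h (bcontfun_scale c f) = c * h f})"
  have "closed {h :: ('k \<Rightarrow>\<^sub>C 's) \<Rightarrow> 's. \<forall>f g. h (f + g) = h f + h g}"
    "closed {h :: ('k \<Rightarrow>\<^sub>C 's) \<Rightarrow> 's. \<forall>c f. h (bcontfun_scale c f) = c * h f}"
    by (intro closed_Collect_all closed_Collect_eq continuous_intros continuous_on_product_coordinates)+
  then have "compact J"
    unfolding J_def by (intro compact_Int_closed closed_Int compact_product_of_balls)
  define F where "F h = (SOME \<phi>. \<forall>f. functional_of \<phi> f = h f)" for h :: "('k \<Rightarrow>\<^sub>C 's) \<Rightarrow> 's"
  have F: "functional_of (F h) f = h f" if "h \<in> J" for h f
  proof -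
    have bound: "\<mu> (\<lambda>x. norm (f x)) \<le> norm f * \<mu> (\<lambda>x. 1)" for f :: "'k \<Rightarrow>\<^sub>C 's"
      by (rule positive_functional_le_const[OF \<mu>]) (auto intro!: continuous_intros norm_bounded)
    have h: "h (f + g) = h f + h g" "h (bcontfun_scale c f) = c * h f"
      "norm (h f) \<le> norm f * \<mu> (\<lambda>x. 1)" for f g c
      using that bound[of f] order_trans by (auto simp: J_def)
    obtain \<phi> where "\<And>f. functional_of \<phi> f = h f"
      by (rule obtain_functional[of h "\<mu> (\<lambda>x. 1)"]) (use h in auto)
    then have "\<exists>\<phi>. \<forall>f. functional_of \<phi> f = h f" by blast
    from someI_ex[OF this] show ?thesis by (simp add: F_def)
  qed
  have F_in: "F h \<in> order_interval \<mu>" if "h \<in> J" for h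
    using that by (auto simp: order_interval_def F) (simp add: J_def)
  have "continuous_map (top_of_set J) (weak_topology dual_scale) F"
  proof (rule continuous_map_into_weak_topology[OF _ topspace_weak_topology_dual])
    fix \<Phi> :: "('k, 's) bcontfun_dual \<Rightarrow>\<^sub>L 's" assume \<Phi>: "\<Phi> \<in> bounded_functionals dual_scale"
    have "\<exists>f. \<forall>\<psi>\<in>order_interval \<mu>. norm (\<Phi> \<psi> - functional_of \<psi> f) \<le> 1 / real (Suc n)" for n
      using order_interval_second_dual[OF \<mu> \<Phi>, of "1 / real (Suc n)"] by (metis divide_pos_pos of_nat_0_less_iff zero_less_Suc zero_less_one)
    then obtain f where f: "\<And>n \<psi>. \<psi> \<in> order_interval \<mu> \<Longrightarrow> norm (\<Phi> \<psi> - functional_of \<psi> (f n)) \<le> 1 / real (Suc n)"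
      by metis
    have "uniform_limit J (\<lambda>n h. h (f n)) (\<lambda>h. \<Phi> (F h)) sequentially"
    proof (rule uniform_limitI)
      fix e :: real assume "0 < e"
      then obtain N where N: "1 / real (Suc N) < e" using nat_approx_posE by metis
      have "dist (h (f n)) (\<Phi> (F h)) < e" if "N \<le> n" "h \<in> J" for n h
      proof -
        have "norm (\<Phi> (F h) - h (f n)) \<le> 1 / real (Suc n)"
          using f[OF F_in[OF that(2)], of n] by (simp add: F that(2))
        also have "\<dots> \<le> 1 / real (Suc N)" using that(1) by (simp add: frac_le)
        finally show ?thesis using N by (simp add: dist_norm norm_minus_commute)
      qed
      then show "\<forall>\<^sub>F n in sequentially. \<forall>h\<in>J. dist (h (f n)) (\<Phi> (F h)) < e"
        by (auto simp: eventually_sequentially)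
    qed
    then have "continuous_on J (\<lambda>h. \<Phi> (F h))"
      by (rule uniform_limit_theorem[rotated])
        (auto intro!: always_eventually continuous_on_subset[OF continuous_on_product_coordinates subset_UNIV])
    then show "continuous_map (top_of_set J) euclidean (\<lambda>h. \<Phi> (F h))" by simp
  qed
  moreover have "compactin (top_of_set J) J"
    using \<open>compact J\<close> by (simp add: compactin_subtopology)
  ultimately have "compactin (weak_topology dual_scale) (F ` J)"
    by (intro image_compactin)
  moreover have "F ` J = order_interval \<mu>"
  proof
    show "F ` J \<subseteq> order_interval \<mu>" using F_in by blast
    show "order_interval \<mu> \<subseteq> F ` J"
    proof
      fix \<psi> :: "('k, 's) bcontfun_dual" assume "\<psi> \<in> order_interval \<mu>"
      then have "blinfun_apply (functional_of \<psi>) \<in> J"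
        by (simp add: J_def order_interval_def blinfun.add_right functional_of_scale)
      moreover from this have "F (blinfun_apply (functional_of \<psi>)) = \<psi>"
        by (intro dual_eqI F)
      ultimately show "\<psi> \<in> F ` J" by force
    qed
  qed
  ultimately show ?thesis by simp
qed

section \<open>Splitting dominated functionals\<close>

definition sublinear :: "('v::real_vector \<Rightarrow> real) \<Rightarrow> bool"
  where "sublinear p \<longleftrightarrow> (\<forall>x y. p (x + y) \<le> p x + p y) \<and> (\<forall>r x. 0 < r \<longrightarrow> p (r *\<^sub>R x) \<le> r * p x)"

lemma sublinear_add: "sublinear p \<Longrightarrow> p (x + y) \<le> p x + p y"
  and sublinear_scale_le: "sublinear p \<Longrightarrow> 0 < r \<Longrightarrow> p (r *\<^sub>R x) \<le> r * p x"
  by (auto simp: sublinear_def)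

lemma sublinear_scale:
  assumes "sublinear p" "0 < r" shows "p (r *\<^sub>R x) = r * p x"
  using sublinear_scale_le[OF assms, of x] sublinear_scale_le[OF assms(1), of "1 / r" "r *\<^sub>R x"] assms(2)
  by (simp add: field_simps)

lemma sublinear_zero: "sublinear p \<Longrightarrow> p 0 = 0"
  using sublinear_scale[of p 2 0] by simp

lemma sublinear_minus_le: "sublinear p \<Longrightarrow> - p (- x) \<le> p x"
  using sublinear_add[of p x "- x"] sublinear_zero[of p] by simp

text \<open>
  The families to which this is applied are closed under a kind of merging: \<open>F i x + F j y\<close> bounds
  the value of some member at \<open>x + y\<close>, and the infimum inherits subadditivity from this.
\<close>

lemma sublinear_INF:
  fixes F :: "'i \<Rightarrow> 'v::real_vector \<Rightarrow> real"
  assumes ne: "I \<noteq> {}" and bdd: "\<And>x. bdd_below ((\<lambda>i. F i x) ` I)"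
    and add: "\<And>i j x y. i \<in> I \<Longrightarrow> j \<in> I \<Longrightarrow> \<exists>k\<in>I. F k (x + y) \<le> F i x + F j y"
    and scale: "\<And>i r x. i \<in> I \<Longrightarrow> 0 < r \<Longrightarrow> \<exists>k\<in>I. F k (r *\<^sub>R x) \<le> r * F i x"
  shows "sublinear (\<lambda>x. INF i\<in>I. F i x)"
  unfolding sublinear_def
proof (intro conjI allI impI)
  fix x y
  have "(INF i\<in>I. F i (x + y)) - F j y \<le> F i x" if ij: "i \<in> I" "j \<in> I" for i j
  proof -
    obtain k where "k \<in> I" "F k (x + y) \<le> F i x + F j y" using add[OF ij] by blast
    then show ?thesis using cINF_lower[OF bdd[of "x + y"], of k] by linarith
  qed
  then have "(INF i\<in>I. F i (x + y)) - F j y \<le> (INF i\<in>I. F i x)" if "j \<in> I" for j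
    using that by (intro cINF_greatest[OF ne]) auto
  then have "(INF i\<in>I. F i (x + y)) - (INF i\<in>I. F i x) \<le> F j y" if "j \<in> I" for j
    using that by (simp add: algebra_simps)
  then have "(INF i\<in>I. F i (x + y)) - (INF i\<in>I. F i x) \<le> (INF i\<in>I. F i y)"
    by (intro cINF_greatest[OF ne])
  then show "(INF i\<in>I. F i (x + y)) \<le> (INF i\<in>I. F i x) + (INF i\<in>I. F i y)" by simp
next
  fix r :: real and x assume r: "0 < r"
  have "(INF i\<in>I. F i (r *\<^sub>R x)) / r \<le> F i x" if i: "i \<in> I" for i
  proof -
    obtain k where "k \<in> I" "F k (r *\<^sub>R x) \<le> r * F i x" using scale[OF i r, of x] by blast
    then have "(INF i\<in>I. F i (r *\<^sub>R x)) \<le> r * F i x"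
      using cINF_lower[OF bdd[of "r *\<^sub>R x"], of k] by linarith
    then show ?thesis using r by (simp add: field_simps)
  qed
  then have "(INF i\<in>I. F i (r *\<^sub>R x)) / r \<le> (INF i\<in>I. F i x)"
    by (intro cINF_greatest[OF ne])
  then show "(INF i\<in>I. F i (r *\<^sub>R x)) \<le> r * (INF i\<in>I. F i x)"
    using r by (simp add: field_simps)
qed

text \<open>
  For fixed \<open>y\<close> the functional \<open>x \<mapsto> INF t\<ge>0. m (x + t y) - t m y\<close> is sublinear and lies below \<open>m\<close>.
  Minimality makes it equal to \<open>m\<close>, and comparison with \<open>t = 1\<close> gives superadditivity.
\<close>

lemma minimal_sublinear_linear:
  assumes m: "sublinear m" and minimal: "\<And>q. sublinear q \<Longrightarrow> (\<And>x. q x \<le> m x) \<Longrightarrow> q = m"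
  shows "linear m"
proof -
  have super: "m x + m y \<le> m (x + y)" for x y
  proof -
    define F where "F t x = m (x + t *\<^sub>R y) - t * m y" for t x
    have bdd: "bdd_below ((\<lambda>t. F t x) ` {0..})" for x
    proof (rule bdd_belowI2)
      fix t :: real assume "t \<in> {0..}"
      then have "m (t *\<^sub>R y) = t * m y"
        using sublinear_scale[OF m, of t y] sublinear_zero[OF m] by (cases "t = 0") auto
      then show "- m (- x) \<le> F t x"
        using sublinear_add[OF m, of "x + t *\<^sub>R y" "- x"] by (simp add: F_def)
    qed
    have "(\<lambda>x. INF t\<in>{0..}. F t x) = m"
    proof (rule minimal)
      show "sublinear (\<lambda>x. INF t\<in>{0..}. F t x)"
      proof (rule sublinear_INF[OF _ bdd])
        fix s t :: real and x x' assume "s \<in> {0..}" "t \<in> {0..}"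
        then show "\<exists>k\<in>{0..}. F k (x + x') \<le> F s x + F t x'"
          using sublinear_add[OF m, of "x + s *\<^sub>R y" "x' + t *\<^sub>R y"]
          by (intro bexI[of _ "s + t"]) (simp_all add: F_def algebra_simps)
      next
        fix t r :: real and x assume "t \<in> {0..}" "0 < r"
        then show "\<exists>k\<in>{0..}. F k (r *\<^sub>R x) \<le> r * F t x"
          using sublinear_scale_le[OF m, of r "x + t *\<^sub>R y"]
          by (intro bexI[of _ "r * t"]) (simp_all add: F_def algebra_simps)
      qed simp
      show "(INF t\<in>{0..}. F t x) \<le> m x" for x
        using cINF_lower[OF bdd, of 0 x] by (simp add: F_def)
    qed
    then have "m x = (INF t\<in>{0..}. F t x)" by metis
    also have "\<dots> \<le> F 1 x" by (rule cINF_lower[OF bdd]) simp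
    finally show ?thesis by (simp add: F_def)
  qed
  have add: "m (x + y) = m x + m y" for x y
    using super[of x y] sublinear_add[OF m, of x y] by simp
  have minus: "m (- x) = - m x" for x
    using add[of x "- x"] sublinear_zero[OF m] by simp
  show ?thesis
  proof (rule linearI[OF add])
    fix r x
    show "m (r *\<^sub>R x) = r *\<^sub>R m x"
      using sublinear_scale[OF m, of r x] sublinear_scale[OF m, of "- r" x] minus[of "r *\<^sub>R x"]
        sublinear_zero[OF m] by (cases r "0 :: real" rule: linorder_cases) auto
  qed
qed

text \<open>
  The Hahn-Banach theorem, from Zorn's lemma applied to the sublinear functionals below \<open>p\<close>.
\<close>

lemma sublinear_dominates_linear:
  fixes p :: "'v::real_vector \<Rightarrow> real"
  assumes p: "sublinear p"
  obtains L where "linear L" "\<And>x. L x \<le> p x"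
proof -
  define A where "A = {q. sublinear q \<and> (\<forall>x. q x \<le> p x)}"
  define P where "P q r \<longleftrightarrow> (\<forall>x. r x \<le> q x)" for q r :: "'v \<Rightarrow> real"
  have "\<exists>m\<in>A. \<forall>a\<in>A. P m a \<longrightarrow> a = m"
  proof (rule predicate_Zorn)
    show "partial_order_on A (relation_of P A)"
      by (rule partial_order_on_relation_ofI) (auto simp: P_def fun_eq_iff intro: order_trans antisym)
  next
    fix C assume C: "C \<in> Chains (relation_of P A)"
    then have CA: "q \<in> A" if "q \<in> C" for q
      using that by (auto simp: Chains_def relation_of_def)
    have chain: "P q r \<or> P r q" if "q \<in> C" "r \<in> C" for q r
      using C that by (auto simp: Chains_def relation_of_def)
    show "\<exists>u\<in>A. \<forall>a\<in>C. P a u"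
    proof (cases "C = {}")
      case True then show ?thesis using p by (auto simp: A_def)
    next
      case False
      have bdd: "bdd_below ((\<lambda>q. q x) ` C)" for x
      proof (rule bdd_belowI2)
        fix q assume "q \<in> C"
        then have "sublinear q" "q (- x) \<le> p (- x)" using CA by (auto simp: A_def)
        then show "- p (- x) \<le> q x" using sublinear_minus_le[of q x] by simp
      qed
      have "sublinear (\<lambda>x. INF q\<in>C. q x)"
      proof (rule sublinear_INF[OF False bdd])
        fix q r x y assume qr: "q \<in> C" "r \<in> C"
        have sub: "sublinear q" "sublinear r" using CA qr by (auto simp: A_def)
        from chain[OF qr] show "\<exists>k\<in>C. k (x + y) \<le> q x + r y"
        proof
          assume "P q r"
          then have "r (x + y) \<le> q x + r y"
            using sublinear_add[OF sub(2), of x y] by (auto simp: P_def) (smt (verit))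
          then show ?thesis using qr by blast
        next
          assume "P r q"
          then have "q (x + y) \<le> q x + r y"
            using sublinear_add[OF sub(1), of x y] by (auto simp: P_def) (smt (verit))
          then show ?thesis using qr by blast
        qed
      next
        fix q and r :: real and x assume "q \<in> C" "0 < r"
        then show "\<exists>k\<in>C. k (r *\<^sub>R x) \<le> r * q x"
          using CA by (intro bexI[of _ q]) (auto simp: A_def sublinear_scale_le)
      qed
      moreover have "(INF q\<in>C. q x) \<le> r x" if "r \<in> C" for r x
        using cINF_lower[OF bdd that] .
      moreover from this have "(INF q\<in>C. q x) \<le> p x" for x
        using False CA order_trans unfolding A_def by blast
      ultimately show ?thesis
        by (intro bexI[of _ "\<lambda>x. INF q\<in>C. q x"]) (auto simp: A_def P_def)
    qed
  qed
  then obtain m where m: "m \<in> A" "\<And>a. a \<in> A \<Longrightarrow> P m a \<Longrightarrow> a = m" by blast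
  have "linear m"
  proof (rule minimal_sublinear_linear)
    show "sublinear m" using m(1) by (simp add: A_def)
    show "q = m" if "sublinear q" "\<And>x. q x \<le> m x" for q
      using m that by (auto simp: A_def P_def intro: order_trans)
  qed
  with m(1) show thesis by (intro that[of m]) (auto simp: A_def)
qed

text \<open>
  A linear functional below \<open>x \<mapsto> INF y. p (x + y) + r y - L y\<close> serves as \<open>M\<close>: the choice \<open>y = 0\<close>
  gives \<open>M \<le> p\<close>, and the choice \<open>x = - y\<close> gives \<open>L - M \<le> r\<close>.
\<close>

lemma split_linear_below_sum:
  fixes L :: "'v::real_vector \<Rightarrow> real"
  assumes L: "linear L" and p: "sublinear p" and r: "sublinear r" and le: "\<And>x. L x \<le> p x + r x"
  obtains M where "linear M" "\<And>x. M x \<le> p x" "\<And>x. L x - M x \<le> r x"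
proof -
  define F where "F y x = p (x + y) + r y - L y" for y x
  have bdd: "bdd_below (range (\<lambda>y. F y x))" for x
  proof (rule bdd_belowI2)
    show "- p (- x) \<le> F y x" for y
      using le[of y] sublinear_add[OF p, of "x + y" "- x"] by (simp add: F_def)
  qed
  have "sublinear (\<lambda>x. INF y. F y x)"
  proof (rule sublinear_INF[OF _ bdd])
    fix y z x x'
    show "\<exists>k\<in>UNIV. F k (x + x') \<le> F y x + F z x'"
      using sublinear_add[OF p, of "x + y" "x' + z"] sublinear_add[OF r, of y z]
      by (intro bexI[of _ "y + z"]) (auto simp: F_def linear_add[OF L] algebra_simps)
  next
    fix y x and c :: real assume "0 < c"
    then show "\<exists>k\<in>UNIV. F k (c *\<^sub>R x) \<le> c * F y x"
      using sublinear_scale[OF p, of c "x + y"] sublinear_scale[OF r, of c y]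
      by (intro bexI[of _ "c *\<^sub>R y"]) (auto simp: F_def linear_scale[OF L] algebra_simps)
  qed simp
  then obtain M where M: "linear M" "\<And>x. M x \<le> (INF y. F y x)"
    using sublinear_dominates_linear by blast
  have M_le: "M x \<le> F y x" for x y
    using M(2)[of x] cINF_lower[OF bdd, of y x] by simp
  show thesis
  proof (rule that[OF M(1)])
    show "M x \<le> p x" for x
      using M_le[of x 0] by (simp add: F_def sublinear_zero[OF r] linear_0[OF L])
    show "L x - M x \<le> r x" for x
      using M_le[of "- x" x] by (simp add: F_def sublinear_zero[OF p] linear_neg[OF M(1)])
  qed
qed

text \<open>
  The measure \<open>\<nu>\<close> is truncated at \<open>\<mu>\<close>. The splitting is carried out for real parts; as both bounds are
  invariant under rotation, passing back to scalar-linear functionals costs no constant.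
\<close>

lemma split_functional:
  fixes \<nu> :: "('k::topological_space, 's::{real_normed_field,euclidean_space}) functional"
  assumes \<mu>: "positive_functional \<mu>" and \<nu>: "\<nu> \<in> bounded_functionals bcontfun_scale" and C: "0 \<le> C"
    and le: "\<And>f. norm (\<nu> f) \<le> \<mu> (\<lambda>x. norm (f x)) + C * norm f"
  obtains \<rho> where "\<rho> \<in> order_interval \<mu>" "\<And>f. norm (\<nu> f - functional_of \<rho> f) \<le> C * norm f"
proof -
  define p where "p f = \<mu> (\<lambda>x. norm (apply_bcontfun f x))" for f :: "'k \<Rightarrow>\<^sub>C 's"
  have p_rotate: "p (bcontfun_scale u f) = p f" if "norm u = 1" for u f
    using that by (simp add: p_def norm_mult)
  have "sublinear p"
    unfolding sublinear_def p_def
  proof (intro conjI allI impI)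
    show "\<mu> (\<lambda>x. norm ((f + g) x)) \<le> \<mu> (\<lambda>x. norm (f x)) + \<mu> (\<lambda>x. norm (g x))" for f g :: "'k \<Rightarrow>\<^sub>C 's"
    proof -
      have "\<mu> (\<lambda>x. norm ((f + g) x)) \<le> \<mu> (\<lambda>x. norm (f x) + norm (g x))"
        by (rule positive_functional_mono[OF \<mu>]) (auto intro!: continuous_intros norm_triangle_ineq)
      then show ?thesis
        by (simp add: positive_functional_add[OF \<mu>] continuous_on_norm)
    qed
    show "\<mu> (\<lambda>x. norm ((r *\<^sub>R f) x)) \<le> r * \<mu> (\<lambda>x. norm (f x))" if "0 < r" for r and f :: "'k \<Rightarrow>\<^sub>C 's"
      using that by (simp add: positive_functional_scale[OF \<mu>] continuous_on_norm)
  qed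
  moreover have "sublinear (\<lambda>f :: 'k \<Rightarrow>\<^sub>C 's. C * norm f)"
    unfolding sublinear_def using C
    by (auto simp: distrib_left[symmetric] intro!: mult_left_mono norm_triangle_ineq)
  moreover have "linear (\<lambda>f. inner (\<nu> f) 1)"
    by (rule linearI) (simp_all add: blinfun.add_right blinfun.scaleR_right inner_add_left)
  moreover have "inner (\<nu> f) 1 \<le> p f + C * norm f" for f
    using le[of f] norm_inner_one_le[of "\<nu> f"] by (simp add: p_def)
  ultimately obtain M where M: "linear M" "\<And>f. M f \<le> p f" "\<And>f. inner (\<nu> f) 1 - M f \<le> C * norm f"
    using split_linear_below_sum[of "\<lambda>f. inner (\<nu> f) 1" p "\<lambda>f. C * norm f"] by blast
  have "p f \<le> norm f * \<mu> (\<lambda>x. 1)" for f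
    unfolding p_def
    by (rule positive_functional_le_const[OF \<mu>]) (auto intro!: continuous_intros norm_bounded)
  then obtain \<rho> where \<rho>: "\<And>f. inner (functional_of \<rho> f) 1 = M f"
    using functional_with_real_part[OF M(1), of "\<mu> (\<lambda>x. 1)"] order_trans[OF M(2)] by blast
  show thesis
  proof (rule that)
    show "\<rho> \<in> order_interval \<mu>"
      unfolding order_interval_def p_def[symmetric]
    proof (intro CollectI allI norm_le_if_inner_one_le)
      show "inner (u * functional_of \<rho> f) 1 \<le> p f" if "norm u = 1" for u f
        using M(2)[of "bcontfun_scale u f"] by (simp add: \<rho>[symmetric] functional_of_scale p_rotate that)
    qed
    show "norm (\<nu> f - functional_of \<rho> f) \<le> C * norm f" for f
    proof (rule norm_le_if_inner_one_le)
      show "inner (u * (\<nu> f - functional_of \<rho> f)) 1 \<le> C * norm f" if "norm u = 1" for u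
        using M(3)[of "bcontfun_scale u f"]
        by (simp add: \<rho>[symmetric] functional_of_scale bounded_functional_scale[OF \<nu>]
            norm_bcontfun_scale that right_diff_distrib inner_diff_left)
    qed
  qed
qed

section \<open>Approximating the adjoint by a weakly compact operator\<close>

text \<open>
  The weights are normalised cut-offs of the distance between the values of the functions in \<open>F\<close> at
  \<open>y\<close> and at finitely many points \<open>x\<close>.
\<close>

lemma partition_of_unity:
  fixes F :: "('k::topological_space \<Rightarrow>\<^sub>C 'b::real_normed_vector) set"
  assumes compact: "compact (UNIV :: 'k set)" and F: "finite F" and e: "0 < e"
  shows "\<exists>X p. finite X \<and> (\<forall>x\<in>X. continuous_on UNIV (p x)) \<and> (\<forall>x\<in>X. \<forall>y. (0::real) \<le> p x y) \<and>
    (\<forall>y. (\<Sum>x\<in>X. p x y) = 1) \<and>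
    (\<forall>f\<in>F. \<forall>x\<in>X. \<forall>y. p x y \<noteq> 0 \<longrightarrow> norm (apply_bcontfun f y - apply_bcontfun f x) < e)"
proof -
  define d where "d x y = max 0 (e - (\<Sum>f\<in>F. norm (apply_bcontfun f y - apply_bcontfun f x)))" for x y
  have d_cont: "continuous_on UNIV (d x)" for x
    unfolding d_def by (intro continuous_intros) auto
  have d_nonneg: "0 \<le> d x y" for x y by (simp add: d_def)
  have d_close: "norm (f y - f x) < e" if "f \<in> F" "d x y \<noteq> 0" for f :: "'k \<Rightarrow>\<^sub>C 'b" and x y
  proof -
    have "norm (f y - f x) \<le> (\<Sum>f\<in>F. norm (apply_bcontfun f y - apply_bcontfun f x))"
      using F that(1) by (intro member_le_sum) auto
    with that(2) show ?thesis by (auto simp: d_def max_def split: if_splits)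
  qed
  have "open {y. 0 < d x y}" for x
    using d_cont by (intro open_Collect_less) auto
  moreover have "UNIV \<subseteq> (\<Union>x\<in>UNIV. {y. 0 < d x y})"
  proof
    fix y :: 'k
    have "0 < d y y" using e by (simp add: d_def)
    then show "y \<in> (\<Union>x\<in>UNIV. {y. 0 < d x y})" by blast
  qed
  ultimately obtain X where X: "finite X" "UNIV \<subseteq> (\<Union>x\<in>X. {y. 0 < d x y})"
    by (rule compactE_image[OF compact])
  have pos: "0 < (\<Sum>x\<in>X. d x y)" for y
  proof -
    obtain x where "x \<in> X" "0 < d x y" using X(2) by blast
    then show ?thesis using X(1) d_nonneg by (intro sum_pos2) auto
  qed
  show ?thesis
  proof (intro exI[of _ X] exI[of _ "\<lambda>x y. d x y / (\<Sum>z\<in>X. d z y)"] conjI ballI allI impI)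
    show "continuous_on UNIV (\<lambda>y. d x y / (\<Sum>z\<in>X. d z y))" for x
      using d_cont pos by (intro continuous_intros) (auto simp: less_imp_neq[THEN not_sym])
    show "0 \<le> d x y / (\<Sum>z\<in>X. d z y)" for x y
      using d_nonneg pos[of y] by simp
    show "(\<Sum>x\<in>X. d x y / (\<Sum>z\<in>X. d z y)) = 1" for y
      using pos[of y] by (simp add: sum_divide_distrib[symmetric])
    show "norm (f y - f x) < e" if "f \<in> F" "d x y / (\<Sum>z\<in>X. d z y) \<noteq> 0" for f x y
      using d_close that by simp
  qed (use X in auto)
qed

text \<open>
  Rotating the summands turns the sum into the value of \<open>\<phi>\<close> at a function of norm at most one.
\<close>

lemma sum_norm_functional_partition_le:
  fixes \<phi> :: "('k::topological_space, 's::{real_normed_field,euclidean_space}) bcontfun_dual"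
  assumes compact: "compact (UNIV :: 'k set)"
    and p: "\<And>x. x \<in> X \<Longrightarrow> continuous_on UNIV (p x)" "\<And>x y. x \<in> X \<Longrightarrow> 0 \<le> p x y"
      "\<And>y. (\<Sum>x\<in>X. p x y) = 1"
  shows "(\<Sum>x\<in>X. norm (functional_of \<phi> (Bcontfun (\<lambda>y. of_real (p x y))))) \<le> norm \<phi>"
proof -
  define q where "q x = (Bcontfun (\<lambda>y. of_real (p x y)) :: 'k \<Rightarrow>\<^sub>C 's)" for x
  have q: "q x y = of_real (p x y)" if "x \<in> X" for x y
    unfolding q_def using p(1)[OF that] by (simp add: apply_Bcontfun_compact[OF compact] continuous_on_of_real)
  define u where "u x = (SOME u. norm u = 1 \<and> u * functional_of \<phi> (q x) = of_real (norm (functional_of \<phi> (q x))))" for x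
  have "norm (u x) = 1 \<and> u x * functional_of \<phi> (q x) = of_real (norm (functional_of \<phi> (q x)))" for x
    unfolding u_def by (rule someI_ex) (metis obtain_phase)
  then have u: "norm (u x) = 1" "u x * functional_of \<phi> (q x) = of_real (norm (functional_of \<phi> (q x)))" for x
    by auto
  define g where "g = (\<Sum>x\<in>X. bcontfun_scale (u x) (q x))"
  have "norm g \<le> 1"
  proof (rule norm_bound)
    fix y
    have "norm (g y) \<le> (\<Sum>x\<in>X. norm (u x * q x y))"
      using norm_sum[of "\<lambda>x. u x * q x y" X] by (simp add: g_def apply_bcontfun_sum)
    also have "\<dots> = (\<Sum>x\<in>X. p x y)"
      using p(2) by (intro sum.cong) (auto simp: q norm_mult u)
    finally show "norm (g y) \<le> 1" by (simp add: p(3))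
  qed
  have "functional_of \<phi> g = of_real (\<Sum>x\<in>X. norm (functional_of \<phi> (q x)))"
    by (simp add: g_def blinfun.sum_right functional_of_scale u)
  then have "norm (functional_of \<phi> g) = \<bar>\<Sum>x\<in>X. norm (functional_of \<phi> (q x))\<bar>"
    by (simp only: norm_of_real)
  then have "(\<Sum>x\<in>X. norm (functional_of \<phi> (q x))) = norm (functional_of \<phi> g)"
    by (simp add: sum_nonneg)
  also have "\<dots> \<le> norm \<phi> * norm g" by (rule norm_functional_of_le)
  also have "\<dots> \<le> norm \<phi>" using \<open>norm g \<le> 1\<close> by (simp add: mult_left_le)
  finally show ?thesis by (simp add: q_def)
qed

lemma closed_Collect_coordinate_add:
  "closed {B :: 'i \<Rightarrow> 'b::real_normed_vector. B i = B j + B k}"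
  by (intro closed_Collect_eq continuous_on_add continuous_on_product_coordinates)

lemma closed_Collect_coordinate_mult:
  "closed {B :: 'i \<Rightarrow> 'b::real_normed_field. B i = c * B j}"
  by (intro closed_Collect_eq continuous_on_mult continuous_on_const continuous_on_product_coordinates)

text \<open>
  The functional \<open>\<phi> \<circ> T\<close> is a limit of the sums of \<open>\<phi> (p x) \<cdot> (T f x)\<close> over finer and finer
  partitions of unity \<open>p\<close>. Each functional \<open>f \<mapsto> T f x\<close> is within \<open>C\<close> of some \<open>\<rho> x\<close> in the order
  interval of \<open>\<mu>\<close>. Replacing it by \<open>\<rho> x\<close> gives operators that move the unit ball of the dual into
  the order interval, and a cluster point of these operators is within \<open>C\<close> of the adjoint of \<open>T\<close>. The
  cluster point is found as a bilinear form \<open>B (\<phi>, f)\<close> in a compact product of balls.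
\<close>

theorem weak_ess_norm_adjoint_le:
  fixes T :: "('k::topological_space, 's::{real_normed_field,euclidean_space}) operator"
  assumes compact: "compact (UNIV :: 'k set)" and T: "T \<in> bounded_operators bcontfun_scale"
    and \<mu>: "positive_functional \<mu>" and C: "0 \<le> C"
    and le: "\<And>f x. norm (T f x) \<le> \<mu> (\<lambda>y. norm (f y)) + C * norm f"
  shows "weak_ess_norm dual_scale (adjoint_operator T) \<le> C"
proof -
  have "\<exists>\<rho>. \<rho> \<in> order_interval \<mu> \<and> (\<forall>f. norm (T f x - functional_of \<rho> f) \<le> C * norm f)" for x
  proof -
    have "point_evaluation x o\<^sub>L T \<in> bounded_functionals bcontfun_scale"
      by (simp add: bounded_functionals_bcontfun_iff bounded_operator_scale[OF T])
    moreover have "norm ((point_evaluation x o\<^sub>L T) f) \<le> \<mu> (\<lambda>y. norm (f y)) + C * norm f" for f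
      using le by simp
    ultimately obtain \<rho> where "\<rho> \<in> order_interval \<mu>"
      "\<And>f. norm ((point_evaluation x o\<^sub>L T) f - functional_of \<rho> f) \<le> C * norm f"
      by (rule split_functional[OF \<mu> _ C]) blast
    then show ?thesis by auto
  qed
  then obtain \<rho> where "\<forall>x. \<rho> x \<in> order_interval \<mu> \<and> (\<forall>f. norm (T f x - functional_of (\<rho> x) f) \<le> C * norm f)"
    using choice[of "\<lambda>x \<rho>. \<rho> \<in> order_interval \<mu> \<and> (\<forall>f. norm (T f x - functional_of \<rho> f) \<le> C * norm f)"] by blast
  then have \<rho>: "norm (functional_of (\<rho> x) f) \<le> \<mu> (\<lambda>y. norm (f y))"
    "norm (T f x - functional_of (\<rho> x) f) \<le> C * norm f" for x f
    by (simp_all add: order_interval_def)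
  have \<mu>_nonneg: "0 \<le> \<mu> (\<lambda>y. norm (f y))" for f :: "'k \<Rightarrow>\<^sub>C 's"
    by (rule positive_functional_nonneg[OF \<mu>]) (auto intro!: continuous_intros)
  define H where "H = {B :: ('k, 's) bcontfun_dual \<times> ('k \<Rightarrow>\<^sub>C 's) \<Rightarrow> 's.
      \<forall>i. norm (B i) \<le> norm (fst i) * \<mu> (\<lambda>y. norm (apply_bcontfun (snd i) y))} \<inter>
    (({B. \<forall>\<phi> \<psi> f. B (\<phi> + \<psi>, f) = B (\<phi>, f) + B (\<psi>, f)} \<inter>
      {B. \<forall>c \<phi> f. B (dual_scale c \<phi>, f) = c * B (\<phi>, f)}) \<inter>
     ({B. \<forall>\<phi> f g. B (\<phi>, f + g) = B (\<phi>, f) + B (\<phi>, g)} \<inter>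
      {B. \<forall>\<phi> c f. B (\<phi>, bcontfun_scale c f) = c * B (\<phi>, f)}))"
  have "compact H"
    unfolding H_def
    by (intro compact_Int_closed closed_Int compact_product_of_balls closed_Collect_all
        closed_Collect_coordinate_add closed_Collect_coordinate_mult)
  \<comment> \<open>the forms whose error at \<open>f = fst fe\<close> exceeds the bound \<open>C\<close> by at most \<open>snd fe\<close>\<close>
  define S where "S fe = {B :: ('k, 's) bcontfun_dual \<times> ('k \<Rightarrow>\<^sub>C 's) \<Rightarrow> 's.
      \<forall>\<phi>. norm (functional_of \<phi> (T (fst fe)) - B (\<phi>, fst fe)) \<le> norm \<phi> * (C * norm (fst fe) + snd fe)}"
    for fe :: "('k \<Rightarrow>\<^sub>C 's) \<times> real"
  have "H \<inter> (\<Inter>fe\<in>UNIV \<times> {0<..}. S fe) \<noteq> {}"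
  proof (rule compact_imp_fip_image[OF \<open>compact H\<close>])
    show "closed (S fe)" for fe
      unfolding S_def
      by (intro closed_Collect_all closed_Collect_le continuous_on_norm continuous_on_diff
          continuous_on_const continuous_on_product_coordinates)
  next
    fix I :: "(('k \<Rightarrow>\<^sub>C 's) \<times> real) set" assume I: "finite I" "I \<subseteq> UNIV \<times> {0<..}"
    define e where "e = Min (insert 1 (snd ` I))"
    have e: "0 < e" "\<And>fe. fe \<in> I \<Longrightarrow> e \<le> snd fe"
      using I by (auto simp: e_def)
    obtain X and p :: "'k \<Rightarrow> 'k \<Rightarrow> real" where X: "finite X" and p': "\<forall>x\<in>X. continuous_on UNIV (p x)"
      "\<forall>x\<in>X. \<forall>y. 0 \<le> p x y" "\<forall>y. (\<Sum>x\<in>X. p x y) = 1"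
      and p_close: "\<forall>f\<in>(\<lambda>fe. T (fst fe)) ` I. \<forall>x\<in>X. \<forall>y. p x y \<noteq> 0 \<longrightarrow> norm (apply_bcontfun f y - apply_bcontfun f x) < e"
      using partition_of_unity[OF compact finite_imageI[OF I(1)] e(1), of "\<lambda>fe. T (fst fe)"]
      by blast
    from p' have p: "x \<in> X \<Longrightarrow> continuous_on UNIV (p x)" "x \<in> X \<Longrightarrow> 0 \<le> p x y"
      "(\<Sum>x\<in>X. p x y) = 1" for x y
      by simp_all
    define q where "q x = (Bcontfun (\<lambda>y. of_real (p x y)) :: 'k \<Rightarrow>\<^sub>C 's)" for x
    have q: "q x y = of_real (p x y)" if "x \<in> X" for x y
      unfolding q_def using p(1)[OF that] by (simp add: apply_Bcontfun_compact[OF compact] continuous_on_of_real)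
    have q_sum: "(\<Sum>x\<in>X. norm (functional_of \<phi> (q x))) \<le> norm \<phi>" for \<phi> :: "('k, 's) bcontfun_dual"
      unfolding q_def by (rule sum_norm_functional_partition_le[OF compact p])
    have sum_bound: "(\<Sum>x\<in>X. norm (functional_of \<phi> (q x)) * b) \<le> norm \<phi> * b" if "0 \<le> b"
      for \<phi> :: "('k, 's) bcontfun_dual" and b
      using mult_right_mono[OF q_sum that] by (simp add: sum_distrib_right)
    define B where "B i = (\<Sum>x\<in>X. functional_of (fst i) (q x) * functional_of (\<rho> x) (snd i))"
      for i :: "('k, 's) bcontfun_dual \<times> ('k \<Rightarrow>\<^sub>C 's)"
    have "B \<in> H"
    proof -
      have "norm (B i) \<le> norm (fst i) * \<mu> (\<lambda>y. norm (apply_bcontfun (snd i) y))" for i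
      proof -
        have "norm (B i) \<le> (\<Sum>x\<in>X. norm (functional_of (fst i) (q x)) * \<mu> (\<lambda>y. norm (apply_bcontfun (snd i) y)))"
          unfolding B_def by (intro sum_norm_le) (auto simp: norm_mult intro!: mult_left_mono \<rho>)
        also have "\<dots> \<le> norm (fst i) * \<mu> (\<lambda>y. norm (apply_bcontfun (snd i) y))"
          by (rule sum_bound[OF \<mu>_nonneg])
        finally show ?thesis .
      qed
      moreover have "B (\<phi> + \<psi>, f) = B (\<phi>, f) + B (\<psi>, f)" "B (dual_scale c \<phi>, f) = c * B (\<phi>, f)"
        "B (\<phi>, f + g) = B (\<phi>, f) + B (\<phi>, g)" "B (\<phi>, bcontfun_scale c f) = c * B (\<phi>, f)" for \<phi> \<psi> f g c
        by (simp_all add: B_def dual_apply blinfun.add_right functional_of_scale distrib_left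
            distrib_right sum.distrib sum_distrib_left mult.assoc mult.left_commute)
      ultimately show ?thesis
        unfolding H_def by blast
    qed
    moreover have "B \<in> S fe" if "fe \<in> I" for fe
      unfolding S_def
    proof (intro CollectI allI)
      fix \<phi> :: "('k, 's) bcontfun_dual"
      define f where "f = fst fe"
      define Tf where "Tf = (\<Sum>x\<in>X. bcontfun_scale (T f x) (q x))"
      have "norm (T f - Tf) \<le> e"
      proof (rule norm_bound)
        fix y
        have "(T f - Tf) y = (\<Sum>x\<in>X. p x y *\<^sub>R T f y) - (\<Sum>x\<in>X. p x y *\<^sub>R T f x)"
        proof -
          have "(\<Sum>x\<in>X. p x y *\<^sub>R T f y) = T f y"
            using p(3)[of y] by (simp add: scaleR_left.sum[symmetric])
          moreover have "Tf y = (\<Sum>x\<in>X. p x y *\<^sub>R T f x)"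
            by (simp add: Tf_def apply_bcontfun_sum q scaleR_conv_of_real mult.commute)
          ultimately show ?thesis by simp
        qed
        also have "\<dots> = (\<Sum>x\<in>X. p x y *\<^sub>R (T f y - T f x))"
          by (simp add: sum_subtractf scaleR_right_diff_distrib)
        also have "norm \<dots> \<le> (\<Sum>x\<in>X. p x y * e)"
        proof (rule sum_norm_le)
          fix x assume x: "x \<in> X"
          show "norm (p x y *\<^sub>R (T f y - T f x)) \<le> p x y * e"
          proof (cases "p x y = 0")
            case False
            then have "norm (T f y - T f x) < e"
              using bspec[OF p_close, of "T f"] x \<open>fe \<in> I\<close> by (simp add: f_def)
            then show ?thesis
              using p(2)[OF x, of y] by (simp add: mult_left_mono)
          qed simp
        qed
        also have "\<dots> = e" using p(3)[of y] by (simp add: sum_distrib_right[symmetric])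
        finally show "norm ((T f - Tf) y) \<le> e" .
      qed
      then have "norm (functional_of \<phi> (T f - Tf)) \<le> norm \<phi> * e"
        using norm_functional_of_le[of \<phi> "T f - Tf"] mult_left_mono[of _ e "norm \<phi>"] by (meson norm_ge_zero order_trans)
      moreover have "functional_of \<phi> Tf - B (\<phi>, f) =
          (\<Sum>x\<in>X. functional_of \<phi> (q x) * (T f x - functional_of (\<rho> x) f))"
        by (simp add: Tf_def B_def blinfun.sum_right functional_of_scale right_diff_distrib sum_subtractf mult.commute)
      moreover have "norm (\<Sum>x\<in>X. functional_of \<phi> (q x) * (T f x - functional_of (\<rho> x) f)) \<le>
          (\<Sum>x\<in>X. norm (functional_of \<phi> (q x)) * (C * norm f))"
        by (intro sum_norm_le) (auto simp: norm_mult intro!: mult_left_mono \<rho>)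
      moreover have "\<dots> \<le> norm \<phi> * (C * norm f)"
        using C by (intro sum_bound) simp
      moreover have "functional_of \<phi> (T f) - B (\<phi>, f) = functional_of \<phi> (T f - Tf) + (functional_of \<phi> Tf - B (\<phi>, f))"
        by (simp add: blinfun.diff_right)
      ultimately have "norm (functional_of \<phi> (T f) - B (\<phi>, f)) \<le> norm \<phi> * e + norm \<phi> * (C * norm f)"
        using norm_triangle_ineq[of "functional_of \<phi> (T f - Tf)" "functional_of \<phi> Tf - B (\<phi>, f)"] by simp
      also have "\<dots> \<le> norm \<phi> * (C * norm f + snd fe)"
        using e(2)[OF that] by (simp add: distrib_left mult_left_mono)
      finally show "norm (functional_of \<phi> (T (fst fe)) - B (\<phi>, fst fe)) \<le> norm \<phi> * (C * norm (fst fe) + snd fe)"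
        by (simp add: f_def)
    qed
    ultimately show "H \<inter> (\<Inter>fe\<in>I. S fe) \<noteq> {}" by blast
  qed
  then obtain B where "B \<in> H" and S: "\<And>f e. 0 < e \<Longrightarrow> B \<in> S (f, e)" by auto
  then have B_add: "B (\<phi> + \<psi>, f) = B (\<phi>, f) + B (\<psi>, f)" "B (\<phi>, f + g) = B (\<phi>, f) + B (\<phi>, g)"
    and B_scale: "B (dual_scale c \<phi>, f) = c * B (\<phi>, f)" "B (\<phi>, bcontfun_scale c f) = c * B (\<phi>, f)"
    and B_le: "norm (B (\<phi>, f)) \<le> norm \<phi> * \<mu> (\<lambda>y. norm (f y))" for \<phi> \<psi> f g c
    by (auto simp: H_def)
  have B_close: "norm (functional_of \<phi> (T f) - B (\<phi>, f)) \<le> norm \<phi> * (C * norm f)" for \<phi> f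
  proof (rule field_le_epsilon)
    fix e :: real assume e: "0 < e"
    define d where "d = e / (norm \<phi> + 1)"
    have d: "0 < d" "norm \<phi> * d \<le> e"
      using e norm_ge_zero[of \<phi>] unfolding d_def
      by (simp_all add: pos_divide_le_eq divide_pos_pos add_nonneg_pos)
    from S[OF d(1), of f] d(2) show "norm (functional_of \<phi> (T f) - B (\<phi>, f)) \<le> norm \<phi> * (C * norm f) + e"
      unfolding S_def by (simp add: distrib_left) (meson add_left_mono order_trans)
  qed
  have \<mu>_le: "\<mu> (\<lambda>y. norm (f y)) \<le> norm f * \<mu> (\<lambda>x. 1)" for f :: "'k \<Rightarrow>\<^sub>C 's"
    by (rule positive_functional_le_const[OF \<mu>]) (auto intro!: continuous_intros norm_bounded)
  have "\<exists>\<psi>. \<forall>f. functional_of \<psi> f = B (\<phi>, f)" for \<phi>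
  proof (rule obtain_functional[of "\<lambda>f. B (\<phi>, f)" "norm \<phi> * \<mu> (\<lambda>x. 1)"])
    show "norm (B (\<phi>, f)) \<le> norm f * (norm \<phi> * \<mu> (\<lambda>x. 1))" for f
      using B_le[of \<phi> f] mult_left_mono[OF \<mu>_le[of f] norm_ge_zero[of \<phi>]] by (simp add: mult.left_commute)
  qed (use B_add B_scale in auto)
  then obtain R' where R': "\<And>\<phi> f. functional_of (R' \<phi>) f = B (\<phi>, f)" by metis
  have "bounded_linear R'"
  proof (rule bounded_linear_intro[where K = "\<mu> (\<lambda>x. 1)"])
    show "R' (\<phi> + \<psi>) = R' \<phi> + R' \<psi>" for \<phi> \<psi>
      by (rule dual_eqI) (simp add: R' dual_apply B_add)
    show "R' (r *\<^sub>R \<phi>) = r *\<^sub>R R' \<phi>" for r \<phi>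
    proof (rule dual_eqI)
      have "r *\<^sub>R \<phi> = dual_scale (of_real r) \<phi>"
        by (rule dual_eqI) (simp add: dual_apply scaleR_conv_of_real)
      then show "functional_of (R' (r *\<^sub>R \<phi>)) f = functional_of (r *\<^sub>R R' \<phi>) f" for f
        by (simp add: R' dual_apply B_scale scaleR_conv_of_real)
    qed
    show "norm (R' \<phi>) \<le> norm \<phi> * \<mu> (\<lambda>x. 1)" for \<phi>
    proof (rule norm_dual_le)
      show "norm (functional_of (R' \<phi>) f) \<le> norm \<phi> * \<mu> (\<lambda>x. 1) * norm f" for f
        using B_le[of \<phi> f] mult_left_mono[OF \<mu>_le[of f] norm_ge_zero[of \<phi>]] by (simp add: R' mult_ac)
      show "0 \<le> norm \<phi> * \<mu> (\<lambda>x. 1)"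
        by (intro mult_nonneg_nonneg positive_functional_nonneg[OF \<mu>]) auto
    qed
  qed
  then have R: "blinfun_apply (Blinfun R') = R'" by (rule bounded_linear_Blinfun_apply)
  have "Blinfun R' \<in> weakly_compact_operators dual_scale"
  proof (rule weakly_compact_operatorI[OF Hausdorff_weak_topology_dual _ compactin_order_interval[OF \<mu>]])
    have "R' (dual_scale c \<phi>) = dual_scale c (R' \<phi>)" for c \<phi>
      by (rule dual_eqI) (simp add: R' B_scale)
    then show "Blinfun R' \<in> bounded_operators dual_scale"
      using bounded_linear.linear[OF \<open>bounded_linear R'\<close>]
      by (simp add: bounded_operators_def Vector_Spaces.linear_iff R vector_space_dual_scale linear_add)
    show "blinfun_apply (Blinfun R') ` cball 0 1 \<subseteq> order_interval \<mu>"
    proof clarsimp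
      fix \<phi> :: "('k, 's) bcontfun_dual" assume "norm \<phi> \<le> 1"
      then have "norm \<phi> * \<mu> (\<lambda>y. norm (f y)) \<le> \<mu> (\<lambda>y. norm (f y))" for f :: "'k \<Rightarrow>\<^sub>C 's"
        using \<mu>_nonneg[of f] by (simp add: mult_left_le_one_le)
      then show "blinfun_apply (Blinfun R') \<phi> \<in> order_interval \<mu>"
        using order_trans[OF B_le[of \<phi>]] by (simp add: order_interval_def R R')
    qed
  qed
  then have "weak_ess_norm dual_scale (adjoint_operator T) \<le> norm (adjoint_operator T - Blinfun R')"
    unfolding weak_ess_norm_def by (intro cINF_lower bdd_belowI2[where m = 0]) auto
  also have "\<dots> \<le> C"
  proof (rule norm_blinfun_bound[OF C])
    fix \<phi> :: "('k, 's) bcontfun_dual"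
    show "norm ((adjoint_operator T - Blinfun R') \<phi>) \<le> C * norm \<phi>"
      by (rule norm_dual_le)
        (use B_close[of \<phi>] C in \<open>simp_all add: blinfun.diff_left R R' dual_apply
          functional_of_adjoint_operator[OF T] mult_ac\<close>)
  qed
  finally show ?thesis .
qed

section \<open>Disjoint sequences on which an undominated operator stays large\<close>

definition unit_function :: "('k::topological_space \<Rightarrow> real) \<Rightarrow> bool"
  where "unit_function f \<longleftrightarrow> continuous_on UNIV f \<and> (\<forall>x. 0 \<le> f x \<and> f x \<le> 1)"

lemma closed_positive_functionals:
  "closed {m :: ('k::topological_space \<Rightarrow> real) \<Rightarrow> real. positive_functional m}"
  unfolding positive_functional_def
  by (intro closed_Collect_conj closed_Collect_all closed_Collect_imp open_Collect_const
      closed_Collect_eq closed_Collect_le continuous_on_add continuous_on_mult continuous_on_const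
      continuous_on_product_coordinates)

text \<open>
  For every \<open>\<mu>\<close> consider the members of \<open>M\<close> that exceed \<open>\<mu>\<close> by more than \<open>C\<close> at some function. These
  sets are directed downwards, so by compactness their closures have a common point \<open>m0\<close>. The point of
  the construction is that \<open>\<mu>\<close> may afterwards be chosen as a multiple of \<open>m0\<close> itself.
\<close>

lemma accumulation_functional:
  fixes M :: "(('k::topological_space \<Rightarrow> real) \<Rightarrow> real) set"
  assumes compact: "compact (UNIV :: 'k set)"
    and M: "\<And>m. m \<in> M \<Longrightarrow> positive_functional m" "\<And>m. m \<in> M \<Longrightarrow> m (\<lambda>x. 1) \<le> D"
    and undominated: "\<And>\<mu>. positive_functional \<mu> \<Longrightarrow> \<exists>m\<in>M. \<exists>f. unit_function f \<and> \<mu> f + C < m f"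
  shows "\<exists>m0. positive_functional m0 \<and>
    (\<forall>t S e. 0 \<le> t \<longrightarrow> finite S \<longrightarrow> (\<forall>s\<in>S. continuous_on UNIV s) \<longrightarrow> 0 < e \<longrightarrow>
      (\<exists>m\<in>M. \<exists>f. unit_function f \<and> t * m0 f + C < m f \<and> (\<forall>s\<in>S. \<bar>m s - m0 s\<bar> < e)))"
proof -
  \<comment> \<open>values at discontinuous functions are reset so that all functionals lie in a compact product\<close>
  define restr where "restr m f = (if continuous_on UNIV f then m f else 0)"
    for m :: "('k \<Rightarrow> real) \<Rightarrow> real" and f :: "'k \<Rightarrow> real"
  have restr: "restr m f = m f" if "continuous_on UNIV f" for m f
    using that by (simp add: restr_def)
  have restr_positive: "positive_functional (restr m)" if "positive_functional m" for m
    using that unfolding positive_functional_def by (simp add: restr continuous_on_add continuous_on_mult)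
  define b where "b f = D * (SOME c. \<forall>x. \<bar>f x\<bar> \<le> c)" for f :: "'k \<Rightarrow> real"
  have m_le: "\<bar>m f\<bar> \<le> b f" if m: "m \<in> M" and f: "continuous_on UNIV f" for m f
  proof -
    have "\<exists>c. \<forall>x. \<bar>f x\<bar> \<le> c"
      using compact_imp_bounded[OF compact_continuous_image[OF f compact]] by (auto simp: bounded_iff)
    from someI_ex[OF this] obtain c where abs_le: "\<And>x. \<bar>f x\<bar> \<le> c" and b: "b f = D * c"
      unfolding b_def by blast
    have c: "f x \<le> c" "- f x \<le> c" "0 \<le> c" for x
      using abs_le[of x] by linarith+
    have "m f \<le> c * m (\<lambda>x. 1)"
      by (rule positive_functional_le_const[OF M(1)[OF m] f c(1)])
    moreover have "m (\<lambda>x. - f x) \<le> c * m (\<lambda>x. 1)"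
      by (rule positive_functional_le_const[OF M(1)[OF m] continuous_on_minus[OF f] c(2)])
    moreover have "m (\<lambda>x. - f x) = - m f"
      using positive_functional_scale[OF M(1)[OF m] f, of "- 1"] by simp
    moreover have "c * m (\<lambda>x. 1) \<le> c * D"
      by (intro mult_left_mono M(2)[OF m] c(3))
    ultimately have "m f \<le> D * c" "- m f \<le> D * c" by (simp_all add: mult.commute)
    then show ?thesis unfolding b by linarith
  qed
  define Q where "Q = {m :: ('k \<Rightarrow> real) \<Rightarrow> real. \<forall>f. norm (m f) \<le> (if continuous_on UNIV f then b f else 0)}"
  have Q: "restr m \<in> Q" if "m \<in> M" for m
    using m_le[OF that] by (simp add: Q_def restr_def)
  define A where "A \<mu> = {m \<in> M. \<exists>f. unit_function f \<and> \<mu> f + C < m f}" for \<mu>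
  have "Q \<inter> (\<Inter>\<mu>\<in>{\<mu>. positive_functional \<mu>}. closure (restr ` A \<mu>)) \<noteq> {}"
  proof (rule compact_imp_fip_image)
    show "compact Q" unfolding Q_def by (rule compact_product_of_balls)
  next
    fix I :: "(('k \<Rightarrow> real) \<Rightarrow> real) set" assume I: "finite I" "I \<subseteq> {\<mu>. positive_functional \<mu>}"
    \<comment> \<open>the sum dominates each member of \<open>I\<close>\<close>
    then have "positive_functional (\<lambda>f. \<Sum>\<mu>\<in>I. \<mu> f)"
      by (intro positive_functional_sum_functionals) auto
    then obtain m f where m: "m \<in> M" "unit_function f" "(\<Sum>\<mu>\<in>I. \<mu> f) + C < m f"
      using undominated by blast
    have "restr m \<in> closure (restr ` A \<mu>)" if "\<mu> \<in> I" for \<mu>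
    proof -
      have "0 \<le> \<mu>' f" if "\<mu>' \<in> I" for \<mu>'
        using I(2) that m(2) by (intro positive_functional_nonneg[of \<mu>']) (auto simp: unit_function_def)
      then have "\<mu> f \<le> (\<Sum>\<mu>\<in>I. \<mu> f)"
        using I(1) that by (intro member_le_sum[of \<mu> I "\<lambda>\<mu>. \<mu> f"]) auto
      then have "m \<in> A \<mu>" using m by (auto simp: A_def)
      then have "restr m \<in> restr ` A \<mu>" by (rule imageI)
      then show ?thesis by (rule subsetD[OF closure_subset])
    qed
    with Q[OF m(1)] have "restr m \<in> Q \<inter> (\<Inter>\<mu>\<in>I. closure (restr ` A \<mu>))" by simp
    then show "Q \<inter> (\<Inter>\<mu>\<in>I. closure (restr ` A \<mu>)) \<noteq> {}" by (metis empty_iff)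
  qed simp
  then obtain m0 where "m0 \<in> Q \<inter> (\<Inter>\<mu>\<in>{\<mu>. positive_functional \<mu>}. closure (restr ` A \<mu>))"
    by (meson ex_in_conv)
  then have m0: "m0 \<in> closure (restr ` A \<mu>)" if "positive_functional \<mu>" for \<mu>
    using that by simp
  show ?thesis
  proof (intro exI conjI allI impI)
    have "positive_functional (\<lambda>f :: 'k \<Rightarrow> real. 0)" by (simp add: positive_functional_def)
    from m0[OF this] have "m0 \<in> closure (restr ` M)"
      by (rule subsetD[OF closure_mono, rotated]) (auto simp: A_def)
    also have "\<dots> \<subseteq> {m. positive_functional m}"
      by (intro closure_minimal closed_positive_functionals image_subsetI CollectI restr_positive M(1))
    finally show m0_positive: "positive_functional m0" by simp
    fix t e :: real and S :: "('k \<Rightarrow> real) set"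
    assume t: "0 \<le> t" and S: "finite S" "\<forall>s\<in>S. continuous_on UNIV s" and e: "0 < e"
    define U where "U = (\<Inter>s\<in>S. {m :: ('k \<Rightarrow> real) \<Rightarrow> real. \<bar>m s - m0 s\<bar> < e})"
    have "open U"
      unfolding U_def
      by (intro open_INT S(1) ballI open_Collect_less continuous_on_rabs continuous_on_diff continuous_on_const
          continuous_on_product_coordinates)
    moreover have "m0 \<in> U" using e by (simp add: U_def)
    moreover have "m0 \<in> closure (restr ` A (\<lambda>f. t * m0 f))"
      by (intro m0 positive_functional_mult_right t m0_positive)
    ultimately have "U \<inter> restr ` A (\<lambda>f. t * m0 f) \<noteq> {}"
      using open_Int_closure_eq_empty[of U "restr ` A (\<lambda>f. t * m0 f)"] by (metis IntI empty_iff)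
    then obtain m where m: "m \<in> A (\<lambda>f. t * m0 f)" "restr m \<in> U" by (auto simp: ex_in_conv[symmetric])
    then obtain f where "m \<in> M" "unit_function f" "t * m0 f + C < m f" by (auto simp: A_def)
    moreover have "\<forall>s\<in>S. \<bar>m s - m0 s\<bar> < e"
      using m(2) S(2) by (simp add: U_def restr)
    ultimately show "\<exists>m\<in>M. \<exists>f. unit_function f \<and> t * m0 f + C < m f \<and> (\<forall>s\<in>S. \<bar>m s - m0 s\<bar> < e)"
      by (intro bexI[of _ m] exI[of _ f] conjI)
  qed
qed

text \<open>
  If \<open>t * m0 f + C < m f \<le> D\<close> with \<open>t\<close> large, then \<open>m0 f\<close> is small although \<open>m f\<close> exceeds \<open>C\<close>. So a
  sequence can be chosen in which the earlier functions \<open>f i\<close> are small for \<open>m0\<close>, hence also for the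
  later functionals \<open>m n\<close>, which are close to \<open>m0\<close> on them. Subtracting large multiples of the
  earlier functions and cutting off at a low level then makes the functions disjoint at little cost.
\<close>

lemma disjoint_sequence_of_positive_functionals:
  fixes M :: "(('k::topological_space \<Rightarrow> real) \<Rightarrow> real) set"
  assumes compact: "compact (UNIV :: 'k set)" and C: "0 < C"
    and M: "\<And>m. m \<in> M \<Longrightarrow> positive_functional m" "\<And>m. m \<in> M \<Longrightarrow> m (\<lambda>x. 1) \<le> D"
    and undominated: "\<And>\<mu>. positive_functional \<mu> \<Longrightarrow> \<exists>m\<in>M. \<exists>f. unit_function f \<and> \<mu> f + C < m f"
  obtains m h where "\<And>n::nat. m n \<in> M" "\<And>n. unit_function (h n)" "\<And>n. C / 2 < m n (h n)"
    "\<And>i j y. i \<noteq> j \<Longrightarrow> h i y = 0 \<or> h j y = 0"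
proof -
  have "\<exists>m0. positive_functional m0 \<and>
    (\<forall>t S e. 0 \<le> t \<longrightarrow> finite S \<longrightarrow> (\<forall>s\<in>S. continuous_on UNIV s) \<longrightarrow> 0 < e \<longrightarrow>
      (\<exists>m\<in>M. \<exists>f. unit_function f \<and> t * m0 f + C < m f \<and> (\<forall>s\<in>S. \<bar>m s - m0 s\<bar> < e)))"
    by (rule accumulation_functional[where M = M and D = D and C = C, OF compact]) (fact M undominated)+
  then obtain m0 where m0: "positive_functional m0"
    and near: "\<forall>t S e. 0 \<le> t \<longrightarrow> finite S \<longrightarrow> (\<forall>s\<in>S. continuous_on UNIV s) \<longrightarrow> 0 < e \<longrightarrow>
      (\<exists>m\<in>M. \<exists>f. unit_function f \<and> t * m0 f + C < m f \<and> (\<forall>s\<in>S. \<bar>m s - m0 s\<bar> < e))"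
    by blast
  have M_nonneg: "0 \<le> m (\<lambda>x. 1)" if "m \<in> M" for m
    by (rule positive_functional_nonneg[OF M(1)[OF that]]) auto
  have D: "0 \<le> D"
  proof -
    obtain m where "m \<in> M" using near[rule_format, of 0 "{}" 1] by auto
    with M(2) M_nonneg show ?thesis using order_trans by blast
  qed
  \<comment> \<open>\<open>k\<close> is the cut-off level and \<open>1 / k\<close> the multiple that is subtracted; each costs at most \<open>C / 4\<close>\<close>
  define k where "k = C / (4 * (D + 1))"
  have k: "0 < k" "k * D \<le> C / 4"
    using C D by (simp_all add: k_def pos_divide_le_eq divide_pos_pos)
  define a where "a = k * C / 8"
  have a: "0 < a" using k C by (simp add: a_def)
  define R where "R n S m f \<longleftrightarrow> m \<in> M \<and> unit_function f \<and> C < m f \<and> m0 f \<le> a * (1 / 2) ^ Suc n \<and>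
    (\<forall>s\<in>S. m s \<le> m0 s + a / real (Suc n))" for n S and m :: "('k \<Rightarrow> real) \<Rightarrow> real" and f :: "'k \<Rightarrow> real"
  have step: "\<exists>m f. R n S m f" if S: "finite S" "\<And>s. s \<in> S \<Longrightarrow> continuous_on UNIV s" for n S
  proof -
    define t where "t = (D + 1) * 2 ^ Suc n / a"
    have t: "0 < t" using D a by (simp add: t_def)
    obtain m f where mf: "m \<in> M" "unit_function f" "t * m0 f + C < m f" "\<forall>s\<in>S. \<bar>m s - m0 s\<bar> < a / real (Suc n)"
      using near[rule_format, OF less_imp_le[OF t] S, of "a / real (Suc n)"] a by auto
    have f: "continuous_on UNIV f" "\<And>x. 0 \<le> f x" "\<And>x. f x \<le> 1"
      using mf(2) by (auto simp: unit_function_def)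
    have "0 \<le> m0 f" by (rule positive_functional_nonneg[OF m0 f(1,2)])
    moreover have "m f \<le> D"
      using positive_functional_le_const[OF M(1)[OF mf(1)] f(1,3)] M(2)[OF mf(1)] by simp
    ultimately have "t * m0 f \<le> D + 1" "C < m f"
      using mf(3) C t mult_nonneg_nonneg[of t "m0 f"] by linarith+
    moreover have "m0 f \<le> a * (1 / 2) ^ Suc n"
    proof -
      have "(D + 1) * (2 ^ Suc n * m0 f / a) \<le> (D + 1) * 1"
        using \<open>t * m0 f \<le> D + 1\<close> by (simp add: t_def mult_ac)
      then have "2 ^ Suc n * m0 f / a \<le> 1"
        by (rule mult_left_le_imp_le) (use D in simp)
      then show ?thesis using a by (simp add: field_simps power_one_over)
    qed
    moreover have "m s \<le> m0 s + a / real (Suc n)" if "s \<in> S" for s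
      using bspec[OF mf(4) that] by linarith
    ultimately have "R n S m f"
      using mf(1,2) by (simp add: R_def)
    then show ?thesis by blast
  qed
  \<comment> \<open>\<open>S\<close> collects the functions chosen so far\<close>
  define P where "P n z \<longleftrightarrow> (case z of (S, m, f) \<Rightarrow> finite S \<and> (\<forall>s\<in>S. continuous_on UNIV s) \<and> R n S m f)"
    for n and z :: "('k \<Rightarrow> real) set \<times> (('k \<Rightarrow> real) \<Rightarrow> real) \<times> ('k \<Rightarrow> real)"
  have "\<exists>z. \<forall>n. P n (z n) \<and> fst (z (Suc n)) = insert (snd (snd (z n))) (fst (z n))"
  proof (rule dependent_nat_choice)
    show "\<exists>z. P 0 z"
      using step[of "{}" 0] by (auto simp: P_def)
  next
    fix z n assume "P n z"
    moreover obtain S m f where z: "z = (S, m, f)" by (cases z)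
    ultimately have S: "finite (insert f S)" "\<And>s. s \<in> insert f S \<Longrightarrow> continuous_on UNIV s"
      by (auto simp: P_def R_def unit_function_def)
    from step[OF this] obtain m' f' where "R (Suc n) (insert f S) m' f'" by blast
    with S show "\<exists>w. P (Suc n) w \<and> fst w = insert (snd (snd z)) (fst z)"
      by (intro exI[of _ "(insert f S, m', f')"]) (simp add: P_def z)
  qed
  then obtain z where z: "\<And>n. P n (z n)" "\<And>n. fst (z (Suc n)) = insert (snd (snd (z n))) (fst (z n))"
    by blast
  define m where "m n = fst (snd (z n))" for n
  define f where "f n = snd (snd (z n))" for n
  have R: "R n (fst (z n)) (m n) (f n)" for n
    using z(1)[of n] by (auto simp: P_def m_def f_def split: prod.splits)
  have f_mem: "f i \<in> fst (z n)" if "i < n" for i n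
    using that by (induction n) (auto simp: z(2) f_def less_Suc_eq)
  have m: "m n \<in> M" "C < m n (f n)" for n using R[of n] by (auto simp: R_def)
  have f: "continuous_on UNIV (f n)" "0 \<le> f n x" "f n x \<le> 1" for n x
    using R[of n] by (auto simp: R_def unit_function_def)
  have small: "m n (f i) \<le> a * (1 / 2) ^ Suc i + a / real (Suc n)" if "i < n" for i n
    using R[of n] R[of i] f_mem[OF that] unfolding R_def by fastforce
  have sum_small: "(\<Sum>i<n. m n (f i)) \<le> 2 * a" for n
  proof -
    have "(\<Sum>i<n. m n (f i)) \<le> (\<Sum>i<n. a * (1 / 2) ^ Suc i + a / real (Suc n))"
      by (intro sum_mono small) simp
    also have "\<dots> = a * (\<Sum>i<n. (1 / 2) ^ Suc i) + real n * (a / real (Suc n))"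
      by (simp add: sum.distrib sum_distrib_left)
    also have "(\<Sum>i<n. (1 / 2 :: real) ^ Suc i) = 1 - (1 / 2) ^ n"
      by (induction n) (simp_all add: field_simps)
    also have "a * (1 - (1 / 2) ^ n) \<le> a" using a by simp
    also have "real n * (a / real (Suc n)) \<le> a" using a by (simp add: field_simps)
    finally show ?thesis by simp
  qed
  define h where "h n y = max 0 (f n y - (1 / k) * (\<Sum>i<n. f i y) - k)" for n y
  have sum_nonneg': "0 \<le> (1 / k) * (\<Sum>i<n. f i y)" for n y
    using k(1) f(2) by (simp add: sum_nonneg)
  have disjoint: "h i y = 0 \<or> h j y = 0" if "i < j" for i j y
  proof (rule ccontr)
    assume "\<not> ?thesis"
    then have pos: "0 < f i y - (1 / k) * (\<Sum>i<i. f i y) - k" "0 < f j y - (1 / k) * (\<Sum>i<j. f i y) - k"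
      by (auto simp: h_def max_def split: if_splits)
    then have "k < f i y" using sum_nonneg'[of y i] by linarith
    also have "f i y \<le> (\<Sum>i<j. f i y)" using that f(2) by (intro member_le_sum) auto
    finally have "1 < (1 / k) * (\<Sum>i<j. f i y)" using k(1) by (simp add: field_simps)
    then show False using pos(2) f(3)[of j y] k(1) by linarith
  qed
  show thesis
  proof (rule that[OF m(1)])
    show "unit_function (h n)" for n
      unfolding unit_function_def
    proof (intro conjI allI)
      show "continuous_on UNIV (h n)"
        unfolding h_def by (intro continuous_intros f)
      show "0 \<le> h n x" "h n x \<le> 1" for x
        using sum_nonneg'[of x n] f(3)[of n x] k(1) by (auto simp: h_def)
    qed
    show "C / 2 < m n (h n)" for n
    proof -
      have pm: "positive_functional (m n)" by (rule M(1)[OF m(1)])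
      have cont: "continuous_on UNIV (\<lambda>y. \<Sum>i<n. f i y)" by (intro continuous_intros f)
      have "m n (\<lambda>y. (f n y - (1 / k) * (\<Sum>i<n. f i y)) - k * 1) =
          m n (f n) - (1 / k) * (\<Sum>i<n. m n (f i)) - k * m n (\<lambda>x. 1)"
        by (simp only: positive_functional_diff[OF pm] positive_functional_scale[OF pm]
            positive_functional_sum[OF pm] f cont continuous_on_diff continuous_on_mult continuous_on_const)
      moreover have "(1 / k) * (\<Sum>i<n. m n (f i)) \<le> C / 4"
      proof -
        have "(1 / k) * (\<Sum>i<n. m n (f i)) \<le> (1 / k) * (2 * a)"
          using sum_small k(1) by (intro mult_left_mono) auto
        also have "\<dots> = C / 4" using k(1) by (simp add: a_def)
        finally show ?thesis .
      qed
      moreover have "k * m n (\<lambda>x. 1) \<le> C / 4"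
        using mult_left_mono[OF M(2)[OF m(1), of n], of k] k by linarith
      moreover have "m n (\<lambda>y. (f n y - (1 / k) * (\<Sum>i<n. f i y)) - k * 1) \<le> m n (h n)"
        unfolding h_def using k(1) by (intro positive_functional_mono[OF pm]) (auto intro!: continuous_intros f)
      ultimately show ?thesis using m(2)[of n] by linarith
    qed
    show "i \<noteq> j \<Longrightarrow> h i y = 0 \<or> h j y = 0" for i j y
      using disjoint by (metis linorder_neqE_nat)
  qed
qed

text \<open>
  The preceding lemma applies to the total variations of the functionals \<open>f \<mapsto> T f x\<close>. A function on
  which such a variation is large dominates some \<open>g\<close> with \<open>T g x\<close> large.
\<close>

theorem undominated_operator_disjoint_sequence:
  fixes T :: "('k::topological_space, 's::{real_normed_field,euclidean_space}) operator"
  assumes compact: "compact (UNIV :: 'k set)" and T: "T \<in> bounded_operators bcontfun_scale" and C: "0 < C"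
    and undominated: "\<And>\<mu>. positive_functional \<mu> \<Longrightarrow> \<exists>f x. \<mu> (\<lambda>y. norm (apply_bcontfun f y)) + C * norm f < norm (T f x)"
  obtains g x where "\<And>n::nat. norm (g n) \<le> 1" "\<And>n. C / 2 < norm (T (g n) (x n))"
    "\<And>i j y. i \<noteq> j \<Longrightarrow> g i y = 0 \<or> g j y = 0"
proof -
  define \<nu> where "\<nu> x = point_evaluation x o\<^sub>L T" for x
  have \<nu>: "\<nu> x \<in> bounded_functionals bcontfun_scale" "\<nu> x f = T f x" for x f
    by (simp_all add: \<nu>_def bounded_functionals_bcontfun_iff bounded_operator_scale[OF T])
  have norm_\<nu>: "norm (\<nu> x) \<le> norm T" for x
  proof -
    have "norm (\<nu> x) \<le> norm (point_evaluation x :: ('k, 's) functional) * norm T"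
      unfolding \<nu>_def by (rule norm_blinfun_compose)
    also have "\<dots> \<le> 1 * norm T"
      by (intro mult_right_mono norm_point_evaluation_le) simp
    finally show ?thesis by simp
  qed
  note var = positive_functional_variation[OF compact \<nu>(1)]
  obtain m h where mh: "\<And>n::nat. m n \<in> range (\<lambda>x. variation (\<nu> x))" "\<And>n. unit_function (h n)"
    "\<And>n. C / 2 < m n (h n)" and disjoint: "\<And>i j y. i \<noteq> j \<Longrightarrow> h i y = 0 \<or> h j y = 0"
  proof (rule disjoint_sequence_of_positive_functionals[OF compact C])
    show "positive_functional m" if "m \<in> range (\<lambda>x. variation (\<nu> x))" for m
      using that var by auto
    show "m (\<lambda>x. 1) \<le> norm T" if "m \<in> range (\<lambda>x. variation (\<nu> x))" for m
      using that variation_one_le[OF compact \<nu>(1)] norm_\<nu> order_trans by blast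
    fix \<mu> :: "('k \<Rightarrow> real) \<Rightarrow> real" assume \<mu>: "positive_functional \<mu>"
    from undominated[OF \<mu>] obtain f x where fx: "\<mu> (\<lambda>y. norm (apply_bcontfun f y)) + C * norm f < norm (T f x)" by blast
    have cont: "continuous_on UNIV (\<lambda>y. norm (f y))" by (intro continuous_intros) auto
    have "f \<noteq> 0" using fx positive_functional_zero[OF \<mu>] by auto
    then have f: "0 < norm f" by simp
    have "unit_function (\<lambda>y. (1 / norm f) * norm (f y))"
      using f cont norm_bounded[of f] by (auto simp: unit_function_def intro!: continuous_intros)
    moreover have "\<mu> (\<lambda>y. (1 / norm f) * norm (f y)) + C < variation (\<nu> x) (\<lambda>y. (1 / norm f) * norm (f y))"
    proof -
      have "\<mu> (\<lambda>y. norm (f y)) + C * norm f < variation (\<nu> x) (\<lambda>y. norm (f y))"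
        using norm_le_variation[OF compact \<nu>(1), of x f] fx by (simp add: \<nu>(2))
      then have "(\<mu> (\<lambda>y. norm (f y)) + C * norm f) / norm f < variation (\<nu> x) (\<lambda>y. norm (f y)) / norm f"
        using f by (rule divide_strict_right_mono)
      then show ?thesis
        using f by (simp only: positive_functional_scale[OF \<mu> cont] positive_functional_scale[OF var cont])
          (simp add: add_divide_distrib)
    qed
    ultimately show "\<exists>m\<in>range (\<lambda>x. variation (\<nu> x)). \<exists>f. unit_function f \<and> \<mu> f + C < m f" by blast
  qed blast
  have "\<exists>x g. (\<forall>y. norm (apply_bcontfun g y) \<le> h n y) \<and> C / 2 < norm (T g x)" for n
  proof -
    obtain x where x: "m n = variation (\<nu> x)" using mh(1)[of n] by blast
    obtain g where "\<And>y. norm (apply_bcontfun g y) \<le> h n y" "C / 2 < norm (\<nu> x g)"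
      by (rule less_variationE[OF compact \<nu>(1), of "C / 2" x "h n"])
        (use mh(2)[of n] mh(3)[of n] x in \<open>auto simp: unit_function_def\<close>)
    then show ?thesis by (auto simp: \<nu>(2))
  qed
  then obtain x g where g: "\<And>n y. norm (apply_bcontfun (g n) y) \<le> h n y" "\<And>n. C / 2 < norm (T (g n) (x n))"
    by metis
  show thesis
  proof (rule that[OF _ g(2)])
    show "norm (g n) \<le> 1" for n
    proof (rule norm_bound)
      show "norm (g n y) \<le> 1" for y
        using g(1)[of n y] mh(2)[of n] by (auto simp: unit_function_def intro: order_trans)
    qed
    show "g i y = 0 \<or> g j y = 0" if "i \<noteq> j" for i j y
      using disjoint[OF that, of y] g(1)[of i y] g(1)[of j y] by auto
  qed
qed

section \<open>Fixing a copy of the null sequences\<close>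

text \<open>
  A disjoint sequence \<open>g\<close> in the unit ball defines the operator \<open>c \<mapsto> \<Sum>i. c i * g i\<close> from the null
  sequences into \<open>C(K)\<close>, and a sequence \<open>\<phi>\<close> of functionals that tends to zero pointwise defines
  \<open>f \<mapsto> (\<phi> i f)\<close> in the other direction.
\<close>

definition disjoint_unit_sequence :: "(nat \<Rightarrow> 'k::topological_space \<Rightarrow>\<^sub>C 's::real_normed_field) \<Rightarrow> bool"
  where "disjoint_unit_sequence g \<longleftrightarrow>
    (\<forall>i. norm (g i) \<le> 1) \<and> (\<forall>i j x. i \<noteq> j \<longrightarrow> apply_bcontfun (g i) x = 0 \<or> apply_bcontfun (g j) x = 0)"

definition weak_star_null ::
    "real \<Rightarrow> (nat \<Rightarrow> ('k::topological_space, 's::real_normed_field) functional) \<Rightarrow> bool"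
  where "weak_star_null b \<phi> \<longleftrightarrow>
    (\<forall>i. \<phi> i \<in> bounded_functionals bcontfun_scale \<and> norm (\<phi> i) \<le> b) \<and> (\<forall>f. (\<lambda>i. \<phi> i f) \<longlonglongrightarrow> 0)"

lemma weak_star_nullD:
  assumes "weak_star_null b \<phi>"
  shows "\<phi> i \<in> bounded_functionals bcontfun_scale" "norm (\<phi> i) \<le> b" "(\<lambda>i. \<phi> i f) \<longlonglongrightarrow> 0"
    "norm (\<phi> i f) \<le> b * norm f"
  using assms norm_blinfun[of "\<phi> i" f] mult_right_mono[of "norm (\<phi> i)" b "norm f"]
  by (auto simp: weak_star_null_def intro: order_trans)

lemma disjoint_unit_sequence_comp:
  "disjoint_unit_sequence g \<Longrightarrow> inj r \<Longrightarrow> disjoint_unit_sequence (\<lambda>i. g (r i))"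
  unfolding disjoint_unit_sequence_def inj_def by metis

lemma weak_star_null_comp:
  assumes "weak_star_null b \<phi>" "filterlim r at_top sequentially"
  shows "weak_star_null b (\<lambda>i. \<phi> (r i))"
  using assms filterlim_compose[OF _ assms(2)] by (auto simp: weak_star_null_def)

lemma norm_sum_disjoint_le:
  fixes g :: "nat \<Rightarrow> 'k::topological_space \<Rightarrow>\<^sub>C 's::real_normed_field"
  assumes g: "disjoint_unit_sequence g" and c: "\<And>i. i \<in> A \<Longrightarrow> norm (c i) \<le> b" and b: "0 \<le> b"
  shows "norm (\<Sum>i\<in>A. bcontfun_scale (c i) (g i)) \<le> b"
proof (cases "finite A")
  case finite: True
  show ?thesis
  proof (rule norm_bound)
    fix x
    have "norm (\<Sum>i\<in>A. c i * g i x) \<le> b"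
    proof (cases "\<exists>k\<in>A. g k x \<noteq> 0")
      case True
      then obtain k where k: "k \<in> A" "g k x \<noteq> 0" by blast
      then have "g i x = 0" if "i \<noteq> k" for i
        using g that by (auto simp: disjoint_unit_sequence_def)
      then have "(\<Sum>i\<in>A. c i * g i x) = (\<Sum>i\<in>A. if i = k then c k * g k x else 0)"
        by (intro sum.cong) auto
      also have "\<dots> = c k * g k x" using finite k by simp
      also have "norm \<dots> \<le> b * 1"
        unfolding norm_mult
      proof (intro mult_mono c[OF k(1)] b)
        show "norm (g k x) \<le> 1"
          using g norm_bounded[of "g k" x] by (auto simp: disjoint_unit_sequence_def intro: order_trans)
      qed simp
      finally show ?thesis by simp
    next
      case False
      then have "(\<Sum>i\<in>A. c i * g i x) = 0" by (intro sum.neutral) auto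
      then show ?thesis using b by simp
    qed
    then show "norm ((\<Sum>i\<in>A. bcontfun_scale (c i) (g i)) x) \<le> b"
      by (simp add: apply_bcontfun_sum)
  qed
qed (use b in simp)

text \<open>
  After rotation the partial sums of \<open>norm (\<nu> (g i))\<close> are values of \<open>\<nu>\<close> on the unit ball.
\<close>

lemma functional_disjoint_tendsto_zero:
  fixes g :: "nat \<Rightarrow> 'k::topological_space \<Rightarrow>\<^sub>C 's::{real_normed_field,euclidean_space}"
  assumes g: "disjoint_unit_sequence g" and \<nu>: "\<nu> \<in> bounded_functionals bcontfun_scale"
  shows "(\<lambda>i. \<nu> (g i)) \<longlonglongrightarrow> 0"
proof -
  have "(\<Sum>i<n. norm (\<nu> (g i))) \<le> norm \<nu>" for n
  proof -
    have "\<exists>u. norm u = 1 \<and> u * \<nu> (g i) = of_real (norm (\<nu> (g i)))" for i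
      using obtain_phase by metis
    then obtain u where u: "\<And>i. norm (u i) = 1" "\<And>i. u i * \<nu> (g i) = of_real (norm (\<nu> (g i)))"
      by metis
    have "\<nu> (\<Sum>i<n. bcontfun_scale (u i) (g i)) = of_real (\<Sum>i<n. norm (\<nu> (g i)))"
      by (simp add: blinfun.sum_right bounded_functional_scale[OF \<nu>] u)
    then have "norm (\<nu> (\<Sum>i<n. bcontfun_scale (u i) (g i))) = \<bar>\<Sum>i<n. norm (\<nu> (g i))\<bar>"
      by (simp only: norm_of_real)
    moreover have "norm (\<nu> (\<Sum>i<n. bcontfun_scale (u i) (g i))) \<le> norm \<nu> * 1"
      using norm_sum_disjoint_le[OF g, of "{..<n}" u 1] u(1)
      by (intro order_trans[OF norm_blinfun] mult_left_mono) auto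
    ultimately show ?thesis by simp
  qed
  then have "summable (\<lambda>i. norm (\<nu> (g i)))"
    by (intro bounded_imp_summable[of _ "norm \<nu>"]) (simp_all only: lessThan_Suc_atMost[symmetric] norm_ge_zero)
  then have "(\<lambda>i. norm (\<nu> (g i))) \<longlonglongrightarrow> 0" by (rule summable_LIMSEQ_zero)
  then show ?thesis by (rule tendsto_norm_zero_cancel)
qed

text \<open>
  Each new index is taken beyond the point from which on the rows and columns with smaller indices
  have become small.
\<close>

lemma off_diagonal_subsequence:
  fixes a :: "nat \<Rightarrow> nat \<Rightarrow> real"
  assumes rows: "\<And>i. a i \<longlonglongrightarrow> 0" and columns: "\<And>j. (\<lambda>i. a i j) \<longlonglongrightarrow> 0" and e: "0 < e"
  obtains r where "strict_mono r" "\<And>i j. i \<noteq> j \<Longrightarrow> \<bar>a (r i) (r j)\<bar> \<le> e * (1 / 2) ^ (i + j)"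
proof -
  define Q where "Q n k l \<longleftrightarrow> k < l \<and> (\<forall>p\<le>k. \<forall>q\<ge>l. \<bar>a p q\<bar> \<le> e * (1 / 4) ^ Suc n \<and> \<bar>a q p\<bar> \<le> e * (1 / 4) ^ Suc n)"
    for n k l :: nat
  have "\<exists>r. \<forall>n. True \<and> Q n (r n) (r (Suc n))"
  proof (rule dependent_nat_choice)
    fix k n :: nat
    define d where "d = e * (1 / 4) ^ Suc n"
    have d: "0 < d" using e by (simp add: d_def)
    have "\<forall>\<^sub>F q in sequentially. \<bar>a p q\<bar> \<le> d \<and> \<bar>a q p\<bar> \<le> d" for p
      using tendstoD[OF rows[of p] d] tendstoD[OF columns[of p] d]
      by eventually_elim (simp add: dist_real_def)
    then have "\<forall>\<^sub>F q in sequentially. \<forall>p\<in>{..k}. \<bar>a p q\<bar> \<le> d \<and> \<bar>a q p\<bar> \<le> d"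
      by (intro eventually_ball_finite) auto
    then obtain l where "\<forall>q\<ge>l. \<forall>p\<in>{..k}. \<bar>a p q\<bar> \<le> d \<and> \<bar>a q p\<bar> \<le> d"
      by (auto simp: eventually_sequentially)
    then show "\<exists>l. True \<and> Q n k l"
      by (intro exI[of _ "max l (Suc k)"]) (auto simp: Q_def d_def)
  qed simp
  then obtain r where r: "\<And>n. Q n (r n) (r (Suc n))" by blast
  have mono: "strict_mono r" using r by (auto simp: strict_mono_Suc_iff Q_def)
  have close: "\<bar>a (r i) (r j)\<bar> \<le> e * (1 / 2) ^ (i + j) \<and> \<bar>a (r j) (r i)\<bar> \<le> e * (1 / 2) ^ (i + j)"
    if ij: "i < j" for i j
  proof -
    obtain n where n: "j = Suc n" using ij by (cases j) auto
    then have "r i \<le> r n" using mono ij by (simp add: strict_mono_less_eq)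
    then have "\<bar>a (r i) (r j)\<bar> \<le> e * (1 / 4) ^ j" "\<bar>a (r j) (r i)\<bar> \<le> e * (1 / 4) ^ j"
      using r[of n] by (auto simp: Q_def n)
    moreover have "e * (1 / 4) ^ j \<le> e * (1 / 2) ^ (i + j)"
    proof -
      have "(1 / 4 :: real) ^ j = (1 / 2) ^ (j + j)"
        by (simp add: power_add power_mult_distrib[symmetric])
      also have "\<dots> \<le> (1 / 2) ^ (i + j)" using ij by (intro power_decreasing) auto
      finally show ?thesis using e by simp
    qed
    ultimately show ?thesis by linarith
  qed
  show thesis
  proof (rule that[OF mono])
    show "\<bar>a (r i) (r j)\<bar> \<le> e * (1 / 2) ^ (i + j)" if "i \<noteq> j" for i j
      using close[of i j] close[of j i] that by (cases "i < j") (auto simp: add.commute)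
  qed
qed

lemma weak_star_null_point_differences:
  assumes "X \<longlonglongrightarrow> l"
  shows "weak_star_null 2 (\<lambda>i. point_evaluation (X i) - point_evaluation l)"
proof -
  have "(\<lambda>i. apply_bcontfun f (X i) - apply_bcontfun f l) \<longlonglongrightarrow> 0" for f :: "'a \<Rightarrow>\<^sub>C 'b"
    using continuous_on_tendsto_compose[OF continuous_on_apply_bcontfun[of UNIV f] assms]
    by (intro LIM_zero) simp
  moreover have "norm (point_evaluation (X i) - point_evaluation l :: ('a \<Rightarrow>\<^sub>C 'b) \<Rightarrow>\<^sub>L 'b) \<le> 1 + 1" for i
    by (intro order_trans[OF norm_triangle_ineq4] add_mono norm_point_evaluation_le)
  ultimately show ?thesis
    by (simp add: weak_star_null_def bounded_functionals_bcontfun_iff blinfun.diff_left right_diff_distrib)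
qed

text \<open>
  Up to the factor \<open>w\<close> and rapidly decreasing entries, \<open>\<phi>\<close> inverts \<open>T\<close> on the span of \<open>g\<close>, and the
  bounds on \<open>\<phi>\<close> and \<open>g\<close> are absolute constants. As \<open>T\<close> is not dominated with
  constant \<open>w / 2\<close>, there are disjoint functions \<open>g i\<close> and points \<open>X i\<close> with \<open>T (g i) (X i)\<close> larger than
  \<open>w / 4\<close>. Sequential compactness lets the points converge to some \<open>l\<close>. Then the differences of the
  evaluations at \<open>X i\<close> and \<open>l\<close> tend to zero pointwise, while \<open>T (g i) l\<close> tends to zero by
  disjointness, so that the matrix of their values at \<open>T (g j)\<close> has null rows, null columns, and a
  diagonal that is eventually above \<open>w / 8\<close>.
\<close>

theorem essential_operator_fixes_null_sequences:
  fixes T :: "('k::topological_space, 's::{real_normed_field,euclidean_space}) operator"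
  assumes compact: "compact (UNIV :: 'k set)" and seq_compact: "seq_compact (UNIV :: 'k set)"
    and T: "T \<in> bounded_operators bcontfun_scale"
    and w: "w = weak_ess_norm dual_scale (adjoint_operator T)" "0 < w"
  obtains \<phi> g where "weak_star_null 16 \<phi>" "disjoint_unit_sequence g"
    "\<And>i. \<phi> i (T (g i)) = of_real w" "\<And>i j. i \<noteq> j \<Longrightarrow> norm (\<phi> i (T (g j))) \<le> (1 / 2) ^ (i + j)"
proof -
  have undominated: "\<exists>f x. \<mu> (\<lambda>y. norm (apply_bcontfun f y)) + w / 2 * norm f < norm (T f x)"
    if \<mu>: "positive_functional \<mu>" for \<mu>
  proof (rule ccontr)
    assume "\<not> ?thesis"
    then have "norm (T f x) \<le> \<mu> (\<lambda>y. norm (apply_bcontfun f y)) + w / 2 * norm f" for f x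
      by (meson linorder_not_less)
    then have "w \<le> w / 2"
      unfolding w(1) using w by (intro weak_ess_norm_adjoint_le[OF compact T \<mu>]) auto
    then show False using w(2) by simp
  qed
  obtain g0 x0 where g0: "\<And>n::nat. norm (g0 n) \<le> 1" "\<And>n. w / 2 / 2 < norm (T (g0 n) (x0 n))"
    "\<And>i j y. i \<noteq> j \<Longrightarrow> g0 i y = 0 \<or> g0 j y = 0"
  proof (rule undominated_operator_disjoint_sequence[OF compact T])
    show "0 < w / 2" using w(2) by simp
    show "\<exists>f x. \<mu> (\<lambda>y. norm (apply_bcontfun f y)) + w / 2 * norm f < norm (T f x)"
      if "positive_functional \<mu>" for \<mu> using that by (rule undominated)
  qed blast
  obtain l s where s: "strict_mono s" "(x0 \<circ> s) \<longlonglongrightarrow> l"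
    by (rule seq_compactE[OF seq_compact, of x0]) auto
  define X where "X = x0 \<circ> s"
  have X: "X \<longlonglongrightarrow> l" using s(2) by (simp add: X_def)
  define \<psi> where "\<psi> i = (point_evaluation (X i) - point_evaluation l :: ('k, 's) functional)" for i
  have \<psi>: "weak_star_null 2 \<psi>"
    unfolding \<psi>_def by (rule weak_star_null_point_differences[OF X])
  define g1 where "g1 i = g0 (s i)" for i
  have "disjoint_unit_sequence g0" using g0(1,3) by (simp add: disjoint_unit_sequence_def)
  then have g1: "disjoint_unit_sequence g1"
    unfolding g1_def by (rule disjoint_unit_sequence_comp) (rule strict_mono_imp_inj_on[OF s(1)])
  have g1_null: "(\<lambda>j. \<nu> (T (g1 j))) \<longlonglongrightarrow> 0" if "\<nu> \<in> bounded_functionals bcontfun_scale" for \<nu> :: "('k, 's) functional"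
    using functional_disjoint_tendsto_zero[OF g1, of "\<nu> o\<^sub>L T"] that
    by (simp add: bounded_functionals_bcontfun_iff bounded_operator_scale[OF T])
  have "\<forall>\<^sub>F i in sequentially. norm (T (g1 i) l) < w / 8"
    using tendstoD[OF g1_null[OF point_evaluation_in_functionals, of l], of "w / 8"] w(2) by simp
  then obtain N where N: "\<And>i. N \<le> i \<Longrightarrow> norm (T (g1 i) l) < w / 8"
    by (auto simp: eventually_sequentially)
  have diagonal: "w / 8 < norm (\<psi> i (T (g1 i)))" if "N \<le> i" for i
    using N[OF that] g0(2)[of "s i"] norm_triangle_ineq2[of "T (g1 i) (X i)" "T (g1 i) l"]
    by (simp add: \<psi>_def blinfun.diff_left X_def g1_def)
  define a where "a i j = norm (\<psi> (i + N) (T (g1 (j + N))))" for i j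
  obtain r where r: "strict_mono r" and off: "\<And>i j. i \<noteq> j \<Longrightarrow> \<bar>a (r i) (r j)\<bar> \<le> 1 / 8 * (1 / 2) ^ (i + j)"
  proof (rule off_diagonal_subsequence[of a "1 / 8"])
    have shift: "filterlim (\<lambda>i. i + N) at_top sequentially"
      by (rule filterlim_add_const_nat_at_top)
    show "a i \<longlonglongrightarrow> 0" for i
      unfolding a_def using filterlim_compose[OF g1_null[OF weak_star_nullD(1)[OF \<psi>]] shift]
      by (rule tendsto_norm_zero)
    show "(\<lambda>i. a i j) \<longlonglongrightarrow> 0" for j
      unfolding a_def using filterlim_compose[OF weak_star_nullD(3)[OF \<psi>] shift]
      by (rule tendsto_norm_zero)
  qed auto
  define k where "k i = r i + N" for i
  have k: "filterlim k at_top sequentially" "inj k"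
    using r filterlim_subseq[OF r] filterlim_compose[OF filterlim_add_const_nat_at_top filterlim_subseq[OF r], of N]
    by (auto simp: k_def[abs_def] inj_def strict_mono_eq add.commute)
  \<comment> \<open>normalises the diagonal to \<open>w\<close>\<close>
  define c where "c i = of_real w / \<psi> (k i) (T (g1 (k i)))" for i
  have c: "norm (c i) \<le> 8" for i
  proof -
    have "w / 8 < norm (\<psi> (k i) (T (g1 (k i))))" by (rule diagonal) (simp add: k_def)
    moreover from this have "0 < norm (\<psi> (k i) (T (g1 (k i))))" using w(2) by linarith
    ultimately show ?thesis using w(2) by (simp add: c_def norm_divide pos_divide_le_eq del: zero_less_norm_iff)
  qed
  define \<phi> where "\<phi> i = blinfun_mult_right (c i) o\<^sub>L \<psi> (k i)" for i
  have \<phi>: "\<phi> i f = c i * \<psi> (k i) f" for i f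
    by (simp add: \<phi>_def blinfun_mult_right.rep_eq)
  show thesis
  proof (rule that[of \<phi> "\<lambda>i. g1 (k i)"])
    show "disjoint_unit_sequence (\<lambda>i. g1 (k i))"
      by (rule disjoint_unit_sequence_comp[OF g1 k(2)])
    show "weak_star_null 16 \<phi>"
      unfolding weak_star_null_def
    proof (intro conjI allI)
      show "\<phi> i \<in> bounded_functionals bcontfun_scale" for i
        by (simp add: bounded_functionals_bcontfun_iff \<phi> bounded_functional_scale[OF weak_star_nullD(1)[OF \<psi>]])
      show "norm (\<phi> i) \<le> 16" for i
      proof (rule norm_blinfun_bound)
        fix f
        have "norm (c i) * norm (\<psi> (k i) f) \<le> 8 * (2 * norm f)"
          by (intro mult_mono c weak_star_nullD(4)[OF \<psi>]) auto
        then show "norm (\<phi> i f) \<le> 16 * norm f" by (simp add: \<phi> norm_mult)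
      qed simp
      show "(\<lambda>i. \<phi> i f) \<longlonglongrightarrow> 0" for f
      proof (rule Lim_null_comparison)
        show "(\<lambda>i. 8 * norm (\<psi> (k i) f)) \<longlonglongrightarrow> 0"
          using tendsto_mult_right_zero[OF tendsto_norm_zero[OF filterlim_compose[OF weak_star_nullD(3)[OF \<psi>] k(1)]]] .
        show "\<forall>\<^sub>F i in sequentially. norm (\<phi> i f) \<le> 8 * norm (\<psi> (k i) f)"
          using c by (simp add: \<phi> norm_mult mult_right_mono)
      qed
    qed
    show "\<phi> i (T (g1 (k i))) = of_real w" for i
      using diagonal[of "k i"] w(2) by (auto simp: \<phi> c_def k_def)
    show "norm (\<phi> i (T (g1 (k j)))) \<le> (1 / 2) ^ (i + j)" if "i \<noteq> j" for i j
    proof -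
      have "norm (c i) * norm (\<psi> (k i) (T (g1 (k j)))) \<le> 8 * (1 / 8 * (1 / 2) ^ (i + j))"
        using off[OF that] by (intro mult_mono c) (auto simp: a_def k_def)
      then show ?thesis by (simp add: \<phi> norm_mult)
    qed
  qed
qed

section \<open>Operators factoring through the null sequences\<close>

lemma summable_disjoint_series:
  fixes g :: "nat \<Rightarrow> 'k::topological_space \<Rightarrow>\<^sub>C 's::{real_normed_field,banach}"
  assumes g: "disjoint_unit_sequence g" and c: "c \<longlonglongrightarrow> 0"
  shows "summable (\<lambda>i. bcontfun_scale (c i) (g i))"
  unfolding summable_Cauchy
proof (intro allI impI)
  fix e :: real assume e: "0 < e"
  then obtain N where N: "\<And>i. N \<le> i \<Longrightarrow> norm (c i) < e / 2"
    using tendstoD[OF c, of "e / 2"] by (auto simp: eventually_sequentially)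
  have "norm (\<Sum>i\<in>{m..<n}. bcontfun_scale (c i) (g i)) < e" if "N \<le> m" for m n
  proof -
    have "norm (\<Sum>i\<in>{m..<n}. bcontfun_scale (c i) (g i)) \<le> e / 2"
      using e N that by (intro norm_sum_disjoint_le[OF g]) (auto intro: less_imp_le)
    then show ?thesis using e by simp
  qed
  then show "\<exists>N. \<forall>m\<ge>N. \<forall>n. norm (\<Sum>i\<in>{m..<n}. bcontfun_scale (c i) (g i)) < e"
    by blast
qed

lemma norm_disjoint_series_le:
  fixes g :: "nat \<Rightarrow> 'k::topological_space \<Rightarrow>\<^sub>C 's::{real_normed_field,banach}"
  assumes g: "disjoint_unit_sequence g" and c: "c \<longlonglongrightarrow> 0" and b: "\<And>i. norm (c i) \<le> b"
  shows "norm (\<Sum>i. bcontfun_scale (c i) (g i)) \<le> b"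
proof -
  have "0 \<le> b" using b[of 0] norm_ge_zero order_trans by blast
  then have "norm (\<Sum>i<n. bcontfun_scale (c i) (g i)) \<le> b" for n
    by (intro norm_sum_disjoint_le[OF g b])
  then show ?thesis
    using tendsto_norm[OF summable_LIMSEQ[OF summable_disjoint_series[OF g c]]]
    by (intro LIMSEQ_le_const2) auto
qed

text \<open>
  The composition of \<open>f \<mapsto> (\<phi> i f)\<close> with \<open>c \<mapsto> \<Sum>i. c i * g i\<close>, that is, an operator on \<open>C(K)\<close> that
  factors through the null sequences.
\<close>

definition series_operator ::
    "(nat \<Rightarrow> ('k::topological_space, 's::{real_normed_field,banach}) functional) \<Rightarrow>
      (nat \<Rightarrow> 'k \<Rightarrow>\<^sub>C 's) \<Rightarrow> ('k, 's) operator"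
  where "series_operator \<phi> g = Blinfun (\<lambda>f. \<Sum>i. bcontfun_scale (\<phi> i f) (g i))"

lemma bcontfun_scale_add_left: "bcontfun_scale (a + b) f = bcontfun_scale a f + bcontfun_scale b f"
  and bcontfun_scale_scale: "bcontfun_scale a (bcontfun_scale b f) = bcontfun_scale (a * b) f"
  and bcontfun_scale_scaleR_left: "bcontfun_scale (r *\<^sub>R a) f = r *\<^sub>R bcontfun_scale a f"
  by (rule bcontfun_eqI; simp add: algebra_simps)+

lemma bounded_linear_bcontfun_scale:
  "bounded_linear (bcontfun_scale c :: ('k::topological_space \<Rightarrow>\<^sub>C 's::real_normed_field) \<Rightarrow> _)"
proof (rule bounded_linear_intro[where K = "norm c"])
  show "bcontfun_scale c (f + g) = bcontfun_scale c f + bcontfun_scale c g" for f g :: "'k \<Rightarrow>\<^sub>C 's"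
    by (rule bcontfun_eqI) (simp add: distrib_left)
  show "bcontfun_scale c (r *\<^sub>R f) = r *\<^sub>R bcontfun_scale c f" for r and f :: "'k \<Rightarrow>\<^sub>C 's"
    by (rule bcontfun_eqI) simp
qed (simp add: norm_bcontfun_scale mult.commute)

context
  fixes \<phi> :: "nat \<Rightarrow> ('k::topological_space, 's::{real_normed_field,euclidean_space}) functional"
    and g :: "nat \<Rightarrow> 'k \<Rightarrow>\<^sub>C 's" and b :: real
  assumes \<phi>: "weak_star_null b \<phi>" and g: "disjoint_unit_sequence g"
begin

lemma series_operator_summable: "summable (\<lambda>i. bcontfun_scale (\<phi> i f) (g i))"
  by (rule summable_disjoint_series[OF g weak_star_nullD(3)[OF \<phi>]])

lemma norm_series_le: "norm (\<Sum>i. bcontfun_scale (\<phi> i f) (g i)) \<le> b * norm f"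
  by (rule norm_disjoint_series_le[OF g weak_star_nullD(3,4)[OF \<phi>]])

lemma series_operator_apply: "series_operator \<phi> g f = (\<Sum>i. bcontfun_scale (\<phi> i f) (g i))"
proof -
  have "bounded_linear (\<lambda>f. \<Sum>i. bcontfun_scale (\<phi> i f) (g i))"
  proof (rule bounded_linear_intro[where K = b])
    show "(\<Sum>i. bcontfun_scale (\<phi> i (f + h)) (g i)) =
        (\<Sum>i. bcontfun_scale (\<phi> i f) (g i)) + (\<Sum>i. bcontfun_scale (\<phi> i h) (g i))" for f h
      by (subst suminf_add[OF series_operator_summable series_operator_summable])
        (simp add: blinfun.add_right bcontfun_scale_add_left)
    show "(\<Sum>i. bcontfun_scale (\<phi> i (r *\<^sub>R f)) (g i)) = r *\<^sub>R (\<Sum>i. bcontfun_scale (\<phi> i f) (g i))" for r f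
      by (subst suminf_scaleR_right[OF series_operator_summable])
        (simp add: blinfun.scaleR_right bcontfun_scale_scaleR_left)
  qed (use norm_series_le in \<open>simp add: mult.commute\<close>)
  then show ?thesis
    by (simp add: series_operator_def bounded_linear_Blinfun_apply)
qed

lemma norm_series_operator_le: "0 \<le> b \<Longrightarrow> norm (series_operator \<phi> g) \<le> b"
  by (rule norm_blinfun_bound) (simp_all add: series_operator_apply norm_series_le)

lemma series_operator_in_bounded_operators: "series_operator \<phi> g \<in> bounded_operators bcontfun_scale"
  by (simp add: bounded_operators_bcontfun_iff series_operator_apply bounded_functional_scale[OF weak_star_nullD(1)[OF \<phi>]]
      bounded_linear.suminf[OF bounded_linear_bcontfun_scale series_operator_summable] bcontfun_scale_scale)

lemma functional_series_operator:
  assumes "\<nu> \<in> bounded_functionals bcontfun_scale"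
  shows "(\<lambda>i. \<phi> i f * \<nu> (g i)) sums \<nu> (series_operator \<phi> g f)"
  using bounded_linear.sums[OF blinfun.bounded_linear_right summable_sums[OF series_operator_summable], of \<nu> f]
  by (simp add: series_operator_apply bounded_functional_scale[OF assms])

end

lemma series_operator_compose_biorthogonal:
  fixes \<phi> \<psi> :: "nat \<Rightarrow> ('k::topological_space, 's::{real_normed_field,euclidean_space}) functional"
  assumes \<phi>: "weak_star_null b \<phi>" "disjoint_unit_sequence g"
    and \<psi>: "weak_star_null c \<psi>" "disjoint_unit_sequence h"
    and pairing: "\<And>i j. \<phi> i (h j) = (if i = j then 1 else 0)"
  shows "series_operator \<phi> g o\<^sub>L series_operator \<psi> h = series_operator \<psi> g"
proof (rule blinfun_eqI)
  fix f
  have "(\<lambda>j. \<psi> j f * \<phi> i (h j)) sums \<psi> i f" for i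
    using sums_single[of i "\<lambda>j. \<psi> j f"] by (simp add: pairing if_distrib eq_commute cong: if_cong)
  then have "\<phi> i (series_operator \<psi> h f) = \<psi> i f" for i
    using functional_series_operator[OF \<psi> weak_star_nullD(1)[OF \<phi>(1)], of f i] by (rule sums_unique2[symmetric])
  then show "(series_operator \<phi> g o\<^sub>L series_operator \<psi> h) f = series_operator \<psi> g f"
    by (simp add: series_operator_apply[OF \<phi>] series_operator_apply[OF \<psi>(1) \<phi>(2)])
qed

lemma series_operator_compose_orthogonal:
  fixes \<phi> \<psi> :: "nat \<Rightarrow> ('k::topological_space, 's::{real_normed_field,euclidean_space}) functional"
  assumes \<phi>: "weak_star_null b \<phi>" "disjoint_unit_sequence g"
    and \<psi>: "weak_star_null c \<psi>" "disjoint_unit_sequence h"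
    and pairing: "\<And>i j. \<phi> i (h j) = 0"
  shows "series_operator \<phi> g o\<^sub>L series_operator \<psi> h = 0"
proof (rule blinfun_eqI)
  fix f
  have "\<phi> i (series_operator \<psi> h f) = 0" for i
    using sums_unique2[OF functional_series_operator[OF \<psi> weak_star_nullD(1)[OF \<phi>(1)], of f i] ] by (simp add: pairing)
  moreover have "bcontfun_scale 0 x = 0" for x :: "'k \<Rightarrow>\<^sub>C 's"
    by (rule bcontfun_eqI) simp
  ultimately show "(series_operator \<phi> g o\<^sub>L series_operator \<psi> h) f = blinfun_apply 0 f"
    by (simp add: series_operator_apply[OF \<phi>])
qed

lemma suminf_bounded_operators:
  fixes S :: "nat \<Rightarrow> ('k::topological_space, 's::{real_normed_field,banach}) operator"
  assumes S: "summable S" "\<And>n. S n \<in> bounded_operators bcontfun_scale"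
  shows "suminf S \<in> bounded_operators bcontfun_scale"
proof -
  have apply_sum: "summable (\<lambda>n. S n f)" "suminf S f = (\<Sum>n. S n f)" for f
    using bounded_linear.summable[OF blinfun.bounded_linear_left S(1), of f]
      bounded_linear.suminf[OF blinfun.bounded_linear_left S(1), of f] by simp_all
  show ?thesis
    by (simp add: bounded_operators_bcontfun_iff apply_sum bounded_operator_scale[OF S(2)]
        bounded_linear.suminf[OF bounded_linear_bcontfun_scale apply_sum(1)])
qed

section \<open>A projection onto null sequences that is not weakly compact\<close>

text \<open>
  \<open>w i\<close> is a member of \<open>g\<close>, divided by its value at a point \<open>y i\<close> where its modulus is maximal. A
  subsequence makes the points converge to some \<open>l\<close>; at most one member is nonzero at \<open>l\<close>, and the
  sequence is started after it.
\<close>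

lemma biorthogonal_system:
  fixes g :: "nat \<Rightarrow> 'k::topological_space \<Rightarrow>\<^sub>C 's::real_normed_field"
  assumes compact: "compact (UNIV :: 'k set)" and seq_compact: "seq_compact (UNIV :: 'k set)"
    and g: "disjoint_unit_sequence g" "\<And>i. g i \<noteq> 0"
  obtains y :: "nat \<Rightarrow> 'k" and l :: 'k and w :: "nat \<Rightarrow> 'k \<Rightarrow>\<^sub>C 's"
  where "y \<longlonglongrightarrow> l" "disjoint_unit_sequence w"
    "\<And>i j. w j (y i) = (if i = j then 1 else 0)" "\<And>j. w j l = 0"
proof -
  have "\<exists>p. \<forall>x. norm (g i x) \<le> norm (g i p)" for i
    using continuous_attains_sup[OF compact, of "\<lambda>x. norm (g i x)"] by (auto intro: continuous_on_norm)
  then obtain p where p: "\<And>i x. norm (g i x) \<le> norm (g i (p i))" by metis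
  have p_nonzero: "g i (p i) \<noteq> 0" for i
  proof
    assume "g i (p i) = 0"
    then have "g i = 0" using p[of i] by (intro bcontfun_eqI) simp
    then show False using g(2) by blast
  qed
  define v where "v i = bcontfun_scale (1 / g i (p i)) (g i)" for i
  have v_apply: "v i x = g i x / g i (p i)" for i x by (simp add: v_def)
  have v: "disjoint_unit_sequence v"
    unfolding disjoint_unit_sequence_def
  proof (intro conjI allI impI)
    show "norm (v i) \<le> 1" for i
      by (rule norm_bound) (use p[of i] p_nonzero[of i] in \<open>simp add: v_apply norm_divide divide_le_eq_1\<close>)
    show "v i x = 0 \<or> v j x = 0" if "i \<noteq> j" for i j x
      using g(1) that by (auto simp: v_apply disjoint_unit_sequence_def)
  qed
  have v_diag: "v i (p i) = 1" for i using p_nonzero by (simp add: v_apply)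
  have v_off: "v j (p i) = 0" if "i \<noteq> j" for i j
    using v that v_diag[of i] unfolding disjoint_unit_sequence_def by (metis zero_neq_one)
  obtain l s where s: "strict_mono s" "(p \<circ> s) \<longlonglongrightarrow> l"
    by (rule seq_compactE[OF seq_compact, of p]) auto
  have "\<exists>N. \<forall>j\<ge>N. v (s j) l = 0"
  proof (cases "\<exists>k. v (s k) l \<noteq> 0")
    case True
    then obtain k where k: "v (s k) l \<noteq> 0" by blast
    have "v (s j) l = 0" if "Suc k \<le> j" for j
    proof -
      have "s j \<noteq> s k" using s(1) that by (simp add: strict_mono_eq)
      then show ?thesis using v k unfolding disjoint_unit_sequence_def by blast
    qed
    then show ?thesis by blast
  qed blast
  then obtain N where N: "\<And>j. N \<le> j \<Longrightarrow> v (s j) l = 0" by blast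
  have inj: "s (i + N) = s (j + N) \<longleftrightarrow> i = j" for i j
    using s(1) by (simp add: strict_mono_eq)
  show thesis
  proof (rule that[of "\<lambda>i. p (s (i + N))" l "\<lambda>i. v (s (i + N))"])
    show "(\<lambda>i. p (s (i + N))) \<longlonglongrightarrow> l"
      using LIMSEQ_ignore_initial_segment[OF s(2), of N] by simp
    show "disjoint_unit_sequence (\<lambda>i. v (s (i + N)))"
      by (rule disjoint_unit_sequence_comp[OF v]) (simp add: inj_def inj)
    show "v (s (j + N)) (p (s (i + N))) = (if i = j then 1 else 0)" for i j
      using v_diag v_off inj by auto
    show "v (s (j + N)) l = 0" for j by (rule N) simp
  qed
qed

lemma closedin_weak_evaluation:
  fixes x :: "'k::topological_space" and c :: "'s::real_normed_field"
  shows "closedin (weak_topology bcontfun_scale) {f :: 'k \<Rightarrow>\<^sub>C 's. f x = c}"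
proof -
  have "closedin (weak_topology bcontfun_scale) {f \<in> topspace (weak_topology bcontfun_scale). point_evaluation x f \<in> {c}}"
    by (rule closedin_continuous_map_preimage[OF continuous_map_weak_functional[OF point_evaluation_in_functionals]])
      simp
  then show ?thesis by (simp add: topspace_weak_topology_bcontfun)
qed

text \<open>
  \<open>P\<close> fixes the partial sums of \<open>\<Sum>j. w j\<close>, which lie in the unit ball. A weak cluster point of them
  would be a continuous function with value one at every \<open>y i\<close> and zero at their limit.
\<close>

lemma projection_not_weakly_compact:
  fixes w :: "nat \<Rightarrow> 'k::topological_space \<Rightarrow>\<^sub>C 's::real_normed_field" and P :: "('k, 's) operator"
  assumes y: "y \<longlonglongrightarrow> l" and w: "disjoint_unit_sequence w"
    and pairing: "\<And>i j. w j (y i) = (if i = j then 1 else 0)" "\<And>j. w j l = 0"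
    and P: "\<And>j. P (w j) = w j"
  shows "P \<notin> weakly_compact_operators bcontfun_scale"
proof
  assume "P \<in> weakly_compact_operators bcontfun_scale"
  then obtain S where S: "compactin (weak_topology bcontfun_scale) S" "\<And>f. norm f \<le> 1 \<Longrightarrow> P f \<in> S"
    using weakly_compact_operatorE[OF _ topspace_weak_topology_bcontfun] by metis
  define E where "E i = {f :: 'k \<Rightarrow>\<^sub>C 's. f (y i) = 1} \<inter> {f. apply_bcontfun f l = 0}" for i
  have E_closed: "closedin (weak_topology bcontfun_scale) (E i)" for i
    unfolding E_def by (intro closedin_Int closedin_weak_evaluation)
  have "S \<inter> \<Inter>\<F> \<noteq> {}" if \<F>: "finite \<F>" "\<F> \<subseteq> range E" for \<F>
  proof -
    obtain I where I: "finite I" "\<F> = E ` I"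
      using finite_subset_image[OF \<F>] by blast
    define f where "f = (\<Sum>i\<in>I. w i)"
    have scale_1: "bcontfun_scale 1 h = h" for h :: "'k \<Rightarrow>\<^sub>C 's" by (rule bcontfun_eqI) simp
    have "norm f \<le> 1"
      using norm_sum_disjoint_le[OF w, of I "\<lambda>_. 1" 1] by (simp add: f_def scale_1)
    then have "P f \<in> S" by (rule S(2))
    moreover have "P f = f" by (simp add: f_def blinfun.sum_right P)
    moreover have "f \<in> E i" if "i \<in> I" for i
      using I(1) that by (simp add: E_def f_def apply_bcontfun_sum pairing)
    ultimately show ?thesis using I(2) by auto
  qed
  then have "S \<inter> \<Inter>(range E) \<noteq> {}"
    using S(1) E_closed unfolding compactin_fip by (metis (no_types, lifting) rangeE)
  then obtain f :: "'k \<Rightarrow>\<^sub>C 's" where f: "\<And>i. f (y i) = 1" "f l = 0" by (auto simp: E_def)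
  have "(\<lambda>i. f (y i)) \<longlonglongrightarrow> f l"
    by (rule continuous_on_tendsto_compose[OF continuous_on_apply_bcontfun[of UNIV f] y]) auto
  then have "(\<lambda>i :: nat. 1 :: 's) \<longlonglongrightarrow> 0" using f by simp
  then show False using LIMSEQ_unique[OF tendsto_const, of "1 :: 's"] by (metis zero_neq_one)
qed

lemma compact_imp_compactin_weak:
  fixes S :: "('k::topological_space \<Rightarrow>\<^sub>C 's::real_normed_field) set"
  assumes "compact S" shows "compactin (weak_topology bcontfun_scale) S"
proof -
  have "continuous_map euclidean (weak_topology bcontfun_scale) (\<lambda>f :: 'k \<Rightarrow>\<^sub>C 's. f)"
    by (rule continuous_map_into_weak_topology[OF _ topspace_weak_topology_bcontfun])
      (simp add: blinfun.continuous_on continuous_on_id)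
  then show ?thesis
    using image_compactin[of euclidean S "weak_topology bcontfun_scale" "\<lambda>f. f"] assms by simp
qed

text \<open>
  The unit ball is mapped into the continuous image of a compact product of balls, because the series
  converges uniformly on that product; such an operator is even compact.
\<close>

lemma rapidly_decreasing_coefficients_weakly_compact:
  fixes w :: "nat \<Rightarrow> 'k::topological_space \<Rightarrow>\<^sub>C 's::{real_normed_field,euclidean_space}"
    and E :: "('k, 's) operator"
  assumes E: "E \<in> bounded_operators bcontfun_scale" and w: "disjoint_unit_sequence w" and b: "summable b"
    and coeff: "\<And>f. norm f \<le> 1 \<Longrightarrow> \<exists>c. (\<forall>i. norm (c i) \<le> b i) \<and> E f = (\<Sum>i. bcontfun_scale (c i) (w i))"
  shows "E \<in> weakly_compact_operators bcontfun_scale"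
proof (rule weakly_compact_operatorI[OF Hausdorff_weak_topology_bcontfun E])
  define F where "F c = (\<Sum>i. bcontfun_scale (c i) (w i))" for c
  define S where "S = {c :: nat \<Rightarrow> 's. \<forall>i. norm (c i) \<le> b i}"
  have "uniform_limit S (\<lambda>n c. \<Sum>i<n. bcontfun_scale (c i) (w i)) F sequentially"
    unfolding F_def
  proof (rule Weierstrass_m_test[OF _ b])
    fix n c assume "c \<in> S"
    moreover have "norm (w n) \<le> 1" using w by (simp add: disjoint_unit_sequence_def)
    ultimately have "norm (c n) * norm (w n) \<le> b n * 1"
      by (intro mult_mono) (auto simp: S_def intro: order_trans[OF norm_ge_zero])
    then show "norm (bcontfun_scale (c n) (w n)) \<le> b n" by (simp add: norm_bcontfun_scale)
  qed
  moreover have "continuous_on S (\<lambda>c. \<Sum>i<n. bcontfun_scale (c i) (w i))" for n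
  proof (intro continuous_on_sum)
    fix i
    have "bounded_linear (\<lambda>a. bcontfun_scale a (w i))"
      by (rule bounded_linear_intro[where K = "norm (w i)"])
        (simp_all add: bcontfun_scale_add_left bcontfun_scale_scaleR_left norm_bcontfun_scale)
    then show "continuous_on S (\<lambda>c. bcontfun_scale (c i) (w i))"
      by (rule bounded_linear.continuous_on)
        (rule continuous_on_subset[OF continuous_on_product_coordinates subset_UNIV])
  qed
  ultimately have "continuous_on S F"
    by (intro uniform_limit_theorem[OF always_eventually]) auto
  moreover have "compact S" unfolding S_def by (rule compact_product_of_balls)
  ultimately show "compactin (weak_topology bcontfun_scale) (F ` S)"
    by (intro compact_imp_compactin_weak compact_continuous_image)
  show "blinfun_apply E ` cball 0 1 \<subseteq> F ` S"
    using coeff by (fastforce simp: F_def S_def)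
qed

section \<open>The weak Calkin algebra\<close>

abbreviation (input) weakly_compact_ops ::
    "(('k::topological_space, 's::real_normed_field) operator) set"
  where "weakly_compact_ops \<equiv> weakly_compact_operators bcontfun_scale"

abbreviation (input) bounded_ops ::
    "(('k::topological_space, 's::real_normed_field) operator) set"
  where "bounded_ops \<equiv> bounded_operators bcontfun_scale"

abbreviation (input) calkin ::
    "('s::real_normed_field, (('k::topological_space, 's) operator) set) module"
  where "calkin \<equiv> weak_Calkin_algebra bcontfun_scale"

abbreviation (input) calkin_class ::
    "(('k::topological_space, 's::real_normed_field) operator) \<Rightarrow> ('k, 's) operator set"
  where "calkin_class \<equiv> weak_Calkin_class bcontfun_scale"

lemma weakly_compactI:
  assumes "V \<in> bounded_ops" "compactin (weak_topology bcontfun_scale) S" "\<And>f. norm f \<le> 1 \<Longrightarrow> V f \<in> S"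
  shows "V \<in> weakly_compact_ops"
  by (rule weakly_compact_operatorI[OF Hausdorff_weak_topology_bcontfun assms(1) assms(2)])
    (use assms(3) in auto)

lemma weakly_compactE:
  assumes "V \<in> weakly_compact_ops"
  obtains S where "compactin (weak_topology bcontfun_scale) S" "\<And>f. norm f \<le> 1 \<Longrightarrow> V f \<in> S"
  using weakly_compact_operatorE[OF assms topspace_weak_topology_bcontfun] by metis

lemma weakly_compact_bounded: "V \<in> weakly_compact_ops \<Longrightarrow> V \<in> bounded_ops"
  by (simp add: weakly_compact_operators_def)

lemma bounded_ops_add: "S \<in> bounded_ops \<Longrightarrow> T \<in> bounded_ops \<Longrightarrow> S + T \<in> bounded_ops"
  and bounded_ops_diff: "S \<in> bounded_ops \<Longrightarrow> T \<in> bounded_ops \<Longrightarrow> S - T \<in> bounded_ops"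
  and bounded_ops_compose: "S \<in> bounded_ops \<Longrightarrow> T \<in> bounded_ops \<Longrightarrow> S o\<^sub>L T \<in> bounded_ops"
  and bounded_ops_scaleR: "S \<in> bounded_ops \<Longrightarrow> r *\<^sub>R S \<in> bounded_ops"
  and bounded_ops_zero: "0 \<in> bounded_ops"
  unfolding bounded_operators_bcontfun_iff
  by (auto intro!: bcontfun_eqI simp: blinfun.add_left blinfun.diff_left blinfun.scaleR_left algebra_simps)

lemma weakly_compact_zero: "0 \<in> weakly_compact_ops"
  by (rule weakly_compactI[of 0 "{0}"]) (simp_all add: bounded_ops_zero topspace_weak_topology_bcontfun)

text \<open>
  Addition is continuous from the product of the weak topologies, so it maps the product of two weakly
  compact sets to a weakly compact set.
\<close>

lemma weakly_compact_add:
  fixes U V :: "('k::topological_space, 's::real_normed_field) operator"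
  assumes "U \<in> weakly_compact_ops" "V \<in> weakly_compact_ops" shows "U + V \<in> weakly_compact_ops"
proof -
  obtain S where S: "compactin (weak_topology bcontfun_scale) S" "\<And>f. norm f \<le> 1 \<Longrightarrow> U f \<in> S"
    using assms(1) by (rule weakly_compactE) blast
  obtain R where R: "compactin (weak_topology bcontfun_scale) R" "\<And>f. norm f \<le> 1 \<Longrightarrow> V f \<in> R"
    using assms(2) by (rule weakly_compactE) blast
  let ?X = "prod_topology (weak_topology bcontfun_scale) (weak_topology bcontfun_scale) :: (('k \<Rightarrow>\<^sub>C 's) \<times> ('k \<Rightarrow>\<^sub>C 's)) topology"
  have "continuous_map ?X (weak_topology bcontfun_scale) (\<lambda>p. fst p + snd p)"
  proof (rule continuous_map_into_weak_topology[OF _ topspace_weak_topology_bcontfun])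
    fix \<phi> :: "('k, 's) functional" assume \<phi>: "\<phi> \<in> bounded_functionals bcontfun_scale"
    have "continuous_map ?X euclidean (\<lambda>p. \<phi> (fst p))" "continuous_map ?X euclidean (\<lambda>p. \<phi> (snd p))"
      using continuous_map_compose[OF continuous_map_fst continuous_map_weak_functional[OF \<phi>]]
        continuous_map_compose[OF continuous_map_snd continuous_map_weak_functional[OF \<phi>]]
      by (simp_all add: comp_def)
    then show "continuous_map ?X euclidean (\<lambda>p. \<phi> (fst p + snd p))"
      unfolding blinfun.add_right by (rule continuous_map_add)
  qed
  then have "compactin (weak_topology bcontfun_scale) ((\<lambda>p. fst p + snd p) ` (S \<times> R))"
    by (rule image_compactin[rotated]) (simp add: compactin_Times S R)
  then show ?thesis
  proof (rule weakly_compactI[rotated])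
    show "(U + V) f \<in> (\<lambda>p. fst p + snd p) ` (S \<times> R)" if "norm f \<le> 1" for f
      using S(2)[OF that] R(2)[OF that] by (auto simp: blinfun.add_left intro!: image_eqI[of _ _ "(U f, V f)"])
  qed (use assms weakly_compact_bounded bounded_ops_add in blast)
qed

lemma weakly_compact_compose_left:
  fixes T V :: "('k::topological_space, 's::real_normed_field) operator"
  assumes T: "T \<in> bounded_ops" and V: "V \<in> weakly_compact_ops" shows "T o\<^sub>L V \<in> weakly_compact_ops"
proof -
  obtain S where S: "compactin (weak_topology bcontfun_scale) S" "\<And>f. norm f \<le> 1 \<Longrightarrow> V f \<in> S"
    using V by (rule weakly_compactE) blast
  have "continuous_map (weak_topology bcontfun_scale) (weak_topology bcontfun_scale) T"
  proof (rule continuous_map_into_weak_topology[OF _ topspace_weak_topology_bcontfun])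
    fix \<phi> :: "('k, 's) functional" assume "\<phi> \<in> bounded_functionals bcontfun_scale"
    then have "\<phi> o\<^sub>L T \<in> bounded_functionals bcontfun_scale"
      using T by (simp add: bounded_functionals_bcontfun_iff bounded_operators_bcontfun_iff)
    from continuous_map_weak_functional[OF this]
    show "continuous_map (weak_topology bcontfun_scale) euclidean (\<lambda>f. \<phi> (T f))"
      by (rule continuous_map_eq) simp
  qed
  then have "compactin (weak_topology bcontfun_scale) (blinfun_apply T ` S)"
    by (rule image_compactin[OF S(1)])
  then show ?thesis
    by (rule weakly_compactI[rotated]) (use S(2) T V bounded_ops_compose weakly_compact_bounded in auto)
qed

lemma weakly_compact_scaleR:
  fixes V :: "('k::topological_space, 's::real_normed_field) operator"
  shows "V \<in> weakly_compact_ops \<Longrightarrow> r *\<^sub>R V \<in> weakly_compact_ops"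
proof -
  assume V: "V \<in> weakly_compact_ops"
  have "id_blinfun \<in> bounded_ops" by (simp add: bounded_operators_bcontfun_iff)
  then have "(r *\<^sub>R id_blinfun) o\<^sub>L V \<in> weakly_compact_ops"
    by (intro weakly_compact_compose_left V bounded_ops_scaleR)
  moreover have "(r *\<^sub>R id_blinfun) o\<^sub>L V = r *\<^sub>R V"
    by (rule blinfun_eqI) (simp add: blinfun.scaleR_left)
  ultimately show "r *\<^sub>R V \<in> weakly_compact_ops" by simp
qed

lemma weakly_compact_diff: "U \<in> weakly_compact_ops \<Longrightarrow> V \<in> weakly_compact_ops \<Longrightarrow> U - V \<in> weakly_compact_ops"
  using weakly_compact_add[of U "- 1 *\<^sub>R V"] weakly_compact_scaleR[of V "- 1"] by simp

text \<open>
  \<open>T\<close> is first scaled so that it maps the unit ball into itself.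
\<close>

lemma weakly_compact_compose_right:
  fixes T V :: "('k::topological_space, 's::real_normed_field) operator"
  assumes T: "T \<in> bounded_ops" and V: "V \<in> weakly_compact_ops" shows "V o\<^sub>L T \<in> weakly_compact_ops"
proof -
  define r where "r = norm T + 1"
  have r: "0 < r" by (simp add: r_def add_nonneg_pos)
  obtain S where S: "compactin (weak_topology bcontfun_scale) S" "\<And>f. norm f \<le> 1 \<Longrightarrow> V f \<in> S"
    using V by (rule weakly_compactE) blast
  have "V o\<^sub>L ((1 / r) *\<^sub>R T) \<in> weakly_compact_ops"
  proof (rule weakly_compactI[OF _ S(1)])
    show "V o\<^sub>L ((1 / r) *\<^sub>R T) \<in> bounded_ops"
      by (intro bounded_ops_compose bounded_ops_scaleR T weakly_compact_bounded V)
    show "(V o\<^sub>L ((1 / r) *\<^sub>R T)) f \<in> S" if "norm f \<le> 1" for f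
    proof -
      have "norm (T f) \<le> norm T * 1"
        using norm_blinfun[of T f] mult_left_mono[OF that norm_ge_zero[of T]] by linarith
      then have "norm ((1 / r) *\<^sub>R T f) \<le> 1" using r by (simp add: r_def field_simps)
      then show ?thesis using S(2) by (simp add: blinfun.scaleR_left)
    qed
  qed
  then have "r *\<^sub>R (V o\<^sub>L ((1 / r) *\<^sub>R T)) \<in> weakly_compact_ops" by (rule weakly_compact_scaleR)
  moreover have "r *\<^sub>R (V o\<^sub>L ((1 / r) *\<^sub>R T)) = V o\<^sub>L T"
    using r by (intro blinfun_eqI) (simp add: blinfun.scaleR_left blinfun.scaleR_right)
  ultimately show ?thesis by simp
qed

lemma weak_Calkin_class_eq: "calkin_class T = {X. X - T \<in> weakly_compact_ops}"
proof -
  have "calkin_class T = (\<Union>h\<in>weakly_compact_ops. {h + T})"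
    by (simp add: a_r_coset_def' operator_algebra_def)
  also have "\<dots> = {X. X - T \<in> weakly_compact_ops}"
  proof -
    have "X = h + T \<longleftrightarrow> h = X - T" for X h by (auto simp: algebra_simps)
    then show ?thesis by auto
  qed
  finally show ?thesis .
qed

lemma weak_Calkin_class_eq_iff:
  fixes S T :: "('k::topological_space, 's::real_normed_field) operator"
  shows "calkin_class S = calkin_class T \<longleftrightarrow> S - T \<in> weakly_compact_ops"
proof
  assume "calkin_class S = calkin_class T"
  then have "{X. X - S \<in> weakly_compact_ops} = {X. X - T \<in> weakly_compact_ops}" by (simp add: weak_Calkin_class_eq)
  moreover have "S \<in> {X. X - S \<in> weakly_compact_ops}" by (simp add: weakly_compact_zero)
  ultimately show "S - T \<in> weakly_compact_ops" by blast
next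
  assume ST: "S - T \<in> weakly_compact_ops"
  have "X - S \<in> weakly_compact_ops \<longleftrightarrow> X - T \<in> weakly_compact_ops" for X
    using weakly_compact_add[OF _ ST, of "X - S"] weakly_compact_diff[OF _ ST, of "X - T"] by auto
  then show "calkin_class S = calkin_class T"
    by (simp add: weak_Calkin_class_eq)
qed

lemma weak_Calkin_class_carrier:
  "T \<in> bounded_ops \<Longrightarrow> calkin_class T \<in> carrier (calkin)"
  by (auto simp: quotient_algebra_def FactRing_def ring.defs module.defs A_RCOSETS_def' operator_algebra_def)

lemma weak_Calkin_zero: "\<zero>\<^bsub>calkin\<^esub> = weakly_compact_ops"
  by (simp add: quotient_algebra_def FactRing_def ring.defs module.defs)

lemma weak_Calkin_class_eq_zero_iff:
  fixes T :: "('k::topological_space, 's::real_normed_field) operator"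
  shows "calkin_class T = \<zero>\<^bsub>calkin\<^esub> \<longleftrightarrow> T \<in> weakly_compact_ops"
proof -
  have "calkin_class (0 :: ('k, 's) operator) = weakly_compact_ops" by (simp add: weak_Calkin_class_eq)
  then show ?thesis
    using weak_Calkin_class_eq_iff[of T 0] by (simp add: weak_Calkin_zero)
qed

lemma weak_Calkin_mult:
  fixes S T :: "('k::topological_space, 's::real_normed_field) operator"
  assumes S: "S \<in> bounded_ops" and T: "T \<in> bounded_ops"
  shows "calkin_class S \<otimes>\<^bsub>calkin\<^esub> calkin_class T =
    calkin_class (S o\<^sub>L T)"
proof -
  have class_eq: "calkin_class (X o\<^sub>L Y) = calkin_class (S o\<^sub>L T)"
    if "X \<in> calkin_class S" "Y \<in> calkin_class T" for X Y
  proof -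
    have XY: "X - S \<in> weakly_compact_ops" "Y - T \<in> weakly_compact_ops" using that by (simp_all add: weak_Calkin_class_eq)
    then have "X \<in> bounded_ops" using bounded_ops_add[OF S weakly_compact_bounded[OF XY(1)]] by simp
    then have "(X o\<^sub>L (Y - T)) + ((X - S) o\<^sub>L T) \<in> weakly_compact_ops"
      using XY T by (intro weakly_compact_add weakly_compact_compose_left weakly_compact_compose_right)
    moreover have "(X o\<^sub>L (Y - T)) + ((X - S) o\<^sub>L T) = (X o\<^sub>L Y) - (S o\<^sub>L T)"
      by (rule blinfun_eqI) (simp add: blinfun.add_left blinfun.diff_left blinfun.diff_right)
    ultimately show ?thesis by (simp only: weak_Calkin_class_eq_iff)
  qed
  have nonempty: "calkin_class X \<noteq> {}" for X :: "('k, 's) operator"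
    using weakly_compact_zero by (auto simp: weak_Calkin_class_eq intro!: exI[of _ X])
  have "calkin_class S \<otimes>\<^bsub>calkin\<^esub> calkin_class T =
      (\<Union>X\<in>calkin_class S. \<Union>Y\<in>calkin_class T.
        calkin_class (X o\<^sub>L Y))"
    by (simp add: quotient_algebra_def FactRing_def ring.defs module.defs rcoset_mult_def)
      (simp add: operator_algebra_def)
  also have "\<dots> = calkin_class (S o\<^sub>L T)"
    by (intro SUP_eq_const nonempty class_eq)
  finally show ?thesis .
qed

lemma weak_Calkin_smult_of_real:
  fixes T :: "('k::topological_space, 's::real_normed_field) operator"
  assumes T: "T \<in> bounded_ops"
  shows "of_real r \<odot>\<^bsub>calkin\<^esub> calkin_class T =
    calkin_class (r *\<^sub>R T)"
proof -
  have smult: "Blinfun (\<lambda>x. bcontfun_scale (of_real r) (blinfun_apply X x)) = r *\<^sub>R X" for X :: "('k, 's) operator"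
  proof -
    have "(\<lambda>x. bcontfun_scale (of_real r) (blinfun_apply X x)) = blinfun_apply (r *\<^sub>R X)"
      by (auto simp: bcontfun_scale_of_real blinfun.scaleR_left)
    then show ?thesis by (simp add: blinfun_apply_inverse)
  qed
  have class_eq: "calkin_class (r *\<^sub>R X) = calkin_class (r *\<^sub>R T)"
    if "X \<in> calkin_class T" for X
    using weakly_compact_scaleR[of "X - T" r] that
    unfolding weak_Calkin_class_eq_iff by (simp add: weak_Calkin_class_eq scaleR_diff_right)
  have nonempty: "calkin_class T \<noteq> {}"
    using weakly_compact_zero by (auto simp: weak_Calkin_class_eq intro!: exI[of _ T])
  have "of_real r \<odot>\<^bsub>calkin\<^esub> calkin_class T =
      (\<Union>X\<in>calkin_class T. calkin_class (r *\<^sub>R X))"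
    by (simp add: quotient_algebra_def FactRing_def ring.defs module.defs)
      (simp add: operator_algebra_def smult)
  also have "\<dots> = calkin_class (r *\<^sub>R T)"
    by (intro SUP_eq_const nonempty class_eq)
  finally show ?thesis .
qed

section \<open>Minimality\<close>

lemma compose_suminf_single:
  fixes S :: "nat \<Rightarrow> 'b::real_normed_vector \<Rightarrow>\<^sub>L 'c::banach" and J :: "'a::real_normed_vector \<Rightarrow>\<^sub>L 'b"
  assumes "summable S" "\<And>m. m \<noteq> n \<Longrightarrow> S m o\<^sub>L J = 0"
  shows "suminf S o\<^sub>L J = S n o\<^sub>L J"
proof -
  have "(\<lambda>m. S m o\<^sub>L J) sums (suminf S o\<^sub>L J)"
    by (rule bounded_linear.sums[OF bounded_bilinear.bounded_linear_left[OF bounded_bilinear_blinfun_compose]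
          summable_sums[OF assms(1)]])
  moreover have "(\<lambda>m. S m o\<^sub>L J) sums (S n o\<^sub>L J)"
    using sums_single[of n "\<lambda>m. S n o\<^sub>L J"] assms(2) by (auto elim!: sums_cong[THEN iffD1, rotated])
  ultimately show ?thesis by (rule sums_unique2)
qed

lemma suminf_compose_single:
  fixes S :: "nat \<Rightarrow> 'a::real_normed_vector \<Rightarrow>\<^sub>L 'b::banach" and Q :: "'b \<Rightarrow>\<^sub>L 'c::banach"
  assumes "summable S" "\<And>m. m \<noteq> n \<Longrightarrow> Q o\<^sub>L S m = 0"
  shows "Q o\<^sub>L suminf S = Q o\<^sub>L S n"
proof -
  have "(\<lambda>m. Q o\<^sub>L S m) sums (Q o\<^sub>L suminf S)"
    by (rule bounded_linear.sums[OF bounded_bilinear.bounded_linear_right[OF bounded_bilinear_blinfun_compose]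
          summable_sums[OF assms(1)]])
  moreover have "(\<lambda>m. Q o\<^sub>L S m) sums (Q o\<^sub>L S n)"
    using sums_single[of n "\<lambda>m. Q o\<^sub>L S n"] assms(2) by (auto elim!: sums_cong[THEN iffD1, rotated])
  ultimately show ?thesis by (rule sums_unique2)
qed

text \<open>
  On coefficient sequences the composition acts as the matrix \<open>\<phi> i (T (g j))\<close>. Its diagonal part
  gives \<open>c\<close> times the projection, and the rest has \<open>i\<close>-th coefficient at most \<open>4 / 2 ^ i\<close>.
\<close>

lemma compress_to_scalar_modulo_weakly_compact:
  fixes T :: "('k::topological_space, 's::{real_normed_field,euclidean_space}) operator"
  assumes T: "T \<in> bounded_ops" and z: "weak_star_null 2 z" and w: "disjoint_unit_sequence w"
    and \<phi>: "weak_star_null b \<phi>" and g: "disjoint_unit_sequence g"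
    and diag: "\<And>i. \<phi> i (T (g i)) = of_real c"
    and off: "\<And>i j. i \<noteq> j \<Longrightarrow> norm (\<phi> i (T (g j))) \<le> (1 / 2) ^ (i + j)"
  shows "(series_operator \<phi> w o\<^sub>L T o\<^sub>L series_operator z g) - c *\<^sub>R series_operator z w \<in> weakly_compact_ops"
    (is "(?X o\<^sub>L T o\<^sub>L ?Y) - c *\<^sub>R ?P \<in> _")
proof (rule rapidly_decreasing_coefficients_weakly_compact[OF _ w])
  show "(?X o\<^sub>L T o\<^sub>L ?Y) - c *\<^sub>R ?P \<in> bounded_ops"
    by (intro bounded_ops_diff bounded_ops_compose bounded_ops_scaleR T
        series_operator_in_bounded_operators[OF \<phi> w] series_operator_in_bounded_operators[OF z g]
        series_operator_in_bounded_operators[OF z w])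
  show "summable (\<lambda>i. 4 * (1 / 2 :: real) ^ i)"
    by (intro summable_mult summable_geometric) simp
  fix f :: "'k \<Rightarrow>\<^sub>C 's" assume f: "norm f \<le> 1"
  define e where "e i = \<phi> i (T (?Y f)) - c *\<^sub>R z i f" for i
  have "norm (e i) \<le> 4 * (1 / 2) ^ i" for i
  proof -
    have "\<phi> i o\<^sub>L T \<in> bounded_functionals bcontfun_scale"
      using T weak_star_nullD(1)[OF \<phi>, of i] by (simp add: bounded_functionals_bcontfun_iff bounded_operators_bcontfun_iff)
    from functional_series_operator[OF z g this, of f]
    have "(\<lambda>j. z j f * \<phi> i (T (g j))) sums \<phi> i (T (?Y f))" by simp
    moreover have "(\<lambda>j. if j = i then c *\<^sub>R z i f else 0) sums (c *\<^sub>R z i f)"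
      by (rule sums_single)
    ultimately have "(\<lambda>j. z j f * \<phi> i (T (g j)) - (if j = i then c *\<^sub>R z i f else 0)) sums e i"
      unfolding e_def by (rule sums_diff)
    moreover have "(\<lambda>j. 2 * (1 / 2) ^ i * (1 / 2 :: real) ^ j) sums (2 * (1 / 2) ^ i * 2)"
      using geometric_sums[of "1 / 2 :: real"] by (intro sums_mult) simp
    moreover have "norm (z j f * \<phi> i (T (g j)) - (if j = i then c *\<^sub>R z i f else 0)) \<le> 2 * (1 / 2) ^ i * (1 / 2) ^ j" for j
    proof (cases "j = i")
      case True
      then show ?thesis by (simp add: diag scaleR_conv_of_real)
    next
      case False
      have "norm (z j f) \<le> 2"
        using weak_star_nullD(4)[OF z, of j f] f by linarith
      then have "norm (z j f) * norm (\<phi> i (T (g j))) \<le> 2 * (1 / 2) ^ (i + j)"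
        using off[of i j] False by (intro mult_mono) auto
      then show ?thesis using False by (simp add: norm_mult power_add)
    qed
    ultimately have "norm (e i) \<le> 2 * (1 / 2) ^ i * 2" by (rule norm_sums_le)
    then show ?thesis by simp
  qed
  moreover have "((?X o\<^sub>L T o\<^sub>L ?Y) - c *\<^sub>R ?P) f = (\<Sum>i. bcontfun_scale (e i) (w i))"
  proof -
    have "((?X o\<^sub>L T o\<^sub>L ?Y) - c *\<^sub>R ?P) f =
        (\<Sum>i. bcontfun_scale (\<phi> i (T (?Y f))) (w i)) - (\<Sum>i. c *\<^sub>R bcontfun_scale (z i f) (w i))"
      by (simp add: blinfun.diff_left blinfun.scaleR_left series_operator_apply[OF \<phi> w] series_operator_apply[OF z w]
          suminf_scaleR_right[OF series_operator_summable[OF z w]])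
    also have "\<dots> = (\<Sum>i. bcontfun_scale (\<phi> i (T (?Y f))) (w i) - c *\<^sub>R bcontfun_scale (z i f) (w i))"
      by (rule suminf_diff[OF series_operator_summable[OF \<phi> w] summable_scaleR_right[OF series_operator_summable[OF z w]]])
    also have "(\<lambda>i. bcontfun_scale (\<phi> i (T (?Y f))) (w i) - c *\<^sub>R bcontfun_scale (z i f) (w i)) = (\<lambda>i. bcontfun_scale (e i) (w i))"
      by (auto simp: e_def left_diff_distrib intro!: bcontfun_eqI)
    finally show ?thesis .
  qed
  ultimately show "\<exists>e. (\<forall>i. norm (e i) \<le> 4 * (1 / 2) ^ i) \<and>
      ((?X o\<^sub>L T o\<^sub>L ?Y) - c *\<^sub>R ?P) f = (\<Sum>i. bcontfun_scale (e i) (w i))" by blast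
qed

text \<open>
  Suppose that there are operators \<open>T k\<close> whose norms \<open>n (T k)\<close> are very small in comparison with their
  dual weak essential norms. The null sequences are split into infinitely many blocks by a pairing
  function. All the operators that move the null sequences to where \<open>T k\<close> is large are combined, with
  weights \<open>1 / 2 ^ k\<close>, into one operator \<open>A\<close> which treats the \<open>k\<close>-th block according to \<open>T k\<close>, and
  those that move them back into one operator \<open>B\<close>. The operators \<open>J k\<close> and \<open>Q k\<close> that select the
  \<open>k\<close>-th block are independent of \<open>T\<close>. So \<open>n (J k)\<close> and \<open>n (Q k)\<close> can be taken into account in the
  choice of \<open>T k\<close>, and \<open>n A\<close> and \<open>n B\<close> are just two constants. The weights cost the factor
  \<open>1 / 4 ^ k\<close>, which the choice of \<open>T k\<close> beats with \<open>1 / 8 ^ k\<close>.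
\<close>

theorem dual_weak_essential_norm_minimal:
  fixes N :: "(('k::topological_space, 's::{real_normed_field,euclidean_space}) operator) set \<Rightarrow> real"
  assumes compact: "compact (UNIV :: 'k set)" and seq_compact: "seq_compact (UNIV :: 'k set)"
    and N: "algebra_norm (weak_Calkin_algebra (bcontfun_scale :: 's \<Rightarrow> ('k \<Rightarrow>\<^sub>C 's) \<Rightarrow> _)) N"
  shows "\<exists>c>0. \<forall>T\<in>bounded_operators bcontfun_scale.
    c * weak_ess_norm dual_scale (adjoint_operator T) \<le> N (weak_Calkin_class bcontfun_scale T)"
proof (rule ccontr)
  assume contra: "\<not> ?thesis"
  define n where "n T = N (weak_Calkin_class bcontfun_scale T)" for T
  define ess where "ess T = weak_ess_norm dual_scale (adjoint_operator T)" for T :: "('k, 's) operator"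
  have n_nonneg: "0 \<le> n T" and n_zero: "n T = 0 \<longleftrightarrow> T \<in> weakly_compact_ops" if "T \<in> bounded_ops" for T
    using N weak_Calkin_class_carrier[OF that] unfolding algebra_norm_def n_def
    by (auto simp: weak_Calkin_class_eq_zero_iff[symmetric])
  have n_mult: "n (S o\<^sub>L T) \<le> n S * n T" if "S \<in> bounded_ops" "T \<in> bounded_ops" for S T
    using N weak_Calkin_class_carrier[OF that(1)] weak_Calkin_class_carrier[OF that(2)]
    unfolding algebra_norm_def n_def weak_Calkin_mult[OF that, symmetric] by blast
  have n_scaleR: "n (r *\<^sub>R T) = \<bar>r\<bar> * n T" if "T \<in> bounded_ops" for r T
  proof -
    have "\<forall>c. \<forall>x\<in>carrier (weak_Calkin_algebra bcontfun_scale).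
        N (c \<odot>\<^bsub>weak_Calkin_algebra bcontfun_scale\<^esub> x) = norm (c :: 's) * N x"
      using N by (simp add: algebra_norm_def)
    from this[rule_format, OF weak_Calkin_class_carrier[OF that], of "of_real r"]
    show ?thesis unfolding n_def by (simp add: weak_Calkin_smult_of_real[OF that])
  qed
  have n_cong: "n S = n T" if "S - T \<in> weakly_compact_ops" for S T
    using that by (simp add: n_def weak_Calkin_class_eq_iff[symmetric])
  have small: "\<exists>T. T \<in> bounded_ops \<and> n T < c * ess T \<and> 0 < ess T" if c: "0 < c" for c
  proof -
    obtain T where T: "T \<in> bounded_ops" "n T < c * ess T"
      using contra c unfolding n_def ess_def by (meson linorder_not_le)
    then have "0 < c * ess T" using n_nonneg[OF T(1)] by linarith
    then show ?thesis using T c by (auto simp: zero_less_mult_iff)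
  qed
  \<comment> \<open>a fixed copy of the null sequences\<close>
  obtain T0 where T0: "T0 \<in> bounded_ops" "0 < ess T0" using small[of 1] by auto
  obtain \<phi>0 :: "nat \<Rightarrow> ('k, 's) functional" and g0 where g0: "disjoint_unit_sequence g0" and \<phi>0: "\<And>i. \<phi>0 i (T0 (g0 i)) = of_real (ess T0)"
    by (rule essential_operator_fixes_null_sequences[OF compact seq_compact T0(1) ess_def T0(2)]) blast
  have "g0 i \<noteq> 0" for i using \<phi>0[of i] T0(2) by auto
  then obtain y :: "nat \<Rightarrow> 'k" and l and w :: "nat \<Rightarrow> 'k \<Rightarrow>\<^sub>C 's" where y: "y \<longlonglongrightarrow> l" and w: "disjoint_unit_sequence w"
    and pairing: "\<And>i j. w j (y i) = (if i = j then 1 else 0)" and w_l: "\<And>j. w j l = 0"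
    using biorthogonal_system[OF compact seq_compact g0] by blast
  define z where "z i = (point_evaluation (y i) - point_evaluation l :: ('k, 's) functional)" for i
  have z: "weak_star_null 2 z" unfolding z_def by (rule weak_star_null_point_differences[OF y])
  have zw: "z i (w j) = (if i = j then 1 else 0)" for i j
    by (simp add: z_def blinfun.diff_left pairing w_l)
  \<comment> \<open>\<open>enc k\<close> enumerates the \<open>k\<close>-th block of indices\<close>
  define enc where "enc k i = prod_encode (k, i)" for k i
  have enc_eq: "enc k i = enc m j \<longleftrightarrow> k = m \<and> i = j" for k i m j by (simp add: enc_def)
  have w_enc: "disjoint_unit_sequence (\<lambda>i. w (enc k i))" for k
    by (rule disjoint_unit_sequence_comp[OF w]) (simp add: inj_def enc_eq)
  have z_enc: "weak_star_null 2 (\<lambda>i. z (enc k i))" for k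
  proof (rule weak_star_null_comp[OF z])
    show "filterlim (enc k) at_top sequentially"
      by (rule filterlim_at_top_mono[OF filterlim_ident]) (simp add: enc_def le_prod_encode_2)
  qed
  define P where "P = series_operator z w"
  have P: "P \<in> bounded_ops" unfolding P_def by (rule series_operator_in_bounded_operators[OF z w])
  have scale01: "bcontfun_scale 1 h = h" "bcontfun_scale 0 h = 0" for h :: "'k \<Rightarrow>\<^sub>C 's"
    by (auto intro!: bcontfun_eqI)
  have "P (w j) = w j" for j
  proof -
    have "bcontfun_scale (z i (w j)) (w i) = (if i = j then w j else 0)" for i
      by (simp add: zw scale01)
    then show ?thesis
      using sums_unique[OF sums_single[of j "\<lambda>i. w j"]] by (simp add: P_def series_operator_apply[OF z w])
  qed
  then have "P \<notin> weakly_compact_ops"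
    by (rule projection_not_weakly_compact[OF y w pairing w_l])
  then have n_P: "0 < n P" using n_zero[OF P] n_nonneg[OF P] by simp
  define Q where "Q k = series_operator (\<lambda>i. z (enc k i)) w" for k
  define J where "J k = series_operator z (\<lambda>i. w (enc k i))" for k
  have Q: "Q k \<in> bounded_ops" and J: "J k \<in> bounded_ops" for k
    unfolding Q_def J_def by (rule series_operator_in_bounded_operators[OF z_enc w]
        series_operator_in_bounded_operators[OF z w_enc])+
  \<comment> \<open>the cost of selecting the \<open>k\<close>-th block, known before \<open>T k\<close> is chosen\<close>
  define K where "K k = 1 + n (Q k) * n (J k)" for k
  have K: "0 < K k" for k
    using n_nonneg[OF Q[of k]] n_nonneg[OF J[of k]] by (simp add: K_def add_pos_nonneg)
  have "\<exists>T. T \<in> bounded_ops \<and> n T < (1 / 8) ^ k / K k * ess T \<and> 0 < ess T" for k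
    by (rule small) (simp add: K)
  then obtain T where T: "\<And>k. T k \<in> bounded_ops" and T_small: "\<And>k. n (T k) < (1 / 8) ^ k / K k * ess (T k)"
    and ess_pos: "\<And>k. 0 < ess (T k)" by metis
  have "\<exists>\<phi> g. weak_star_null 16 \<phi> \<and> disjoint_unit_sequence g \<and> (\<forall>i. \<phi> i (T k (g i)) = of_real (ess (T k))) \<and>
      (\<forall>i j. i \<noteq> j \<longrightarrow> norm (\<phi> i (T k (g j))) \<le> (1 / 2) ^ (i + j))" for k
    by (rule essential_operator_fixes_null_sequences[OF compact seq_compact T[of k] ess_def ess_pos[of k]]) blast
  then obtain \<phi> g where \<phi>: "\<And>k. weak_star_null 16 (\<phi> k)" and g: "\<And>k. disjoint_unit_sequence (g k)"
    and diag: "\<And>k i. \<phi> k i (T k (g k i)) = of_real (ess (T k))"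
    and off: "\<And>k i j. i \<noteq> j \<Longrightarrow> norm (\<phi> k i (T k (g k j))) \<le> (1 / 2) ^ (i + j)" by metis
  define SA where "SA k = (1 / 2) ^ k *\<^sub>R series_operator (\<lambda>i. z (enc k i)) (g k)" for k
  define SB where "SB k = (1 / 2) ^ k *\<^sub>R series_operator (\<phi> k) (\<lambda>i. w (enc k i))" for k
  have geometric: "summable S" if "\<And>k. norm (S k) \<le> (1 / 2) ^ k * b"
    for S :: "nat \<Rightarrow> ('k, 's) operator" and b
    by (rule summable_comparison_test'[OF _ that]) (intro summable_mult2 summable_geometric, simp)
  have SA: "summable SA"
    by (rule geometric[of _ 2])
      (simp add: SA_def norm_series_operator_le[OF z_enc g])
  have SB: "summable SB"
    by (rule geometric[of _ 16])
      (simp add: SB_def norm_series_operator_le[OF \<phi> w_enc])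
  have SA_bounded: "SA k \<in> bounded_ops" and SB_bounded: "SB k \<in> bounded_ops" for k
    unfolding SA_def SB_def
    by (intro bounded_ops_scaleR series_operator_in_bounded_operators[OF z_enc g]
        series_operator_in_bounded_operators[OF \<phi> w_enc])+
  define A where "A = suminf SA"
  define B where "B = suminf SB"
  have A: "A \<in> bounded_ops" and B: "B \<in> bounded_ops"
    unfolding A_def B_def by (intro suminf_bounded_operators SA SB SA_bounded SB_bounded)+
  have scale_compose: "(r *\<^sub>R U) o\<^sub>L V = r *\<^sub>R (U o\<^sub>L V)" "U o\<^sub>L (r *\<^sub>R V) = r *\<^sub>R (U o\<^sub>L V)"
    for r and U V :: "('k, 's) operator"
    by (rule blinfun_eqI; simp add: blinfun.scaleR_left blinfun.scaleR_right)+
  have AJ: "A o\<^sub>L J k = (1 / 2) ^ k *\<^sub>R series_operator z (g k)" for k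
  proof -
    have "SA m o\<^sub>L J k = 0" if "m \<noteq> k" for m
      unfolding SA_def J_def scale_compose
      by (subst series_operator_compose_orthogonal[OF z_enc g z w_enc]) (use that in \<open>simp_all add: zw enc_eq\<close>)
    then have "A o\<^sub>L J k = SA k o\<^sub>L J k"
      unfolding A_def by (rule compose_suminf_single[OF SA])
    also have "\<dots> = (1 / 2) ^ k *\<^sub>R series_operator z (g k)"
      unfolding SA_def J_def scale_compose
      by (subst series_operator_compose_biorthogonal[OF z_enc g z w_enc]) (simp_all add: zw enc_eq)
    finally show ?thesis .
  qed
  have QB: "Q k o\<^sub>L B = (1 / 2) ^ k *\<^sub>R series_operator (\<phi> k) w" for k
  proof -
    have "Q k o\<^sub>L SB m = 0" if "m \<noteq> k" for m
      unfolding SB_def Q_def scale_compose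
      by (subst series_operator_compose_orthogonal[OF z_enc w \<phi> w_enc]) (use that in \<open>simp_all add: zw enc_eq\<close>)
    then have "Q k o\<^sub>L B = Q k o\<^sub>L SB k"
      unfolding B_def by (rule suminf_compose_single[OF SB])
    also have "\<dots> = (1 / 2) ^ k *\<^sub>R series_operator (\<phi> k) w"
      unfolding SB_def Q_def scale_compose
      by (subst series_operator_compose_biorthogonal[OF z_enc w \<phi> w_enc]) (simp_all add: zw enc_eq)
    finally show ?thesis .
  qed
  have bound: "n P \<le> n A * n B * (1 / 2) ^ k" for k
  proof -
    define D where "D = series_operator (\<phi> k) w o\<^sub>L T k o\<^sub>L series_operator z (g k)"
    have D: "D \<in> bounded_ops"
      unfolding D_def by (intro bounded_ops_compose T series_operator_in_bounded_operators[OF \<phi> w]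
          series_operator_in_bounded_operators[OF z g])
    have "n D = n (ess (T k) *\<^sub>R P)"
      unfolding D_def P_def
      by (rule n_cong[OF compress_to_scalar_modulo_weakly_compact[OF T z w \<phi> g diag off]])
    then have n_D: "n D = ess (T k) * n P" using ess_pos[of k] by (simp add: n_scaleR[OF P])
    have "(Q k o\<^sub>L B) o\<^sub>L (T k o\<^sub>L (A o\<^sub>L J k)) = (1 / 4) ^ k *\<^sub>R D"
      unfolding AJ QB scale_compose D_def
      by (rule blinfun_eqI) (simp add: blinfun.scaleR_left power_mult_distrib[symmetric])
    then have "n ((Q k o\<^sub>L B) o\<^sub>L (T k o\<^sub>L (A o\<^sub>L J k))) = (1 / 4) ^ k * (ess (T k) * n P)"
      by (simp add: n_scaleR[OF D] n_D)
    moreover have "n ((Q k o\<^sub>L B) o\<^sub>L (T k o\<^sub>L (A o\<^sub>L J k))) \<le> (n (Q k) * n B) * (n (T k) * (n A * n (J k)))"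
      by (rule order_trans[OF n_mult] mult_mono n_mult n_nonneg order_refl mult_nonneg_nonneg
          bounded_ops_compose Q B T A J)+
    moreover have "(n (Q k) * n B) * (n (T k) * (n A * n (J k))) = (n A * n B) * (n (Q k) * n (J k)) * n (T k)"
      by (simp add: mult_ac)
    moreover have "(n A * n B) * (n (Q k) * n (J k)) * n (T k) \<le> (n A * n B) * K k * ((1 / 8) ^ k / K k * ess (T k))"
      using T_small[of k] K[of k]
      by (intro mult_mono mult_nonneg_nonneg n_nonneg A B T Q J) (simp_all add: K_def)
    moreover have "(n A * n B) * K k * ((1 / 8) ^ k / K k * ess (T k)) = (1 / 4) ^ k * (ess (T k) * (n A * n B * (1 / 2) ^ k))"
      using K[of k] by (simp add: power_mult_distrib[symmetric] mult_ac)
    ultimately have "(1 / 4) ^ k * (ess (T k) * n P) \<le> (1 / 4) ^ k * (ess (T k) * (n A * n B * (1 / 2) ^ k))"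
      by linarith
    then have "ess (T k) * n P \<le> ess (T k) * (n A * n B * (1 / 2) ^ k)"
      by (rule mult_left_le_imp_le) simp
    then show ?thesis using ess_pos[of k] by (rule mult_left_le_imp_le)
  qed
  have "(\<lambda>k. n A * n B * (1 / 2) ^ k) \<longlonglongrightarrow> 0"
    by (intro tendsto_mult_right_zero LIMSEQ_power_zero) simp
  then have "n P \<le> 0"
    by (rule LIMSEQ_le_const) (use bound in auto)
  then show False using n_P by simp
qed

theorem corollary1p9:
  assumes "compact (UNIV :: 'k::t2_space set)"
    and "seq_compact (UNIV :: 'k set)"
  shows "(\<forall>N. algebra_norm (weak_Calkin_algebra
              (bcontfun_scale :: real \<Rightarrow> ('k \<Rightarrow>\<^sub>C real) \<Rightarrow> ('k \<Rightarrow>\<^sub>C real))) N \<longrightarrow>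
            (\<exists>c>0. \<forall>T\<in>bounded_operators bcontfun_scale.
              c * weak_ess_norm dual_scale (adjoint_operator T)
                \<le> N (weak_Calkin_class bcontfun_scale T))) \<and>
         (\<forall>N. algebra_norm (weak_Calkin_algebra
              (bcontfun_scale :: complex \<Rightarrow> ('k \<Rightarrow>\<^sub>C complex) \<Rightarrow> ('k \<Rightarrow>\<^sub>C complex))) N \<longrightarrow>
            (\<exists>c>0. \<forall>T\<in>bounded_operators bcontfun_scale.
              c * weak_ess_norm dual_scale (adjoint_operator T)
                \<le> N (weak_Calkin_class bcontfun_scale T)))"
proof (intro conjI allI impI)
  fix N assume "algebra_norm (weak_Calkin_algebra (bcontfun_scale :: real \<Rightarrow> ('k \<Rightarrow>\<^sub>C real) \<Rightarrow> ('k \<Rightarrow>\<^sub>C real))) N"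
  then show "\<exists>c>0. \<forall>T\<in>bounded_operators bcontfun_scale.
      c * weak_ess_norm dual_scale (adjoint_operator T) \<le> N (weak_Calkin_class bcontfun_scale T)"
    by (rule dual_weak_essential_norm_minimal[OF assms])
next
  fix N assume "algebra_norm (weak_Calkin_algebra (bcontfun_scale :: complex \<Rightarrow> ('k \<Rightarrow>\<^sub>C complex) \<Rightarrow> ('k \<Rightarrow>\<^sub>C complex))) N"
  then show "\<exists>c>0. \<forall>T\<in>bounded_operators bcontfun_scale.
      c * weak_ess_norm dual_scale (adjoint_operator T) \<le> N (weak_Calkin_class bcontfun_scale T)"
    by (rule dual_weak_essential_norm_minimal[OF assms])
qed

end
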